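(* Let $k$ be a field and $n\geq1$. Let $U=\{g(t_1)\cdots g(t_n): g(x)\in k[x],\ g(0)\neq0\}$, a multiplicatively closed subset of $k[s_1(t),\dots,s_n(t)]$, and $H_n=U^{-1}k[s_1(t),\dots,s_n(t)]$. For a $k$-algebra homomorphism $\psi\colon H_n\to A$, write $F_n^\psi(x)=x^n-\psi(s_1(t))x^{n-1}+\cdots+(-1)^n\psi(s_n(t))\in A[x]$. Then for every $k$-algebra $A$, the ideal $(F_n^\psi(x))$ of $A\otimes_k k[x]_{(x)}$ lies in $\mathcal{H}ilb_a^n(A)$, and the map $$\mathcal F(A)\colon \operatorname{Hom}_{k\text{-alg}}(H_n,A)\to\mathcal{H}ilb_a^n(A),\qquad \psi\mapsto (F_n^\psi(x)),$$ is a bijection; these maps form an isomorphism of functors from $k$-algebras to sets. Equivalently, $H_n$ represents the functor $\mathcal{H}ilb_a^n$.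
   Context: $k[t_1,\dots,t_n]$ is a polynomial ring over the field $k$, and $s_i(t)$ is the $i$-th elementary symmetric polynomial in $t_1,\dots,t_n$. $k[x]_{(x)}$ is the localization of $k[x]$ at the multiplicative set of polynomials $g(x)$ with $g(0)\neq0$, and $A[x]=A\otimes_k k[x]$. The affine Hilbert functor $\mathcal{H}ilb_a^n$ from $k$-algebras to sets sends a $k$-algebra $A$ to the set of ideals $I$ of $A\otimes_k k[x]_{(x)}$ such that $A\otimes_k k[x]_{(x)}/I$ is a free $A$-module of rank $n$ (and acts on morphisms $A\to B$ by extension of ideals). *)

theory Defs
  imports "HOL-Algebra.Algebra" "HOL-Library.Poly_Mapping" "HOL-Computational_Algebra.Polynomial"
begin

definition type_ring :: "'a::comm_ring_1 ring" where
  "type_ring = \<lparr>carrier = UNIV, monoid.mult = (*), one = 1, ring.zero = 0, add = (+)\<rparr>"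

definition loc_rel :: "('a,'m) ring_scheme \<Rightarrow> 'a set \<Rightarrow> 'a \<times> 'a \<Rightarrow> 'a \<times> 'a \<Rightarrow> bool" where
  "loc_rel R S p q \<longleftrightarrow> fst p \<in> carrier R \<and> snd p \<in> S \<and> fst q \<in> carrier R \<and> snd q \<in> S \<and>
     (\<exists>u\<in>S. u \<otimes>\<^bsub>R\<^esub> ((fst p \<otimes>\<^bsub>R\<^esub> snd q) \<ominus>\<^bsub>R\<^esub> (fst q \<otimes>\<^bsub>R\<^esub> snd p)) = \<zero>\<^bsub>R\<^esub>)"

definition loc_frac :: "('a,'m) ring_scheme \<Rightarrow> 'a set \<Rightarrow> 'a \<Rightarrow> 'a \<Rightarrow> ('a \<times> 'a) set" where
  "loc_frac R S r s = {q. loc_rel R S (r, s) q}"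

definition loc :: "('a,'m) ring_scheme \<Rightarrow> 'a set \<Rightarrow> ('a \<times> 'a) set ring" where
  "loc R S = \<lparr>carrier = {loc_frac R S r s | r s. r \<in> carrier R \<and> s \<in> S},
     monoid.mult = (\<lambda>XX YY. \<Union>p\<in>XX. \<Union>q\<in>YY. loc_frac R S (fst p \<otimes>\<^bsub>R\<^esub> fst q) (snd p \<otimes>\<^bsub>R\<^esub> snd q)),
     one = loc_frac R S \<one>\<^bsub>R\<^esub> \<one>\<^bsub>R\<^esub>,
     ring.zero = loc_frac R S \<zero>\<^bsub>R\<^esub> \<one>\<^bsub>R\<^esub>,
     add = (\<lambda>XX YY. \<Union>p\<in>XX. \<Union>q\<in>YY.
              loc_frac R S ((fst p \<otimes>\<^bsub>R\<^esub> snd q) \<oplus>\<^bsub>R\<^esub> (fst q \<otimes>\<^bsub>R\<^esub> snd p)) (snd p \<otimes>\<^bsub>R\<^esub> snd q))\<rparr>"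

text \<open>Map S^{-1}R \<rightarrow> S'^{-1}R' induced by h : R \<rightarrow> R' with h(S) \<subseteq> S': r/s \<mapsto> h r / h s.\<close>
definition loc_map :: "('b,'n) ring_scheme \<Rightarrow> 'b set \<Rightarrow> ('a \<Rightarrow> 'b) \<Rightarrow> ('a \<times> 'a) set \<Rightarrow> ('b \<times> 'b) set" where
  "loc_map R' S' h XX = (\<Union>p\<in>XX. loc_frac R' S' (h (fst p)) (h (snd p)))"

text \<open>A k-algebra is a commutative ring A with a structure ring homomorphism k \<rightarrow> A.\<close>
definition kalg_hom :: "('a,'m) ring_scheme \<Rightarrow> ('k \<Rightarrow> 'a) \<Rightarrow> ('b,'n) ring_scheme \<Rightarrow> ('k \<Rightarrow> 'b) \<Rightarrow> ('a \<Rightarrow> 'b) \<Rightarrow> bool" where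
  "kalg_hom R \<phi>R A \<phi>A \<psi> \<longleftrightarrow> \<psi> \<in> ring_hom R A \<and> (\<forall>c. \<psi> (\<phi>R c) = \<phi>A c)"

section \<open>Polynomials in t_1,...,t_n (variables indexed 0..n-1), symmetric functions, H_n\<close>

type_synonym 'k mpoly = "(nat \<Rightarrow>\<^sub>0 nat) \<Rightarrow>\<^sub>0 'k"

definition mvar :: "nat \<Rightarrow> 'k::comm_ring_1 mpoly" where
  "mvar i = Poly_Mapping.single (Poly_Mapping.single i 1) 1"

definition mconst :: "'k::comm_ring_1 \<Rightarrow> 'k mpoly" where
  "mconst c = Poly_Mapping.single 0 c"

definition esym :: "nat \<Rightarrow> nat \<Rightarrow> 'k::comm_ring_1 mpoly" where
  "esym n i = (\<Sum>T\<in>{T. T \<subseteq> {..<n} \<and> card T = i}. \<Prod>j\<in>T. mvar j)"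

definition Uset :: "nat \<Rightarrow> 'k::field mpoly set" where
  "Uset n = {(\<Prod>i<n. poly (map_poly mconst g) (mvar i)) | g. poly g 0 \<noteq> 0}"

definition SymR :: "nat \<Rightarrow> 'k::field mpoly ring" where
  "SymR n = type_ring\<lparr>carrier := generate_ring type_ring (range mconst \<union> esym n ` {1..n})\<rparr>"

definition Hn :: "nat \<Rightarrow> ('k::field mpoly \<times> 'k mpoly) set ring" where
  "Hn n = loc (SymR n) (Uset n)"

definition Hn_alg :: "nat \<Rightarrow> 'k::field \<Rightarrow> ('k mpoly \<times> 'k mpoly) set" where
  "Hn_alg n c = loc_frac (SymR n) (Uset n) (mconst c) 1"

definition Hn_s :: "nat \<Rightarrow> nat \<Rightarrow> ('k::field mpoly \<times> 'k mpoly) set" where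
  "Hn_s n i = loc_frac (SymR n) (Uset n) (esym n i) 1"

definition HomH :: "nat \<Rightarrow> ('a,'m) ring_scheme \<Rightarrow> ('k::field \<Rightarrow> 'a)
    \<Rightarrow> (('k mpoly \<times> 'k mpoly) set \<Rightarrow> 'a) set" where
  "HomH n A \<phi> = {\<psi>. kalg_hom (Hn n) (Hn_alg n) A \<phi> \<psi> \<and> \<psi> \<in> extensional (carrier (Hn n))}"

section \<open>A \<otimes>_k k[x]_(x), realised as the localization of A[x] at the images of g(x), g(0) \<noteq> 0\<close>

definition Sx :: "('a,'m) ring_scheme \<Rightarrow> ('k::field \<Rightarrow> 'a) \<Rightarrow> (nat \<Rightarrow> 'a) set" where
  "Sx A \<phi> = {(\<lambda>i. \<phi> (Polynomial.coeff g i)) | g. poly g 0 \<noteq> 0}"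

definition Lx :: "('a,'m) ring_scheme \<Rightarrow> ('k::field \<Rightarrow> 'a) \<Rightarrow> ((nat \<Rightarrow> 'a) \<times> (nat \<Rightarrow> 'a)) set ring" where
  "Lx A \<phi> = loc (UP A) (Sx A \<phi>)"

text \<open>The A-module structure: a \<cdot> f = (a/1) f.\<close>
definition Lx_scalar :: "('a,'m) ring_scheme \<Rightarrow> ('k::field \<Rightarrow> 'a) \<Rightarrow> 'a \<Rightarrow> ((nat \<Rightarrow> 'a) \<times> (nat \<Rightarrow> 'a)) set" where
  "Lx_scalar A \<phi> a = loc_frac (UP A) (Sx A \<phi>) (up_ring.monom (UP A) a 0) \<one>\<^bsub>UP A\<^esub>"

definition free_quot_rank :: "nat \<Rightarrow> ('a,'m) ring_scheme \<Rightarrow> ('k::field \<Rightarrow> 'a)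
     \<Rightarrow> ((nat \<Rightarrow> 'a) \<times> (nat \<Rightarrow> 'a)) set set \<Rightarrow> bool" where
  "free_quot_rank n A \<phi> I \<longleftrightarrow>
     (\<exists>b. b \<in> {..<n} \<rightarrow> carrier (Lx A \<phi>) \<and>
        (\<forall>f\<in>carrier (Lx A \<phi>). \<exists>!c. c \<in> {..<n} \<rightarrow>\<^sub>E carrier A \<and>
            f \<ominus>\<^bsub>Lx A \<phi>\<^esub> (\<Oplus>\<^bsub>Lx A \<phi>\<^esub> i\<in>{..<n}. Lx_scalar A \<phi> (c i) \<otimes>\<^bsub>Lx A \<phi>\<^esub> b i) \<in> I))"

definition Hilb :: "nat \<Rightarrow> ('a,'m) ring_scheme \<Rightarrow> ('k::field \<Rightarrow> 'a)
     \<Rightarrow> ((nat \<Rightarrow> 'a) \<times> (nat \<Rightarrow> 'a)) set set set" where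
  "Hilb n A \<phi> = {I. ideal I (Lx A \<phi>) \<and> free_quot_rank n A \<phi> I}"

definition Hilb_map :: "('b,'n) ring_scheme \<Rightarrow> ('k::field \<Rightarrow> 'b) \<Rightarrow> ('a \<Rightarrow> 'b)
     \<Rightarrow> ((nat \<Rightarrow> 'a) \<times> (nat \<Rightarrow> 'a)) set set \<Rightarrow> ((nat \<Rightarrow> 'b) \<times> (nat \<Rightarrow> 'b)) set set" where
  "Hilb_map B \<phi>B h I = genideal (Lx B \<phi>B) (loc_map (UP B) (Sx B \<phi>B) (\<lambda>p i. h (p i)) ` I)"

definition Fpoly :: "nat \<Rightarrow> ('a,'m) ring_scheme \<Rightarrow> (('k::field mpoly \<times> 'k mpoly) set \<Rightarrow> 'a) \<Rightarrow> nat \<Rightarrow> 'a" where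
  "Fpoly n A \<psi> = (\<lambda>j. if j \<le> n then
       (if even (n - j) then \<psi> (Hn_s n (n - j)) else \<ominus>\<^bsub>A\<^esub> \<psi> (Hn_s n (n - j)))
     else \<zero>\<^bsub>A\<^esub>)"

definition Fmap :: "nat \<Rightarrow> ('a,'m) ring_scheme \<Rightarrow> ('k::field \<Rightarrow> 'a)
     \<Rightarrow> (('k mpoly \<times> 'k mpoly) set \<Rightarrow> 'a) \<Rightarrow> ((nat \<Rightarrow> 'a) \<times> (nat \<Rightarrow> 'a)) set set" where
  "Fmap n A \<phi> \<psi> = genideal (Lx A \<phi>) {loc_frac (UP A) (Sx A \<phi>) (Fpoly n A \<psi>) \<one>\<^bsub>UP A\<^esub>}"

end

theory Submission
  imports "Jordan_Normal_Form.Char_Poly" "HOL-Computational_Algebra.Fraction_Field"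
    "HOL-Algebra.Algebraic_Closure_Type" Defs
begin

text \<open>
  Write \<open>L\<close> for the localization of \<open>A[x]\<close>. A homomorphism \<open>\<psi>\<close> gives a monic polynomial \<open>F\<close> of degree \<open>n\<close>. Let \<open>M\<close> be
  the matrix of multiplication by \<open>g(x)\<close> modulo the generic monic polynomial
  \<open>x\<^sup>n - y\<^sub>1 x\<^bsup>n-1\<^esup> + \<dots>\<close> over \<open>k[y\<^sub>1, \<dots>, y\<^sub>n]\<close>. Substituting \<open>y\<^sub>i = s\<^sub>i(t)\<close>, the Vandermonde matrix of the \<open>t\<^sub>l\<close>
  diagonalizes \<open>M\<close>, so \<open>det M\<close> becomes \<open>g(t\<^sub>1) \<cdots> g(t\<^sub>n)\<close>, and the adjugate of \<open>M\<close> exhibits \<open>det M\<close> as a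
  combination of \<open>g\<close> and the generic polynomial. Since \<open>\<psi>\<close> inverts \<open>g(t\<^sub>1) \<cdots> g(t\<^sub>n)\<close>, every denominator \<open>g\<close> of \<open>L\<close> is
  invertible modulo \<open>F\<close>; hence \<open>1, x, \<dots>, x\<^bsup>n-1\<^esup>\<close> is a basis of \<open>L/(F)\<close>, and \<open>F\<close> is determined by the ideal.

  Conversely let \<open>L/I\<close> be free of rank \<open>n\<close>. By the determinant trick every element of \<open>L/I\<close> is a root of a
  monic polynomial of degree \<open>n\<close>; for the inverse of a denominator \<open>g\<close> this shows that it lies in the image of
  \<open>A[x]\<close>, and for \<open>x\<close> it shows that \<open>1, x, \<dots>, x\<^bsup>n-1\<^esup>\<close> span. A spanning family of \<open>n\<close> elements of a free
  module of rank \<open>n\<close> is a basis, so \<open>I = (F)\<close> for a monic \<open>F\<close> of degree \<open>n\<close>. Multiplication by \<open>g\<close> being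
  invertible on \<open>L/I\<close>, its determinant is a unit, so the assignment of the coefficients of \<open>F\<close> to the \<open>s\<^sub>i(t)\<close>,
  which exists because the \<open>s\<^sub>i(t)\<close> are algebraically independent, extends to the localization \<open>H\<^sub>n\<close>.
\<close>

section \<open>Homomorphisms from type-class rings\<close>

lemma type_ring_simps [simp]:
  "carrier type_ring = UNIV" "x \<otimes>\<^bsub>type_ring\<^esub> y = x * y" "x \<oplus>\<^bsub>type_ring\<^esub> y = x + y"
  "\<one>\<^bsub>type_ring\<^esub> = 1" "\<zero>\<^bsub>type_ring\<^esub> = 0"
  by (simp_all add: type_ring_def)

lemma cring_type_ring: "cring (type_ring :: 'a::comm_ring_1 ring)"
  by (rule cringI; (rule abelian_groupI comm_monoidI)?)
    (auto simp: algebra_simps intro: add.right_inverse)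

lemma a_inv_type_ring [simp]: "\<ominus>\<^bsub>type_ring\<^esub> x = - (x :: 'a::comm_ring_1)"
proof -
  interpret cring "type_ring :: 'a ring" by (rule cring_type_ring)
  show ?thesis by (rule minus_equality) auto
qed

lemma finsum_type_ring: "finsum type_ring f S = (\<Sum>x\<in>S. f x :: 'a::comm_ring_1)"
proof -
  interpret cring "type_ring :: 'a ring" by (rule cring_type_ring)
  show ?thesis by (induction S rule: infinite_finite_induct) auto
qed

lemma finprod_type_ring: "finprod type_ring f S = (\<Prod>x\<in>S. f x :: 'a::comm_ring_1)"
proof -
  interpret cring "type_ring :: 'a ring" by (rule cring_type_ring)
  show ?thesis by (induction S rule: infinite_finite_induct) auto
qed

lemma pow_type_ring: "x [^]\<^bsub>type_ring\<^esub> (n::nat) = (x :: 'a::comm_ring_1) ^ n"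
proof -
  interpret cring "type_ring :: 'a ring" by (rule cring_type_ring)
  show ?thesis by (induction n) (auto simp: mult.commute)
qed

text \<open>Polynomial and determinant computations are carried out over commutative ring types,
  while \<open>A\<close> is an arbitrary ring given by a carrier. Identities proved in the type are
  carried into \<open>A\<close> by such an \<open>h\<close>.\<close>

locale type_hom = A?: cring A for A (structure) +
  fixes h :: "'r::comm_ring_1 \<Rightarrow> 'a"
  assumes hom: "h \<in> ring_hom type_ring A"
begin

lemma closed [simp, intro]: "h x \<in> carrier A"
  using ring_hom_closed[OF hom] by simp

lemma hom_one [simp]: "h 1 = \<one>"
  using ring_hom_one[OF hom] by simp

lemma hom_add [simp]: "h (x + y) = h x \<oplus> h y"
  using ring_hom_add[OF hom] by simp

lemma hom_mult [simp]: "h (x * y) = h x \<otimes> h y"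
  using ring_hom_mult[OF hom] by simp

lemma hom_zero [simp]: "h 0 = \<zero>"
proof -
  have "h 0 \<oplus> h 0 = h 0" using hom_add[of 0 0] by simp
  then show ?thesis by (simp add: A.add.r_cancel_one')
qed

lemma hom_uminus [simp]: "h (- x) = \<ominus> h x"
  using hom_add[of "- x" x] by (intro A.minus_equality[symmetric]) auto

lemma hom_diff [simp]: "h (x - y) = h x \<ominus> h y"
  using hom_add[of x "- y"] by (simp add: a_minus_def)

lemma hom_power: "h (x ^ n) = h x [^] n"
  by (induction n) (auto simp: A.m_comm)

lemma hom_sum: "h (sum f S) = (\<Oplus>i\<in>S. h (f i))"
  by (induction S rule: infinite_finite_induct) auto

lemma hom_prod: "h (prod f S) = (\<Otimes>i\<in>S. h (f i))"
  by (induction S rule: infinite_finite_induct) auto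

lemma hom_Pi [simp, intro]: "(\<lambda>i. h (f i)) \<in> S \<rightarrow> carrier A"
  by auto

end

lemma type_homI:
  assumes "cring A" "\<And>x. h x \<in> carrier A" "h 1 = \<one>\<^bsub>A\<^esub>"
    "\<And>x y. h (x + y) = h x \<oplus>\<^bsub>A\<^esub> h y" "\<And>x y. h (x * y) = h x \<otimes>\<^bsub>A\<^esub> h y"
  shows "type_hom A h"
  using assms by (auto simp: type_hom_def type_hom_axioms_def ring_hom_def)

lemma type_hom_comp:
  assumes "type_hom A h" "cring B" "g \<in> ring_hom A B"
  shows "type_hom B (\<lambda>x. g (h x))"
proof -
  interpret type_hom A h by fact
  show ?thesis
    by (rule type_homI)
      (use assms(2,3) in \<open>auto simp: ring_hom_closed[OF assms(3)] ring_hom_one[OF assms(3)]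
         ring_hom_add[OF assms(3)] ring_hom_mult[OF assms(3)]\<close>)
qed

section \<open>Evaluation of multivariate polynomials\<close>

definition pvar :: "'i \<Rightarrow> ('i \<Rightarrow>\<^sub>0 nat) \<Rightarrow>\<^sub>0 'c::comm_ring_1" where
  "pvar i = Poly_Mapping.single (Poly_Mapping.single i 1) 1"

definition pconst :: "'c \<Rightarrow> ('i \<Rightarrow>\<^sub>0 nat) \<Rightarrow>\<^sub>0 'c::comm_ring_1" where
  "pconst c = Poly_Mapping.single 0 c"

lemma mvar_eq_pvar: "mvar = pvar"
  by (simp add: fun_eq_iff mvar_def pvar_def)

lemma mconst_eq_pconst: "mconst = pconst"
  by (simp add: fun_eq_iff mconst_def pconst_def)

lemma update_eq_add:
  "a \<notin> Poly_Mapping.keys f \<Longrightarrow> Poly_Mapping.update a b f = f + Poly_Mapping.single a (b :: 'b::monoid_add)"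
  by (rule poly_mapping_eqI) (auto simp: lookup_add lookup_update lookup_single when_def in_keys_iff)

text \<open>Constants and variables generate the polynomial ring: a monomial is assembled one
  variable power at a time, and a polynomial one term at a time.\<close>

lemma mpoly_induct [case_names const var add mult]:
  fixes p :: "('i \<Rightarrow>\<^sub>0 nat) \<Rightarrow>\<^sub>0 'c::comm_ring_1"
  assumes const: "\<And>c. P (pconst c)" and var: "\<And>i. P (pvar i)"
    and add: "\<And>p q. P p \<Longrightarrow> P q \<Longrightarrow> P (p + q)" and mult: "\<And>p q. P p \<Longrightarrow> P q \<Longrightarrow> P (p * q)"
  shows "P p"
proof -
  have one: "P 1" using const[of 1] by (simp add: pconst_def)
  have pw: "P (q ^ b)" if "P q" for q b
    by (induction b) (auto simp: one mult that)
  have var_pow: "Poly_Mapping.single (Poly_Mapping.single i b) 1 = (pvar i ^ b :: _ \<Rightarrow>\<^sub>0 'c)" for i :: 'i and b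
  proof (induction b)
    case (Suc b)
    have "Poly_Mapping.single (Poly_Mapping.single i (Suc b)) (1::'c) =
        Poly_Mapping.single (Poly_Mapping.single i 1) 1 * Poly_Mapping.single (Poly_Mapping.single i b) 1"
      by (simp add: mult_single flip: single_add)
    then show ?case by (simp add: Suc pvar_def)
  qed auto
  have mon: "P (Poly_Mapping.single m 1)" for m :: "'i \<Rightarrow>\<^sub>0 nat"
  proof (induction m rule: update_induct)
    case (update f a b)
    have "Poly_Mapping.single (Poly_Mapping.update a b f) (1::'c) =
        Poly_Mapping.single f 1 * Poly_Mapping.single (Poly_Mapping.single a b) 1"
      using update.hyps by (simp add: mult_single update_eq_add)
    then show ?case using update by (simp add: var_pow mult pw var)
  qed (simp add: one)
  have sing: "P (Poly_Mapping.single m c)" for m c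
    using mult[OF const[of c] mon[of m]] by (simp add: pconst_def mult_single)
  show ?thesis
  proof (induction p rule: update_induct)
    case const
    show ?case using sing[of 0 0] by simp
  next
    case (update f a b)
    then show ?case by (simp add: update_eq_add add sing)
  qed
qed

lemma type_hom_mpoly_eqI:
  assumes "type_hom A h" "type_hom A g" "\<And>c. h (pconst c) = g (pconst c)" "\<And>i. h (pvar i) = g (pvar i)"
  shows "h p = g p"
proof -
  interpret h: type_hom A h by fact
  interpret g: type_hom A g by fact
  show ?thesis by (induction p rule: mpoly_induct) (simp_all add: assms(3,4))
qed

definition mon_eval :: "('a,'m) ring_scheme \<Rightarrow> ('i \<Rightarrow> 'a) \<Rightarrow> ('i \<Rightarrow>\<^sub>0 nat) \<Rightarrow> 'a" where
  "mon_eval A v m = (\<Otimes>\<^bsub>A\<^esub>i\<in>Poly_Mapping.keys m. v i [^]\<^bsub>A\<^esub> Poly_Mapping.lookup m i)"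

definition meval :: "('a,'m) ring_scheme \<Rightarrow> ('c \<Rightarrow> 'a) \<Rightarrow> ('i \<Rightarrow> 'a) \<Rightarrow> (('i \<Rightarrow>\<^sub>0 nat) \<Rightarrow>\<^sub>0 'c::comm_ring_1) \<Rightarrow> 'a" where
  "meval A f v p = (\<Oplus>\<^bsub>A\<^esub>m\<in>Poly_Mapping.keys p. f (Poly_Mapping.lookup p m) \<otimes>\<^bsub>A\<^esub> mon_eval A v m)"

context type_hom
begin

context
  fixes v :: "'i \<Rightarrow> 'a"
  assumes v [simp, intro]: "\<And>i. v i \<in> carrier A"
begin

lemma mon_eval_closed [simp, intro]: "mon_eval A v m \<in> carrier A"
  by (auto simp: mon_eval_def intro!: A.finprod_closed)

text \<open>Variables outside the support contribute power 0, hence the factor one. Two monomials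
  can thus be multiplied factor by factor over a common index set.\<close>

lemma mon_eval_superset:
  "finite K \<Longrightarrow> Poly_Mapping.keys m \<subseteq> K \<Longrightarrow> mon_eval A v m = (\<Otimes>i\<in>K. v i [^] Poly_Mapping.lookup m i)"
  unfolding mon_eval_def by (rule A.finprod_mono_neutral_cong_left) (auto simp: in_keys_iff)

lemma mon_eval_add: "mon_eval A v (a + b) = mon_eval A v a \<otimes> mon_eval A v b"
proof -
  let ?K = "Poly_Mapping.keys a \<union> Poly_Mapping.keys b"
  have "mon_eval A v (a + b) = (\<Otimes>i\<in>?K. v i [^] Poly_Mapping.lookup a i \<otimes> v i [^] Poly_Mapping.lookup b i)"
    by (subst mon_eval_superset[of ?K])
      (auto simp: keys_add[THEN subsetD] lookup_add A.nat_pow_mult intro!: A.finprod_cong'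
        dest: keys_add[THEN subsetD])
  also have "\<dots> = (\<Otimes>i\<in>?K. v i [^] Poly_Mapping.lookup a i) \<otimes> (\<Otimes>i\<in>?K. v i [^] Poly_Mapping.lookup b i)"
    by (rule A.finprod_multf) auto
  also have "\<dots> = mon_eval A v a \<otimes> mon_eval A v b"
    by (simp add: mon_eval_superset[of ?K])
  finally show ?thesis .
qed

lemma meval_closed [simp, intro]: "meval A h v p \<in> carrier A"
  by (auto simp: meval_def intro!: A.finsum_closed)

lemma meval_superset:
  "finite K \<Longrightarrow> Poly_Mapping.keys p \<subseteq> K \<Longrightarrow> meval A h v p = (\<Oplus>m\<in>K. h (Poly_Mapping.lookup p m) \<otimes> mon_eval A v m)"
  unfolding meval_def by (rule A.add.finprod_mono_neutral_cong_left) (auto simp: in_keys_iff)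

lemma meval_add: "meval A h v (p + q) = meval A h v p \<oplus> meval A h v q"
proof -
  let ?K = "Poly_Mapping.keys p \<union> Poly_Mapping.keys q"
  have "meval A h v (p + q) = (\<Oplus>m\<in>?K. h (Poly_Mapping.lookup p m) \<otimes> mon_eval A v m \<oplus> h (Poly_Mapping.lookup q m) \<otimes> mon_eval A v m)"
    by (subst meval_superset[of ?K])
      (auto simp: lookup_add A.l_distr intro!: A.finsum_cong' dest: keys_add[THEN subsetD])
  also have "\<dots> = (\<Oplus>m\<in>?K. h (Poly_Mapping.lookup p m) \<otimes> mon_eval A v m) \<oplus> (\<Oplus>m\<in>?K. h (Poly_Mapping.lookup q m) \<otimes> mon_eval A v m)"
    by (rule A.finsum_addf) auto
  also have "\<dots> = meval A h v p \<oplus> meval A h v q"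
    by (simp add: meval_superset[of ?K])
  finally show ?thesis .
qed

lemma meval_single: "meval A h v (Poly_Mapping.single m c) = h c \<otimes> mon_eval A v m"
  by (subst meval_superset[of "{m}"]) auto

lemma meval_mult: "meval A h v (p * q) = meval A h v p \<otimes> meval A h v q"
proof -
  have z: "meval A h v 0 = \<zero>" by (simp add: meval_def)
  \<comment> \<open>Both sides are additive in each factor, so only products of two single terms
    have to be compared: first the right factor is split into terms, then the left one.\<close>
  have single: "meval A h v (Poly_Mapping.single m c * q) = meval A h v (Poly_Mapping.single m c) \<otimes> meval A h v q" for m c
  proof (induction q rule: update_induct)
    case (update f a b)
    have "meval A h v (Poly_Mapping.single m c * Poly_Mapping.single a b) =
        meval A h v (Poly_Mapping.single m c) \<otimes> meval A h v (Poly_Mapping.single a b)"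
      by (simp add: mult_single meval_single mon_eval_add A.m_ac)
    with update show ?case
      by (simp add: update_eq_add distrib_left meval_add A.r_distr)
  qed (simp add: z)
  show ?thesis
  proof (induction p rule: update_induct)
    case (update f a b)
    then show ?case
      by (simp add: update_eq_add distrib_right meval_add A.l_distr single)
  qed (simp add: z)
qed

lemma meval_pconst [simp]: "meval A h v (pconst c) = h c"
  by (simp add: pconst_def meval_single mon_eval_def)

lemma meval_pvar [simp]: "meval A h v (pvar i) = v i"
  by (simp add: pvar_def meval_single mon_eval_def)

lemma type_hom_meval: "type_hom A (meval A h v)"
  by (rule type_homI) (use meval_pconst[of 1] in \<open>auto simp: meval_add meval_mult A.is_cring pconst_def\<close>)

end

end

section \<open>Evaluation of univariate polynomials\<close>

definition peval :: "('a,'m) ring_scheme \<Rightarrow> ('r \<Rightarrow> 'a) \<Rightarrow> 'a \<Rightarrow> 'r::comm_ring_1 poly \<Rightarrow> 'a" where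
  "peval A h z p = (\<Oplus>\<^bsub>A\<^esub>i\<in>{..Polynomial.degree p}. h (poly.coeff p i) \<otimes>\<^bsub>A\<^esub> z [^]\<^bsub>A\<^esub> i)"

context type_hom
begin

context
  fixes z assumes z [simp, intro]: "z \<in> carrier A"
begin

lemma peval_superset:
  assumes "Polynomial.degree p \<le> d"
  shows "peval A h z p = (\<Oplus>i\<in>{..d}. h (poly.coeff p i) \<otimes> z [^] i)"
  unfolding peval_def
  by (rule A.add.finprod_mono_neutral_cong_left) (use assms in \<open>auto simp: coeff_eq_0\<close>)

lemma peval_closed [simp, intro]: "peval A h z p \<in> carrier A"
  by (auto simp: peval_def intro!: A.finsum_closed)

lemma peval_add: "peval A h z (p + q) = peval A h z p \<oplus> peval A h z q"
proof -
  let ?d = "max (Polynomial.degree p) (Polynomial.degree q)"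
  have "peval A h z (p + q) = (\<Oplus>i\<in>{..?d}. h (poly.coeff p i) \<otimes> z [^] i \<oplus> h (poly.coeff q i) \<otimes> z [^] i)"
    by (subst peval_superset[of _ ?d]) (auto simp: A.l_distr degree_add_le_max intro!: A.finsum_cong')
  also have "\<dots> = (\<Oplus>i\<in>{..?d}. h (poly.coeff p i) \<otimes> z [^] i) \<oplus> (\<Oplus>i\<in>{..?d}. h (poly.coeff q i) \<otimes> z [^] i)"
    by (rule A.finsum_addf) auto
  finally show ?thesis by (simp add: peval_superset[of _ ?d])
qed

text \<open>Horner's rule. With it, compatibility of evaluation with products follows by induction
  along \<open>pCons\<close>.\<close>

lemma peval_pCons: "peval A h z (pCons a p) = h a \<oplus> z \<otimes> peval A h z p"
proof -
  have "peval A h z (pCons a p) = (\<Oplus>i\<in>{..Suc (Polynomial.degree p)}. h (poly.coeff (pCons a p) i) \<otimes> z [^] i)"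
    by (rule peval_superset) (auto simp: degree_pCons_le)
  also have "\<dots> = (\<Oplus>i\<in>{..Polynomial.degree p}. h (poly.coeff (pCons a p) (Suc i)) \<otimes> z [^] Suc i) \<oplus> h a"
    by (subst A.finsum_Suc2) auto
  also have "(\<Oplus>i\<in>{..Polynomial.degree p}. h (poly.coeff (pCons a p) (Suc i)) \<otimes> z [^] Suc i) =
      (\<Oplus>i\<in>{..Polynomial.degree p}. z \<otimes> (h (poly.coeff p i) \<otimes> z [^] i))"
    by (intro A.finsum_cong') (auto simp: A.m_ac)
  also have "\<dots> = z \<otimes> peval A h z p"
    by (simp add: peval_def A.finsum_rdistr)
  finally show ?thesis by (simp add: A.a_comm)
qed

lemma peval_smult: "peval A h z (Polynomial.smult c p) = h c \<otimes> peval A h z p"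
proof (induction p)
  case (pCons a p)
  then show ?case by (simp add: peval_pCons A.r_distr A.m_ac)
qed (simp add: peval_def)

lemma peval_mult: "peval A h z (p * q) = peval A h z p \<otimes> peval A h z q"
proof (induction p)
  case (pCons a p)
  then show ?case by (simp add: peval_pCons A.l_distr A.m_assoc peval_add peval_smult)
qed (simp add: peval_def)

lemma peval_const [simp]: "peval A h z [:c:] = h c"
  by (simp add: peval_def)

lemma peval_X [simp]: "peval A h z [:0, 1:] = z"
  by (simp add: peval_pCons peval_def)

lemma type_hom_peval: "type_hom A (peval A h z)"
  by (rule type_homI)
    (use peval_const[of 1] in \<open>auto simp: peval_add peval_mult A.is_cring simp flip: one_pCons\<close>)

end

end

lemma type_hom_poly_expand:
  assumes "type_hom Q \<theta>" and "Polynomial.degree p < n"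
  shows "\<theta> p = (\<Oplus>\<^bsub>Q\<^esub>j\<in>{..<n}. \<theta> [:poly.coeff p j:] \<otimes>\<^bsub>Q\<^esub> \<theta> ([:0, 1:] ^ j))"
proof -
  interpret type_hom Q \<theta> by fact
  have "p = (\<Sum>j\<le>n - 1. Polynomial.monom (poly.coeff p j) j)"
    by (rule poly_as_sum_of_monoms'[symmetric]) (use assms in auto)
  also have "{..n - 1} = {..<n}" using assms by auto
  also have "(\<Sum>j<n. Polynomial.monom (poly.coeff p j) j) = (\<Sum>j<n. [:poly.coeff p j:] * [:0, 1:] ^ j)"
    by (simp add: monom_altdef)
  finally have "\<theta> p = \<theta> (\<Sum>j<n. [:poly.coeff p j:] * [:0, 1:] ^ j)" by simp
  then show ?thesis by (simp add: hom_sum del: mult_pCons_left)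
qed

section \<open>Localization\<close>

text \<open>The extension of \<open>h\<close> to fractions, computed on an arbitrarily chosen
  representative. Independence of the choice is shown below under the assumption that
  \<open>h\<close> maps \<open>S\<close> to units.\<close>

definition loc_lift :: "('b, 'n) ring_scheme \<Rightarrow> ('a \<Rightarrow> 'b) \<Rightarrow> ('a \<times> 'a) set \<Rightarrow> 'b" where
  "loc_lift B h XX = (let p = SOME p. p \<in> XX in h (fst p) \<otimes>\<^bsub>B\<^esub> inv\<^bsub>B\<^esub> h (snd p))"

locale mult_set = R?: cring R for R (structure) +
  fixes S
  assumes S_sub: "S \<subseteq> carrier R" and S_one [simp, intro]: "\<one> \<in> S"
    and S_mult [simp, intro]: "\<And>s t. s \<in> S \<Longrightarrow> t \<in> S \<Longrightarrow> s \<otimes> t \<in> S"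
begin

lemma S_closed [simp, intro]: "s \<in> S \<Longrightarrow> s \<in> carrier R"
  using S_sub by auto

abbreviation frac :: "'a \<Rightarrow> 'a \<Rightarrow> ('a \<times> 'a) set" where
  "frac \<equiv> loc_frac R S"

lemma mem_frac_iff:
  assumes "r \<in> carrier R" "s \<in> S"
  shows "p \<in> frac r s \<longleftrightarrow> fst p \<in> carrier R \<and> snd p \<in> S \<and>
    (\<exists>u\<in>S. u \<otimes> (r \<otimes> snd p) = u \<otimes> (fst p \<otimes> s))"
proof -
  have "u \<otimes> (x \<ominus> y) = \<zero> \<longleftrightarrow> u \<otimes> x = u \<otimes> y" if "u \<in> S" "x \<in> carrier R" "y \<in> carrier R" for u x y
  proof -
    have "u \<otimes> (x \<ominus> y) = u \<otimes> x \<ominus> u \<otimes> y"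
      using that by (simp add: R.minus_eq R.r_distr R.r_minus)
    then show ?thesis using that by simp
  qed
  then show ?thesis
    using assms by (auto simp: loc_frac_def loc_rel_def)
qed

lemma mem_frac_self [intro]: "r \<in> carrier R \<Longrightarrow> s \<in> S \<Longrightarrow> (r, s) \<in> frac r s"
  by (auto simp: mem_frac_iff intro!: bexI[of _ \<one>])

lemma frac_eq_iff:
  assumes "r \<in> carrier R" "s \<in> S" "r' \<in> carrier R" "s' \<in> S"
  shows "frac r s = frac r' s' \<longleftrightarrow> (\<exists>u\<in>S. u \<otimes> (r \<otimes> s') = u \<otimes> (r' \<otimes> s))"
proof
  assume "frac r s = frac r' s'"
  then have "(r', s') \<in> frac r s" using assms by auto
  then show "\<exists>u\<in>S. u \<otimes> (r \<otimes> s') = u \<otimes> (r' \<otimes> s)" using assms by (auto simp: mem_frac_iff)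
next
  \<comment> \<open>Transitivity of the fraction relation, with \<open>(r, s)\<close> as the middle
    term. The multiplier is \<open>u \<otimes> v \<otimes> s\<close>: besides the two given
    multipliers it contains the middle denominator, which eliminating \<open>r\<close> introduces on
    both sides.\<close>
  have step: "p \<in> frac r' s'" if *: "p \<in> frac r s" "u \<in> S" "u \<otimes> (r \<otimes> s') = u \<otimes> (r' \<otimes> s)"
      and "r \<in> carrier R" "s \<in> S" "r' \<in> carrier R" "s' \<in> S" for p u r s r' s'
  proof -
    obtain a b where p: "p = (a, b)" by (cases p)
    with * that obtain v where ab: "a \<in> carrier R" "b \<in> S" "v \<in> S" and v: "v \<otimes> (r \<otimes> b) = v \<otimes> (a \<otimes> s)"
      by (auto simp: mem_frac_iff)
    note [simp] = that(2,4-7) ab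
    have "(u \<otimes> v \<otimes> s) \<otimes> (r' \<otimes> b) = v \<otimes> b \<otimes> (u \<otimes> (r' \<otimes> s))"
      by (simp add: R.m_ac)
    also have "\<dots> = v \<otimes> b \<otimes> (u \<otimes> (r \<otimes> s'))" using that(3) by simp
    also have "\<dots> = u \<otimes> s' \<otimes> (v \<otimes> (r \<otimes> b))"
      by (simp add: R.m_ac)
    also have "\<dots> = u \<otimes> s' \<otimes> (v \<otimes> (a \<otimes> s))" using v by simp
    also have "\<dots> = (u \<otimes> v \<otimes> s) \<otimes> (a \<otimes> s')"
      by (simp add: R.m_ac)
    finally show ?thesis
      by (auto simp: p mem_frac_iff intro!: bexI[of _ "u \<otimes> v \<otimes> s"])
  qed
  assume "\<exists>u\<in>S. u \<otimes> (r \<otimes> s') = u \<otimes> (r' \<otimes> s)"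
  then obtain u where u: "u \<in> S" "u \<otimes> (r \<otimes> s') = u \<otimes> (r' \<otimes> s)" by auto
  show "frac r s = frac r' s'"
    using step[OF _ u assms] step[OF _ u(1) u(2)[symmetric] assms(3,4,1,2)] by blast
qed

lemma frac_eqI:
  assumes "r \<otimes> s' = r' \<otimes> s" "r \<in> carrier R" "s \<in> S" "r' \<in> carrier R" "s' \<in> S"
  shows "frac r s = frac r' s'"
  using assms by (auto simp: frac_eq_iff intro!: bexI[of _ \<one>])

lemma carrier_loc: "carrier (loc R S) = {frac r s | r s. r \<in> carrier R \<and> s \<in> S}"
  by (simp add: loc_def)

lemma frac_closed [simp, intro]: "r \<in> carrier R \<Longrightarrow> s \<in> S \<Longrightarrow> frac r s \<in> carrier (loc R S)"
  by (auto simp: carrier_loc)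

lemma locE:
  assumes "x \<in> carrier (loc R S)"
  obtains r s where "r \<in> carrier R" "s \<in> S" "x = frac r s"
  using assms by (auto simp: carrier_loc)

lemma loc_one: "\<one>\<^bsub>loc R S\<^esub> = frac \<one> \<one>" and loc_zero: "\<zero>\<^bsub>loc R S\<^esub> = frac \<zero> \<one>"
  by (simp_all add: loc_def)

text \<open>The product in \<open>loc\<close> is a union over all pairs of representatives. Every
  pair gives the same class, by multiplying the two multipliers, so the union is that class.\<close>

lemma loc_mult [simp]:
  assumes [simp]: "r \<in> carrier R" "s \<in> S" "r' \<in> carrier R" "s' \<in> S"
  shows "frac r s \<otimes>\<^bsub>loc R S\<^esub> frac r' s' = frac (r \<otimes> r') (s \<otimes> s')"
proof -
  have "frac (fst p \<otimes> fst q) (snd p \<otimes> snd q) = frac (r \<otimes> r') (s \<otimes> s')"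
    if p: "p \<in> frac r s" and q: "q \<in> frac r' s'" for p q
  proof -
    obtain a b c d where pq [simp]: "p = (a, b)" "q = (c, d)" by (cases p, cases q)
    have [simp]: "a \<in> carrier R" "b \<in> S" "c \<in> carrier R" "d \<in> S"
      using p q by (auto simp: mem_frac_iff)
    obtain u where u [simp]: "u \<in> S" and eu: "u \<otimes> (r \<otimes> b) = u \<otimes> (a \<otimes> s)"
      using p by (auto simp: mem_frac_iff)
    obtain v where v [simp]: "v \<in> S" and ev: "v \<otimes> (r' \<otimes> d) = v \<otimes> (c \<otimes> s')"
      using q by (auto simp: mem_frac_iff)
    have "(u \<otimes> v) \<otimes> ((a \<otimes> c) \<otimes> (s \<otimes> s')) = (u \<otimes> (a \<otimes> s)) \<otimes> (v \<otimes> (c \<otimes> s'))"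
      by (simp add: R.m_ac)
    also have "\<dots> = (u \<otimes> (r \<otimes> b)) \<otimes> (v \<otimes> (r' \<otimes> d))" by (simp add: eu ev)
    also have "\<dots> = (u \<otimes> v) \<otimes> ((r \<otimes> r') \<otimes> (b \<otimes> d))"
      by (simp add: R.m_ac)
    finally show ?thesis
      by (subst frac_eq_iff) (auto intro!: bexI[of _ "u \<otimes> v"])
  qed
  then have "frac r s \<otimes>\<^bsub>loc R S\<^esub> frac r' s' =
      (\<Union>p\<in>frac r s. \<Union>q\<in>frac r' s'. frac (r \<otimes> r') (s \<otimes> s'))"
    by (simp add: loc_def)
  also have "\<dots> = frac (r \<otimes> r') (s \<otimes> s')"
    using mem_frac_self[of r s] mem_frac_self[of r' s'] by auto
  finally show ?thesis .
qed

lemma loc_add [simp]: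
  assumes [simp]: "r \<in> carrier R" "s \<in> S" "r' \<in> carrier R" "s' \<in> S"
  shows "frac r s \<oplus>\<^bsub>loc R S\<^esub> frac r' s' = frac (r \<otimes> s' \<oplus> r' \<otimes> s) (s \<otimes> s')"
proof -
  have "frac (fst p \<otimes> snd q \<oplus> fst q \<otimes> snd p) (snd p \<otimes> snd q) = frac (r \<otimes> s' \<oplus> r' \<otimes> s) (s \<otimes> s')"
    if p: "p \<in> frac r s" and q: "q \<in> frac r' s'" for p q
  proof -
    obtain a b c d where pq [simp]: "p = (a, b)" "q = (c, d)" by (cases p, cases q)
    have [simp]: "a \<in> carrier R" "b \<in> S" "c \<in> carrier R" "d \<in> S"
      using p q by (auto simp: mem_frac_iff)
    obtain u where u [simp]: "u \<in> S" and eu: "u \<otimes> (r \<otimes> b) = u \<otimes> (a \<otimes> s)"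
      using p by (auto simp: mem_frac_iff)
    obtain v where v [simp]: "v \<in> S" and ev: "v \<otimes> (r' \<otimes> d) = v \<otimes> (c \<otimes> s')"
      using q by (auto simp: mem_frac_iff)
    have "(u \<otimes> v) \<otimes> ((a \<otimes> d \<oplus> c \<otimes> b) \<otimes> (s \<otimes> s')) =
        (u \<otimes> (a \<otimes> s)) \<otimes> (v \<otimes> d \<otimes> s') \<oplus> (v \<otimes> (c \<otimes> s')) \<otimes> (u \<otimes> b \<otimes> s)"
      by (simp add: R.m_ac R.l_distr R.r_distr)
    also have "\<dots> = (u \<otimes> (r \<otimes> b)) \<otimes> (v \<otimes> d \<otimes> s') \<oplus> (v \<otimes> (r' \<otimes> d)) \<otimes> (u \<otimes> b \<otimes> s)"
      by (simp add: eu ev)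
    also have "\<dots> = (u \<otimes> v) \<otimes> ((r \<otimes> s' \<oplus> r' \<otimes> s) \<otimes> (b \<otimes> d))"
      by (simp add: R.m_ac R.l_distr R.r_distr)
    finally show ?thesis
      by (subst frac_eq_iff) (auto intro!: bexI[of _ "u \<otimes> v"])
  qed
  then have "frac r s \<oplus>\<^bsub>loc R S\<^esub> frac r' s' =
      (\<Union>p\<in>frac r s. \<Union>q\<in>frac r' s'. frac (r \<otimes> s' \<oplus> r' \<otimes> s) (s \<otimes> s'))"
    by (simp add: loc_def)
  also have "\<dots> = frac (r \<otimes> s' \<oplus> r' \<otimes> s) (s \<otimes> s')"
    using mem_frac_self[of r s] mem_frac_self[of r' s'] by auto
  finally show ?thesis .
qed

lemma cring_loc: "cring (loc R S)"
proof (rule cringI)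
  show "abelian_group (loc R S)"
  proof (rule abelian_groupI)
    fix x assume "x \<in> carrier (loc R S)"
    then obtain r s where x: "x = frac r s" and [simp]: "r \<in> carrier R" "s \<in> S" by (rule locE)
    have "frac (\<ominus> r) s \<oplus>\<^bsub>loc R S\<^esub> x = \<zero>\<^bsub>loc R S\<^esub>"
      unfolding x loc_zero by (simp add: R.l_minus R.l_neg) (rule frac_eqI; simp)
    then show "\<exists>y\<in>carrier (loc R S). y \<oplus>\<^bsub>loc R S\<^esub> x = \<zero>\<^bsub>loc R S\<^esub>"
      by (intro bexI[of _ "frac (\<ominus> r) s"]) auto
  qed (auto simp: loc_zero R.a_ac R.m_ac R.l_distr R.r_distr elim!: locE)
  show "comm_monoid (loc R S)"
    by (rule comm_monoidI) (auto simp: loc_one R.m_ac elim!: locE)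
  show "(x \<oplus>\<^bsub>loc R S\<^esub> y) \<otimes>\<^bsub>loc R S\<^esub> z = x \<otimes>\<^bsub>loc R S\<^esub> z \<oplus>\<^bsub>loc R S\<^esub> y \<otimes>\<^bsub>loc R S\<^esub> z"
    if "x \<in> carrier (loc R S)" "y \<in> carrier (loc R S)" "z \<in> carrier (loc R S)" for x y z
  proof -
    from that obtain a b c d e f where xyz: "x = frac a b" "y = frac c d" "z = frac e f"
      and [simp]: "a \<in> carrier R" "b \<in> S" "c \<in> carrier R" "d \<in> S" "e \<in> carrier R" "f \<in> S"
      by (elim locE)
    show ?thesis unfolding xyz by simp (rule frac_eqI; simp add: R.m_ac R.l_distr R.r_distr)
  qed
qed

sublocale L: cring "loc R S"
  by (rule cring_loc)

lemma inj_loc_hom: "(\<lambda>r. frac r \<one>) \<in> ring_hom R (loc R S)"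
  by (rule ring_hom_memI) (auto simp: loc_one)

lemma frac_split: "r \<in> carrier R \<Longrightarrow> s \<in> S \<Longrightarrow> frac r s = frac r \<one> \<otimes>\<^bsub>loc R S\<^esub> frac \<one> s"
  by simp

lemma frac_inverse: "s \<in> S \<Longrightarrow> frac s \<one> \<otimes>\<^bsub>loc R S\<^esub> frac \<one> s = \<one>\<^bsub>loc R S\<^esub>"
  unfolding loc_one by simp (rule frac_eqI; simp)

lemma frac_mult_denominator: "r \<in> carrier R \<Longrightarrow> s \<in> S \<Longrightarrow> frac r s \<otimes>\<^bsub>loc R S\<^esub> frac s \<one> = frac r \<one>"
  by simp (rule frac_eqI; simp add: R.m_ac)

section \<open>The universal property of the localization\<close>

context
  fixes B :: "('c, 'd) ring_scheme" and h
  assumes B: "cring B" and h: "h \<in> ring_hom R B" and units: "h ` S \<subseteq> Units B"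
begin

text \<open>The representative picked by \<open>SOME\<close> is related to \<open>(r, s)\<close> by
  a multiplier \<open>u\<close> in \<open>S\<close>. Its image \<open>h u\<close> is a unit and
  cancels.\<close>

lemma loc_lift_frac:
  assumes [simp]: "r \<in> carrier R" "s \<in> S"
  shows "loc_lift B h (frac r s) = h r \<otimes>\<^bsub>B\<^esub> inv\<^bsub>B\<^esub> h s"
proof -
  interpret B: cring B by (rule B)
  interpret h: ring_hom_cring R B h by unfold_locales (rule h)
  define p where "p = (SOME p. p \<in> frac r s)"
  have p: "p \<in> frac r s" unfolding p_def by (rule someI[of _ "(r, s)"]) auto
  obtain a b where ab: "p = (a, b)" by (cases p)
  have [simp]: "a \<in> carrier R" "b \<in> S"
    using p by (auto simp: mem_frac_iff ab)
  obtain u where u [simp]: "u \<in> S" and eu: "u \<otimes> (r \<otimes> b) = u \<otimes> (a \<otimes> s)"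
    using p by (auto simp: mem_frac_iff ab)
  have [simp]: "h u \<in> Units B" "h b \<in> Units B" "h s \<in> Units B" using units by auto
  have "h u \<otimes>\<^bsub>B\<^esub> (h r \<otimes>\<^bsub>B\<^esub> h b) = h u \<otimes>\<^bsub>B\<^esub> (h a \<otimes>\<^bsub>B\<^esub> h s)"
    using arg_cong[OF eu, of h] by simp
  then have "h r \<otimes>\<^bsub>B\<^esub> h b = h a \<otimes>\<^bsub>B\<^esub> h s" by simp
  then have "h a \<otimes>\<^bsub>B\<^esub> inv\<^bsub>B\<^esub> h b = (h r \<otimes>\<^bsub>B\<^esub> h b) \<otimes>\<^bsub>B\<^esub> inv\<^bsub>B\<^esub> h s \<otimes>\<^bsub>B\<^esub> inv\<^bsub>B\<^esub> h b"
    by (simp add: B.m_assoc)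
  also have "\<dots> = (h b \<otimes>\<^bsub>B\<^esub> inv\<^bsub>B\<^esub> h b) \<otimes>\<^bsub>B\<^esub> (h r \<otimes>\<^bsub>B\<^esub> inv\<^bsub>B\<^esub> h s)"
    by (simp only: B.m_ac B.m_closed h.hom_closed B.Units_inv_closed \<open>h b \<in> Units B\<close> \<open>h s \<in> Units B\<close>
        \<open>r \<in> carrier R\<close> \<open>b \<in> S\<close> S_closed)
  finally show ?thesis by (simp add: loc_lift_def p_def[symmetric] ab)
qed

lemma loc_lift_hom: "loc_lift B h \<in> ring_hom (loc R S) B"
proof -
  interpret B: cring B by (rule B)
  interpret h: ring_hom_cring R B h by unfold_locales (rule h)
  have U [simp]: "h s \<in> Units B" if "s \<in> S" for s using that units by auto
  have inv_mult: "inv\<^bsub>B\<^esub> (x \<otimes>\<^bsub>B\<^esub> y) = inv\<^bsub>B\<^esub> x \<otimes>\<^bsub>B\<^esub> inv\<^bsub>B\<^esub> y" if "x \<in> Units B" "y \<in> Units B" for x y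
  proof -
    have [simp]: "x \<in> carrier B" "y \<in> carrier B" "inv\<^bsub>B\<^esub> x \<in> carrier B" "inv\<^bsub>B\<^esub> y \<in> carrier B"
      using that by auto
    have "(x \<otimes>\<^bsub>B\<^esub> y) \<otimes>\<^bsub>B\<^esub> (inv\<^bsub>B\<^esub> x \<otimes>\<^bsub>B\<^esub> inv\<^bsub>B\<^esub> y) = (x \<otimes>\<^bsub>B\<^esub> inv\<^bsub>B\<^esub> x) \<otimes>\<^bsub>B\<^esub> (y \<otimes>\<^bsub>B\<^esub> inv\<^bsub>B\<^esub> y)"
      by (simp add: B.m_ac del: B.Units_r_inv)
    then show ?thesis using that by (intro B.comm_inv_char) auto
  qed
  show ?thesis
  proof (rule ring_hom_memI)
    fix x y assume "x \<in> carrier (loc R S)" "y \<in> carrier (loc R S)"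
    then obtain r s r' s' where xy: "x = frac r s" "y = frac r' s'"
      and [simp]: "r \<in> carrier R" "s \<in> S" "r' \<in> carrier R" "s' \<in> S" by (elim locE)
    show "loc_lift B h (x \<otimes>\<^bsub>loc R S\<^esub> y) = loc_lift B h x \<otimes>\<^bsub>B\<^esub> loc_lift B h y"
      by (simp add: xy loc_lift_frac inv_mult B.m_ac)
    have "(h r \<otimes>\<^bsub>B\<^esub> h s') \<otimes>\<^bsub>B\<^esub> (inv\<^bsub>B\<^esub> h s \<otimes>\<^bsub>B\<^esub> inv\<^bsub>B\<^esub> h s') = (h r \<otimes>\<^bsub>B\<^esub> inv\<^bsub>B\<^esub> h s) \<otimes>\<^bsub>B\<^esub> (h s' \<otimes>\<^bsub>B\<^esub> inv\<^bsub>B\<^esub> h s')"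
      by (simp only: B.m_ac B.m_closed h.hom_closed B.Units_inv_closed U \<open>r \<in> carrier R\<close> \<open>s \<in> S\<close> \<open>s' \<in> S\<close> S_closed)
    moreover have "(h r' \<otimes>\<^bsub>B\<^esub> h s) \<otimes>\<^bsub>B\<^esub> (inv\<^bsub>B\<^esub> h s \<otimes>\<^bsub>B\<^esub> inv\<^bsub>B\<^esub> h s') = (h r' \<otimes>\<^bsub>B\<^esub> inv\<^bsub>B\<^esub> h s') \<otimes>\<^bsub>B\<^esub> (h s \<otimes>\<^bsub>B\<^esub> inv\<^bsub>B\<^esub> h s)"
      by (simp only: B.m_ac B.m_closed h.hom_closed B.Units_inv_closed U \<open>r' \<in> carrier R\<close> \<open>s \<in> S\<close> \<open>s' \<in> S\<close> S_closed)
    ultimately show "loc_lift B h (x \<oplus>\<^bsub>loc R S\<^esub> y) = loc_lift B h x \<oplus>\<^bsub>B\<^esub> loc_lift B h y"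
      by (simp add: xy loc_lift_frac inv_mult B.l_distr)
  qed (auto simp: loc_lift_frac loc_one elim!: locE)
qed

end

text \<open>A multiplier \<open>u\<close> relating two representatives is mapped to the multiplier
  \<open>h u\<close> in \<open>S'\<close>, so all members of the union defining
  \<open>loc_map\<close> coincide.\<close>

lemma loc_map_frac:
  assumes B: "mult_set R' S'" and h: "h \<in> ring_hom R R'" and hS: "h ` S \<subseteq> S'"
    and [simp]: "r \<in> carrier R" "s \<in> S"
  shows "loc_map R' S' h (frac r s) = loc_frac R' S' (h r) (h s)"
proof -
  interpret B: mult_set R' S' by (rule B)
  interpret h: ring_hom_cring R R' h by unfold_locales (rule h)
  have "loc_frac R' S' (h (fst p)) (h (snd p)) = loc_frac R' S' (h r) (h s)" if p: "p \<in> frac r s" for p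
  proof -
    obtain a b where ab: "p = (a, b)" by (cases p)
    have [simp]: "a \<in> carrier R" "b \<in> S"
      using p by (auto simp: mem_frac_iff ab)
    obtain u where u [simp]: "u \<in> S" and eu: "u \<otimes> (r \<otimes> b) = u \<otimes> (a \<otimes> s)"
      using p by (auto simp: mem_frac_iff ab)
    have [simp]: "h u \<in> S'" "h b \<in> S'" "h s \<in> S'" using hS by auto
    show ?thesis using arg_cong[OF eu, of h]
      by (subst B.frac_eq_iff) (auto simp: ab intro!: bexI[of _ "h u"])
  qed
  then have "loc_map R' S' h (frac r s) = (\<Union>p\<in>frac r s. loc_frac R' S' (h r) (h s))"
    by (simp add: loc_map_def)
  then show ?thesis using mem_frac_self[of r s] by auto
qed

end

section \<open>Norms modulo a monic polynomial\<close>

text \<open>Division with remainder survives over a ring that is not a field because the leading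
  coefficient of \<open>F\<close> is 1: subtracting \<open>F * m\<close> cancels the top term of
  \<open>p\<close>, and the degree drops.\<close>

lemma monic_division:
  fixes F p :: "'r::comm_ring_1 poly"
  assumes F: "Polynomial.degree F = n" "poly.coeff F n = 1" and n: "n \<ge> 1"
  obtains q r where "p = F * q + r" "Polynomial.degree r < n"
proof -
  have "\<exists>q r. p = F * q + r \<and> Polynomial.degree r < n"
  proof (induction "Polynomial.degree p" arbitrary: p rule: less_induct)
    case less
    show ?case
    proof (cases "Polynomial.degree p < n")
      case True
      then show ?thesis by (intro exI[of _ 0] exI[of _ p]) simp
    next
      case False
      define d where "d = Polynomial.degree p"
      define m where "m = Polynomial.monom (poly.coeff p d) (d - n)"
      have "Polynomial.degree (F * m) \<le> n + (d - n)"
        using degree_mult_le[of F m] degree_monom_le[of "poly.coeff p d" "d - n"] F(1)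
        unfolding m_def by linarith
      then have le: "Polynomial.degree (p - F * m) \<le> d"
        using False by (intro degree_diff_le) (auto simp: d_def)
      have "poly.coeff (F * m) d = poly.coeff F n * poly.coeff p d"
        using False by (simp add: m_def mult.commute[of F] coeff_monom_mult d_def)
      then have "poly.coeff (p - F * m) d = 0" using F(2) by simp
      then have "Polynomial.degree (p - F * m) < d"
      proof (cases "p - F * m = 0")
        \<comment> \<open>The zero polynomial has degree 0, which lies below \<open>d\<close>
          because \<open>d \<ge> n \<ge> 1\<close>.\<close>
        case True
        then show ?thesis using False n by (simp add: d_def)
      next
        case nz: False
        then show ?thesis using le \<open>poly.coeff (p - F * m) d = 0\<close>
          by (metis le_neq_implies_less leading_coeff_0_iff)
      qed
      then obtain q r where "p - F * m = F * q + r" "Polynomial.degree r < n"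
        using less[of "p - F * m"] unfolding d_def by blast
      then show ?thesis
        by (intro exI[of _ "q + m"] exI[of _ r]) (simp add: algebra_simps)
    qed
  qed
  then show ?thesis using that by blast
qed

text \<open>Multiplication by \<open>g\<close> modulo \<open>F\<close> in the basis
  \<open>1, x, ..., x^(n-1)\<close>, with the coordinates of \<open>g x^i\<close> in row
  \<open>i\<close>. Naming the multiple of \<open>F\<close> avoids forming the quotient
  ring.\<close>

definition mult_matrix :: "nat \<Rightarrow> 'r::comm_ring_1 poly \<Rightarrow> 'r poly \<Rightarrow> 'r mat \<Rightarrow> bool" where
  "mult_matrix n F g M \<longleftrightarrow> M \<in> carrier_mat n n \<and>
     (\<forall>i<n. \<exists>q. g * [:0, 1:] ^ i = F * q + (\<Sum>j<n. [:M $$ (i, j):] * [:0, 1:] ^ j))"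

lemma poly_sum_powers:
  assumes "Polynomial.degree (p :: 'r::comm_ring_1 poly) < n"
  shows "p = (\<Sum>j<n. [:poly.coeff p j:] * [:0, 1:] ^ j)"
proof -
  have "p = (\<Sum>j\<le>n - 1. Polynomial.monom (poly.coeff p j) j)"
    by (rule poly_as_sum_of_monoms'[symmetric]) (use assms in auto)
  also have "{..n - 1} = {..<n}" using assms by auto
  finally show ?thesis by (simp add: monom_altdef)
qed

lemma mult_matrix_exists:
  fixes F g :: "'r::comm_ring_1 poly"
  assumes F: "Polynomial.degree F = n" "poly.coeff F n = 1" "n \<ge> 1"
  shows "\<exists>M. mult_matrix n F g M"
proof -
  have "\<exists>q r. g * [:0, 1:] ^ i = F * q + r \<and> Polynomial.degree r < n" for i
    using monic_division[OF F, of "g * [:0, 1:] ^ i"] by blast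
  then obtain q r where qr: "\<And>i. g * [:0, 1:] ^ i = F * q i + r i" "\<And>i. Polynomial.degree (r i) < n"
    by metis
  have "mult_matrix n F g (mat n n (\<lambda>(i, j). poly.coeff (r i) j))"
    unfolding mult_matrix_def
  proof (intro conjI allI impI exI)
    fix i assume i: "i < n"
    have "(\<Sum>j<n. [:mat n n (\<lambda>(i, j). poly.coeff (r i) j) $$ (i, j):] * [:0, 1:] ^ j) = r i"
      using poly_sum_powers[OF qr(2)[of i]] i by simp
    then show "g * [:0, 1:] ^ i = F * q i + (\<Sum>j<n. [:mat n n (\<lambda>(i, j). poly.coeff (r i) j) $$ (i, j):] * [:0, 1:] ^ j)"
      using qr(1)[of i] by simp
  qed simp
  then show ?thesis ..
qed

text \<open>Combining the rows of \<open>M\<close> with the entries of the first row of the adjugate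
  gives \<open>(det M, 0, ..., 0)\<close>, which stands for the constant polynomial
  \<open>det M\<close>. Each row represents \<open>g x^i\<close> modulo \<open>F\<close>, so this
  constant is a combination of \<open>g\<close> and \<open>F\<close>.\<close>

lemma mult_matrix_bezout:
  fixes F g :: "'r::comm_ring_1 poly"
  assumes M: "mult_matrix n F g M" and n: "n \<ge> 1"
  obtains u v where "[:det M:] = g * u + F * v"
proof -
  let ?X = "[:0, 1:] :: 'r poly"
  have Mc: "M \<in> carrier_mat n n" using M by (simp add: mult_matrix_def)
  obtain q where q: "\<And>i. i < n \<Longrightarrow> g * ?X ^ i = F * q i + (\<Sum>j<n. [:M $$ (i, j):] * ?X ^ j)"
  proof -
    have "\<forall>i. \<exists>q. i < n \<longrightarrow> g * ?X ^ i = F * q + (\<Sum>j<n. [:M $$ (i, j):] * ?X ^ j)"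
      using M by (auto simp: mult_matrix_def)
    from choice[OF this] show ?thesis using that by blast
  qed
  define a where "a i = adj_mat M $$ (0, i)" for i
  have adj: "(\<Sum>i<n. a i * M $$ (i, j)) = (if j = 0 then det M else 0)" if "j < n" for j
  proof -
    have "(\<Sum>i<n. a i * M $$ (i, j)) = (adj_mat M * M) $$ (0, j)"
      using Mc adj_mat(1)[OF Mc] that n
      by (auto simp: scalar_prod_def a_def lessThan_atLeast0 intro!: sum.cong)
    also have "\<dots> = (if j = 0 then det M else 0)"
      unfolding adj_mat(3)[OF Mc] using that n by auto
    finally show ?thesis .
  qed
  have "(\<Sum>i<n. [:a i:] * (\<Sum>j<n. [:M $$ (i, j):] * ?X ^ j)) = (\<Sum>j<n. [:\<Sum>i<n. a i * M $$ (i, j):] * ?X ^ j)"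
  proof -
    have "(\<Sum>i<n. [:a i:] * (\<Sum>j<n. [:M $$ (i, j):] * ?X ^ j)) = (\<Sum>i<n. \<Sum>j<n. [:a i * M $$ (i, j):] * ?X ^ j)"
      by (simp add: sum_distrib_left mult.commute)
    also have "\<dots> = (\<Sum>j<n. \<Sum>i<n. [:a i * M $$ (i, j):] * ?X ^ j)" by (rule sum.swap)
    also have "\<dots> = (\<Sum>j<n. [:\<Sum>i<n. a i * M $$ (i, j):] * ?X ^ j)"
    proof (rule sum.cong[OF refl])
      fix j
      have "[:\<Sum>i\<in>I. f i:] = (\<Sum>i\<in>I. [:f i:])" for I and f :: "nat \<Rightarrow> 'r"
        by (rule poly_eqI) (simp add: Polynomial.coeff_sum coeff_pCons split: nat.split)
      then show "(\<Sum>i<n. [:a i * M $$ (i, j):] * ?X ^ j) = [:\<Sum>i<n. a i * M $$ (i, j):] * ?X ^ j"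
        by (simp add: sum_distrib_right del: mult_pCons_left)
    qed
    finally show ?thesis .
  qed
  also have "\<dots> = (\<Sum>j<n. if j = 0 then [:det M:] else 0)"
    by (rule sum.cong) (auto simp: adj)
  also have "\<dots> = [:det M:]" using n by simp
  finally have "[:det M:] = (\<Sum>i<n. [:a i:] * (\<Sum>j<n. [:M $$ (i, j):] * ?X ^ j))" by simp
  also have "\<dots> = (\<Sum>i<n. [:a i:] * (g * ?X ^ i - F * q i))"
    by (intro sum.cong) (auto simp: q algebra_simps)
  also have "\<dots> = g * (\<Sum>i<n. [:a i:] * ?X ^ i) + F * (\<Sum>i<n. - ([:a i:] * q i))"
    unfolding sum_distrib_left sum.distrib[symmetric] by (intro sum.cong) (auto simp: algebra_simps)
  finally show ?thesis by (rule that)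
qed

section \<open>Elementary symmetric polynomials\<close>

text \<open>Expanding the product means choosing the set \<open>T\<close> of factors that contribute
  \<open>- a j\<close>. Grouping these sets by cardinality yields the elementary symmetric
  expressions.\<close>

lemma vieta:
  fixes a :: "nat \<Rightarrow> 'r::comm_ring_1"
  shows "(\<Prod>i<n. z - a i) =
    (\<Sum>k\<le>n. (-1) ^ k * (\<Sum>T\<in>{T. T \<subseteq> {..<n} \<and> card T = k}. \<Prod>j\<in>T. a j) * z ^ (n - k))"
proof -
  have "(\<Prod>i<n. z - a i) = (\<Sum>T\<in>Pow {..<n}. (-1) ^ card T * (\<Prod>j\<in>T. a j) * (\<Prod>j\<in>{..<n} - T. z))"
    by (rule prod_diff_conv_sum) simp
  also have "\<dots> = (\<Sum>T\<in>Pow {..<n}. (-1) ^ card T * (\<Prod>j\<in>T. a j) * z ^ (n - card T))"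
    by (intro sum.cong refl) (auto simp: card_Diff_subset finite_subset)
  also have "\<dots> = (\<Sum>k\<le>n. \<Sum>T\<in>{T \<in> Pow {..<n}. card T = k}. (-1) ^ card T * (\<Prod>j\<in>T. a j) * z ^ (n - card T))"
    by (rule sum.group[symmetric]) (auto simp: card_mono[of "{..<n}", simplified])
  also have "\<dots> = (\<Sum>k\<le>n. (-1) ^ k * (\<Sum>T\<in>{T. T \<subseteq> {..<n} \<and> card T = k}. \<Prod>j\<in>T. a j) * z ^ (n - k))"
    by (intro sum.cong refl) (auto simp: sum_distrib_left sum_distrib_right intro!: sum.cong)
  finally show ?thesis .
qed

lemma esym_0: "esym n 0 = 1"
proof -
  have "{T. T \<subseteq> {..<n} \<and> card T = 0} = {{}}" by (auto simp: finite_subset)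
  then show ?thesis by (simp add: esym_def)
qed

lemma esym_gt: "i > n \<Longrightarrow> esym n i = 0"
proof -
  assume "i > n"
  then have "{T. T \<subseteq> {..<n} \<and> card T = i} = {}" by (auto dest!: card_mono[rotated])
  then show ?thesis unfolding esym_def by (simp only: sum.empty)
qed

section \<open>The generic monic polynomial and its specialization at the elementary symmetric
  polynomials\<close>

definition ycoeff :: "nat \<Rightarrow> nat \<Rightarrow> 'k::comm_ring_1 mpoly" where
  "ycoeff n i = (if i = 0 then 1 else if i \<le> n then pvar i else 0)"

definition generic_poly :: "nat \<Rightarrow> 'k::comm_ring_1 mpoly poly" where
  "generic_poly n = (\<Sum>i\<le>n. Polynomial.monom ((-1) ^ i * ycoeff n i) (n - i))"

lemma coeff_sum_monom_rev:
  "poly.coeff (\<Sum>i\<le>n. Polynomial.monom (c i) (n - i)) j = (if j \<le> n then c (n - j) else (0::'r::comm_ring_1))"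
proof -
  have "poly.coeff (\<Sum>i\<le>n. Polynomial.monom (c i) (n - i)) j = (\<Sum>i\<le>n. if i = n - j \<and> j \<le> n then c i else 0)"
    unfolding Polynomial.coeff_sum by (intro sum.cong refl) auto
  then show ?thesis by (auto simp: sum.delta)
qed

lemma coeff_generic_poly:
  "poly.coeff (generic_poly n) j = (if j \<le> n then (-1) ^ (n - j) * ycoeff n (n - j) else 0)"
  unfolding generic_poly_def by (rule coeff_sum_monom_rev)

lemma generic_poly_monic: "Polynomial.degree (generic_poly n) = n" "poly.coeff (generic_poly n) n = 1"
proof -
  show 1: "poly.coeff (generic_poly n) n = 1" by (simp add: coeff_generic_poly ycoeff_def)
  show "Polynomial.degree (generic_poly n) = n"
    by (intro antisym degree_le le_degree) (auto simp: ycoeff_def coeff_generic_poly)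
qed

text \<open>The substitution \<open>y_i = s_i(t)\<close>. One type holds both kinds of polynomials:
  on the source side \<open>pvar i\<close> with \<open>1 \<le> i \<le> n\<close> stands for
  \<open>y_i\<close>, on the target side \<open>pvar i\<close> with \<open>i < n\<close> stands for
  \<open>t_(i+1)\<close>.\<close>

definition esym_hom :: "nat \<Rightarrow> 'k::field mpoly \<Rightarrow> 'k mpoly" where
  "esym_hom n = meval type_ring pconst (esym n)"

lemma type_hom_pconst: "type_hom type_ring (pconst :: 'k::comm_ring_1 \<Rightarrow> ('i \<Rightarrow>\<^sub>0 nat) \<Rightarrow>\<^sub>0 'k)"
  by (rule type_homI) (auto simp: cring_type_ring pconst_def single_add mult_single)

interpretation pconst: type_hom type_ring "pconst :: 'k::comm_ring_1 \<Rightarrow> ('i \<Rightarrow>\<^sub>0 nat) \<Rightarrow>\<^sub>0 'k"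
  by (rule type_hom_pconst)

lemma type_hom_esym_hom: "type_hom type_ring (esym_hom n)"
  unfolding esym_hom_def by (rule pconst.type_hom_meval) simp

lemma esym_hom_pvar: "esym_hom n (pvar i) = esym n i"
  unfolding esym_hom_def by (rule pconst.meval_pvar) simp

lemma esym_hom_pconst: "esym_hom n (pconst c) = pconst c"
  unfolding esym_hom_def by (rule pconst.meval_pconst) simp

text \<open>The values of \<open>ycoeff\<close> at index 0 and beyond \<open>n\<close> are those of
  the elementary symmetric polynomials, so no restriction on \<open>i\<close> is required.\<close>

lemma esym_hom_ycoeff: "esym_hom n (ycoeff n i) = esym n i"
proof -
  interpret type_hom type_ring "esym_hom n" by (rule type_hom_esym_hom)
  show ?thesis by (auto simp: ycoeff_def esym_hom_pvar esym_0 esym_gt)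
qed

text \<open>By \<open>vieta\<close> the substitution turns the generic polynomial into the product
  of all \<open>x - pvar i\<close> with \<open>i < n\<close>, and at \<open>x = pvar l\<close> one
  factor vanishes.\<close>

lemma peval_generic_poly:
  assumes "l < n"
  shows "peval type_ring (esym_hom n) (pvar l) (generic_poly n) = (0 :: 'k::field mpoly)"
proof -
  interpret type_hom type_ring "esym_hom n :: 'k mpoly \<Rightarrow> _" by (rule type_hom_esym_hom)
  have e: "esym_hom n ((-1) ^ i :: 'k mpoly) = (-1) ^ i" for i
    by (induction i) auto
  have "peval type_ring (esym_hom n) (pvar l) (generic_poly n) =
      (\<Sum>j\<le>n. esym_hom n (poly.coeff (generic_poly n) j) * pvar l ^ j :: 'k mpoly)"
    by (simp add: peval_def generic_poly_monic finsum_type_ring pow_type_ring)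
  also have "\<dots> = (\<Sum>k\<le>n. (-1) ^ k * esym n k * pvar l ^ (n - k))"
    by (rule sum.reindex_bij_witness[of _ "\<lambda>k. n - k" "\<lambda>k. n - k"])
      (auto simp: coeff_generic_poly e esym_hom_ycoeff)
  also have "\<dots> = (\<Prod>i<n. pvar l - pvar i)"
    unfolding vieta esym_def mvar_eq_pvar ..
  also have "\<dots> = 0" using assms by (intro prod_zero) auto
  finally show ?thesis .
qed

section \<open>Diagonalizing multiplication by \<open>g\<close> with the Vandermonde matrix\<close>

lemma pvar_eq_iff [simp]: "pvar i = (pvar j :: ('i \<Rightarrow>\<^sub>0 nat) \<Rightarrow>\<^sub>0 'c::comm_ring_1) \<longleftrightarrow> i = j"
proof
  assume "pvar i = (pvar j :: ('i \<Rightarrow>\<^sub>0 nat) \<Rightarrow>\<^sub>0 'c)"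
  then have "Poly_Mapping.keys (pvar i :: ('i \<Rightarrow>\<^sub>0 nat) \<Rightarrow>\<^sub>0 'c) = Poly_Mapping.keys (pvar j :: ('i \<Rightarrow>\<^sub>0 nat) \<Rightarrow>\<^sub>0 'c)" by simp
  then have "Poly_Mapping.single i (1::nat) = Poly_Mapping.single j 1" by (simp add: pvar_def)
  then have "Poly_Mapping.keys (Poly_Mapping.single i (1::nat)) = Poly_Mapping.keys (Poly_Mapping.single j (1::nat))" by simp
  then show "i = j" by simp
qed simp

text \<open>A nonzero kernel vector of the transpose would be the coefficient vector of a nonzero
  polynomial of degree below \<open>n\<close> with the \<open>n\<close> distinct roots
  \<open>t l\<close>.\<close>

lemma det_vandermonde_nonzero:
  fixes t :: "nat \<Rightarrow> 'r::idom"
  assumes t: "inj_on t {..<n}"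
  shows "det (mat n n (\<lambda>(j, l). t l ^ j)) \<noteq> 0"
proof
  let ?V = "mat n n (\<lambda>(j, l). t l ^ j)"
  assume "det ?V = 0"
  then have "det (transpose_mat ?V) = 0" by (subst det_transpose[of _ n]) auto
  then obtain v where v: "v \<in> carrier_vec n" "v \<noteq> 0\<^sub>v n" "transpose_mat ?V *\<^sub>v v = 0\<^sub>v n"
    by (subst (asm) det_0_iff_vec_prod_zero[of _ n]) auto
  define p where "p = (\<Sum>j<n. Polynomial.monom (v $ j) j)"
  have coeff_p: "poly.coeff p j = (if j < n then v $ j else 0)" for j
    by (auto simp: p_def Polynomial.coeff_sum sum.delta)
  obtain j where "j < n" "v $ j \<noteq> 0"
    using v(1,2) by (auto simp: vec_eq_iff)
  then have n: "n > 0" and p0: "p \<noteq> 0" using coeff_p[of j] by auto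
  have "poly p (t l) = 0" if "l < n" for l
  proof -
    have "poly p (t l) = (\<Sum>j<n. v $ j * t l ^ j)"
      by (simp add: p_def poly_sum poly_monom)
    also have "\<dots> = (transpose_mat ?V *\<^sub>v v) $ l"
      using that v(1) by (auto simp: scalar_prod_def lessThan_atLeast0 mult.commute intro!: sum.cong)
    also have "\<dots> = 0" using that v(3) by simp
    finally show ?thesis .
  qed
  then have "t ` {..<n} \<subseteq> {x. poly p x = 0}" by auto
  then have "card (t ` {..<n}) \<le> card {x. poly p x = 0}"
    using poly_roots_finite[OF p0] by (rule card_mono[rotated])
  also have "\<dots> \<le> Polynomial.degree p" using p0 by (rule card_poly_roots_bound)
  also have "\<dots> \<le> n - 1" using n by (intro degree_le) (auto simp: coeff_p)
  finally show False unfolding card_image[OF t] using n by simp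
qed

text \<open>Column \<open>l\<close> of the Vandermonde matrix \<open>V\<close> is an eigenvector of
  the substituted \<open>M\<close>, with eigenvalue the value of \<open>g\<close> at
  \<open>pvar l\<close>. Polynomials over a field form a domain, so the nonzero \<open>det V\<close>
  cancels and the product of the eigenvalues remains.\<close>

lemma esym_hom_norm:
  fixes g :: "'k::field poly"
  assumes M: "mult_matrix n (generic_poly n) (map_poly pconst g) M"
  shows "esym_hom n (det M) = (\<Prod>i<n. poly (map_poly pconst g) (pvar i))"
proof -
  let ?G = "\<lambda>l. poly (map_poly pconst g) (pvar l :: 'k mpoly)"
  let ?s = "esym_hom n :: 'k mpoly \<Rightarrow> 'k mpoly"
  interpret s: type_hom type_ring ?s by (rule type_hom_esym_hom)
  interpret sh: comm_ring_hom ?s by unfold_locales (use s.hom_zero s.hom_one in auto)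
  have Mc: "M \<in> carrier_mat n n" using M by (simp add: mult_matrix_def)
  define V where "V = mat n n (\<lambda>(j, l). pvar l ^ j :: 'k mpoly)"
  define D where "D = mat n n (\<lambda>(i, j). if i = j then ?G i else 0)"
  \<comment> \<open>Evaluation of row \<open>i\<close> at \<open>x = pvar l\<close> kills the
    multiple of the generic polynomial.\<close>
  have entry: "(\<Sum>j<n. ?s (M $$ (i, j)) * pvar l ^ j) = pvar l ^ i * ?G l" if il: "i < n" "l < n" for i l
  proof -
    interpret ev: type_hom type_ring "peval type_ring ?s (pvar l)" by (rule s.type_hom_peval) simp
    have z: "pvar l \<in> carrier type_ring" by simp
    have ev_pow: "peval type_ring ?s (pvar l) ([:0, 1:] ^ i) = pvar l ^ i" for i
      by (simp add: ev.hom_power pow_type_ring s.peval_X[OF z])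
    have evg: "peval type_ring ?s (pvar l) (map_poly pconst g) = ?G l"
      by (simp add: peval_def finsum_type_ring pow_type_ring poly_altdef coeff_map_poly esym_hom_pconst)
    obtain q where q: "map_poly pconst g * [:0, 1:] ^ i = generic_poly n * q + (\<Sum>j<n. [:M $$ (i, j):] * [:0, 1:] ^ j)"
      using M il unfolding mult_matrix_def by blast
    have "?G l * pvar l ^ i = peval type_ring ?s (pvar l) (map_poly pconst g * [:0, 1:] ^ i)"
      by (simp add: evg ev_pow)
    also have "\<dots> = (\<Sum>j<n. ?s (M $$ (i, j)) * pvar l ^ j)"
      unfolding q by (simp add: peval_generic_poly[OF il(2)] ev.hom_sum finsum_type_ring ev_pow s.peval_const[OF z]
          del: mult_pCons_left)
    finally show ?thesis by (simp add: mult.commute)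
  qed
  have "map_mat ?s M * V = V * D"
  proof (rule eq_matI)
    fix i l assume "i < dim_row (V * D)" "l < dim_col (V * D)"
    then have il: "i < n" "l < n" by (auto simp: V_def D_def)
    have "(map_mat ?s M * V) $$ (i, l) = (\<Sum>j<n. ?s (M $$ (i, j)) * pvar l ^ j)"
      using il Mc by (auto simp: scalar_prod_def V_def lessThan_atLeast0 intro!: sum.cong)
    also have "\<dots> = pvar l ^ i * ?G l" using il by (rule entry)
    also have "\<dots> = (\<Sum>k<n. if k = l then pvar l ^ i * ?G l else 0)" using il by simp
    also have "\<dots> = (\<Sum>k<n. V $$ (i, k) * D $$ (k, l))"
      using il by (intro sum.cong) (auto simp: V_def D_def)
    also have "\<dots> = (V * D) $$ (i, l)"
      using il by (simp add: scalar_prod_def V_def D_def lessThan_atLeast0)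
    finally show "(map_mat ?s M * V) $$ (i, l) = (V * D) $$ (i, l)" .
  qed (use Mc in \<open>auto simp: V_def D_def\<close>)
  then have "det (map_mat ?s M) * det V = det V * det D"
    using Mc by (subst (1 2) det_mult[symmetric, of _ n]) (auto simp: V_def D_def)
  moreover have "det V \<noteq> 0"
    unfolding V_def by (rule det_vandermonde_nonzero) (auto simp: inj_on_def)
  ultimately have "det (map_mat ?s M) = det D" by simp
  also have "det D = (\<Prod>i<n. ?G i)"
    by (subst det_upper_triangular[of _ n]) (auto simp: D_def prod_list_diag_prod lessThan_atLeast0)
  finally show ?thesis by simp
qed

text \<open>Algebraic independence of the elementary symmetric polynomials: over the algebraic closure of the
  field of rational functions in the \<open>y\<^sub>i\<close>, the generic polynomial splits, and sending \<open>t\<^sub>i\<close> to its roots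
  recovers the \<open>y\<^sub>i\<close> from the \<open>s\<^sub>i\<close>.\<close>

lemma esym_hom_kernel:
  fixes p :: "'k::field mpoly"
  assumes E: "type_hom A E" and E0: "E (pvar 0) = \<one>\<^bsub>A\<^esub>" and En: "\<And>i. i > n \<Longrightarrow> E (pvar i) = \<zero>\<^bsub>A\<^esub>"
    and p: "esym_hom n p = 0"
  shows "E p = \<zero>\<^bsub>A\<^esub>"
proof -
  interpret E: type_hom A E by (rule E)
  \<comment> \<open>The kernel of \<open>esym_hom n\<close> contains \<open>pvar 0 - 1\<close> and
    each \<open>pvar i\<close> with \<open>i > n\<close>. The map \<open>red\<close> normalizes
    exactly these variables, and the hypotheses on \<open>E\<close> say that \<open>E\<close> does
    not notice the change.\<close>
  define red where "red = meval type_ring pconst (ycoeff n :: nat \<Rightarrow> 'k mpoly)"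
  have red: "type_hom type_ring red" unfolding red_def by (rule pconst.type_hom_meval) simp
  have red_pvar: "red (pvar i) = ycoeff n i" and red_pconst: "red (pconst c) = pconst c" for i c
    unfolding red_def by (auto intro!: pconst.meval_pvar pconst.meval_pconst)
  have E_red: "E (red q) = E q" for q
  proof (rule type_hom_mpoly_eqI[where A = A and h = "\<lambda>q. E (red q)"])
    show "type_hom A (\<lambda>q. E (red q))"
      by (rule type_hom_comp[OF red E.is_cring E.hom])
  qed (use E in \<open>auto simp: red_pvar red_pconst ycoeff_def E0 En\<close>)
  \<comment> \<open>\<open>j\<close> is an injection into an algebraically closed field. There
    \<open>P\<close>, the image of the generic polynomial, splits into linear factors.\<close>
  define j where "j x = to_ac (to_fract x)" for x :: "'k mpoly"
  have j: "type_hom type_ring j"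
    by (rule type_homI) (auto simp: j_def cring_type_ring)
  interpret j: type_hom type_ring j by (rule j)
  have j_sign: "j ((-1) ^ i) = (-1) ^ i" for i
    by (simp add: j.hom_power pow_type_ring)
  define P where "P = (\<Sum>i\<le>n. Polynomial.monom ((-1) ^ i * j (ycoeff n i)) (n - i))"
  have coeff_P: "poly.coeff P i = (if i \<le> n then (-1) ^ (n - i) * j (ycoeff n (n - i)) else 0)" for i
    unfolding P_def by (rule coeff_sum_monom_rev)
  have "poly.coeff P n = 1" by (simp add: coeff_P ycoeff_def)
  moreover have "Polynomial.degree P = n"
    using \<open>poly.coeff P n = 1\<close> by (intro antisym degree_le le_degree) (auto simp: coeff_P)
  ultimately have "P \<noteq> 0" "Polynomial.lead_coeff P = 1" "Polynomial.degree P = n" by auto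
  then obtain Z where Z: "size Z = n" "P = (\<Prod>x\<in>#Z. [:-x, 1:])"
    using alg_closed_imp_factorization[of P] by auto
  obtain xs where xs: "mset xs = Z" by (metis ex_mset)
  define \<alpha> where "\<alpha> i = xs ! i" for i
  have len: "length xs = n" using xs Z(1) by auto
  have "P = (\<Prod>i<n. [:0, 1:] - [:\<alpha> i:])"
  proof -
    have "P = prod_list (map (\<lambda>x. [:-x, 1:]) xs)"
      unfolding Z(2) xs[symmetric] by (simp add: prod_mset_prod_list flip: mset_map)
    also have "\<dots> = (\<Prod>i<n. [:- \<alpha> i, 1:])"
      by (simp add: prod.list_conv_set_nth len \<alpha>_def lessThan_atLeast0)
    finally show ?thesis by simp
  qed
  also have "\<dots> = (\<Sum>k\<le>n. Polynomial.monom ((-1) ^ k * (\<Sum>T\<in>{T. T \<subseteq> {..<n} \<and> card T = k}. \<Prod>i\<in>T. \<alpha> i)) (n - k))"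
    unfolding vieta
  proof (rule sum.cong[OF refl])
    fix k
    have const_prod: "(\<Prod>i\<in>T. [:\<alpha> i:]) = [:\<Prod>i\<in>T. \<alpha> i:]" for T
      by (induction T rule: infinite_finite_induct) auto
    have const_sum: "(\<Sum>T\<in>I. [:f T:]) = [:\<Sum>T\<in>I. f T:]" for I and f :: "nat set \<Rightarrow> 'k mpoly fract alg_closure"
      by (rule poly_eqI) (simp add: Polynomial.coeff_sum coeff_pCons split: nat.split)
    have const_sign: "(-1) ^ k = [:(-1) ^ k :: 'k mpoly fract alg_closure:]"
      by (induction k) (auto simp: one_pCons)
    show "(-1) ^ k * (\<Sum>T\<in>{T. T \<subseteq> {..<n} \<and> card T = k}. \<Prod>i\<in>T. [:\<alpha> i:]) * [:0, 1:] ^ (n - k) =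
        Polynomial.monom ((-1) ^ k * (\<Sum>T\<in>{T. T \<subseteq> {..<n} \<and> card T = k}. \<Prod>i\<in>T. \<alpha> i)) (n - k)"
      unfolding const_prod const_sum const_sign by (simp add: monom_altdef mult.commute)
  qed
  finally have P_roots: "P = \<dots>" .
  \<comment> \<open>Comparing the coefficients of the two forms of \<open>P\<close> identifies the
    elementary symmetric expressions in the roots with the \<open>y_k\<close>.\<close>
  have e_alpha: "(\<Sum>T\<in>{T. T \<subseteq> {..<n} \<and> card T = k}. \<Prod>i\<in>T. \<alpha> i) = j (ycoeff n k)" if "k \<le> n" for k
  proof -
    have "poly.coeff P (n - k) = (-1) ^ k * (\<Sum>T\<in>{T. T \<subseteq> {..<n} \<and> card T = k}. \<Prod>i\<in>T. \<alpha> i)"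
      using that by (subst P_roots) (simp add: coeff_sum_monom_rev)
    then show ?thesis using that by (simp add: coeff_P)
  qed
  interpret jc: type_hom type_ring "\<lambda>c. j (pconst c)"
    by (rule type_hom_comp[OF type_hom_pconst cring_type_ring j.hom])
  \<comment> \<open>Sending the \<open>t\<close> variables to the roots undoes the substitution:
    \<open>esym n k\<close> goes back to the image of \<open>y_k\<close>. Hence
    \<open>\<tau>\<close> after \<open>esym_hom n\<close> equals \<open>j\<close> after
    \<open>red\<close>, and injectivity of \<open>j\<close> finishes the argument.\<close>
  define \<tau> where "\<tau> = meval type_ring (\<lambda>c. j (pconst c)) \<alpha>"
  have tau: "type_hom type_ring \<tau>" unfolding \<tau>_def by (rule jc.type_hom_meval) simp
  interpret \<tau>: type_hom type_ring \<tau> by (rule tau)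
  have tau_pvar: "\<tau> (pvar i) = \<alpha> i" and tau_pconst: "\<tau> (pconst c) = j (pconst c)" for i c
    unfolding \<tau>_def by (auto intro!: jc.meval_pvar jc.meval_pconst)
  have tau_esym: "\<tau> (esym n k) = j (ycoeff n k)" for k
  proof (cases "k \<le> n")
    case True
    then show ?thesis
      by (simp add: esym_def mvar_eq_pvar \<tau>.hom_sum \<tau>.hom_prod finsum_type_ring finprod_type_ring tau_pvar
          flip: e_alpha)
  next
    case False
    then show ?thesis by (simp add: esym_gt ycoeff_def)
  qed
  have "\<tau> (esym_hom n p) = j (red p)"
  proof (rule type_hom_mpoly_eqI[where h = "\<lambda>q. \<tau> (esym_hom n q)" and g = "\<lambda>q. j (red q)"])
    show "type_hom type_ring (\<lambda>q. \<tau> (esym_hom n q))"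
      by (rule type_hom_comp[OF type_hom_esym_hom cring_type_ring \<tau>.hom])
    show "type_hom type_ring (\<lambda>q. j (red q))"
      by (rule type_hom_comp[OF red cring_type_ring j.hom])
  qed (auto simp: esym_hom_pvar esym_hom_pconst red_pvar red_pconst tau_esym tau_pconst)
  then have "red p = 0" using p by (simp add: j_def)
  then show ?thesis using E_red[of p] by simp
qed

text \<open>The substitution hits every generator, and its image is closed under the ring
  operations. Elements of the generated subring can therefore be handled through their preimages in
  \<open>k[y]\<close>.\<close>

lemma carrier_SymR: "carrier (SymR n) = range (esym_hom n :: 'k::field mpoly \<Rightarrow> _)"
proof -
  interpret s: type_hom type_ring "esym_hom n :: 'k mpoly \<Rightarrow> _" by (rule type_hom_esym_hom)
  let ?G = "generate_ring type_ring (range mconst \<union> esym n ` {1..n}) :: 'k mpoly set"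
  have "esym_hom n p \<in> ?G" for p :: "'k mpoly"
  proof (induction p rule: mpoly_induct)
    case (const c)
    then show ?case by (auto simp: esym_hom_pconst mconst_eq_pconst intro: generate_ring.incl)
  next
    case (var i)
    consider "i = 0" | "i \<in> {1..n}" | "i > n" by force
    then show ?case
    proof cases
      case 1
      then show ?thesis using generate_ring.one[of "type_ring :: 'k mpoly ring"] by (simp add: esym_hom_pvar esym_0)
    next
      case 2
      then show ?thesis by (auto simp: esym_hom_pvar intro: generate_ring.incl)
    next
      case 3
      then show ?thesis using ring.zero_in_generate[OF cring.axioms(1)[OF cring_type_ring]] by (simp add: esym_hom_pvar esym_gt)
    qed
  next
    case (add p q)
    then show ?case using generate_ring.eng_add[OF add] by simp
  next
    case (mult p q)
    then show ?case using generate_ring.eng_mult[OF mult] by simp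
  qed
  moreover have "x \<in> range (esym_hom n)" if "x \<in> ?G" for x
    using that
  proof (induction rule: generate_ring.induct)
    case one
    then show ?case using s.hom_one by (metis rangeI type_ring_simps(4))
  next
    case (incl h)
    then consider c where "h = pconst c" | i where "h = esym n i" by (auto simp: mconst_eq_pconst)
    then show ?case
      by cases (metis esym_hom_pconst rangeI, metis esym_hom_pvar rangeI)
  next
    case (a_inv h)
    then obtain p where "h = esym_hom n p" by auto
    then show ?case by (auto intro!: range_eqI[of _ _ "- p"])
  next
    case (eng_add h1 h2)
    then obtain p q where "h1 = esym_hom n p" "h2 = esym_hom n q" by auto
    then show ?case by (auto intro!: range_eqI[of _ _ "p + q"])
  next
    case (eng_mult h1 h2)
    then obtain p q where "h1 = esym_hom n p" "h2 = esym_hom n q" by auto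
    then show ?case by (auto intro!: range_eqI[of _ _ "p * q"])
  qed
  ultimately show ?thesis by (auto simp: SymR_def)
qed

section \<open>The ring \<open>SymR\<close> and its denominators as images of norms\<close>

lemma SymR_simps [simp]:
  "x \<otimes>\<^bsub>SymR n\<^esub> y = x * y" "x \<oplus>\<^bsub>SymR n\<^esub> y = x + y" "\<one>\<^bsub>SymR n\<^esub> = 1" "\<zero>\<^bsub>SymR n\<^esub> = 0"
  by (simp_all add: SymR_def)

lemma cring_SymR: "cring (SymR n :: 'k::field mpoly ring)"
proof -
  have "subring (generate_ring type_ring (range mconst \<union> esym n ` {1..n})) (type_ring :: 'k mpoly ring)"
    by (rule ring.generate_ring_is_subring[OF cring.axioms(1)[OF cring_type_ring]]) simp
  then show ?thesis
    unfolding SymR_def by (subst ring.subcring_iff[OF cring.axioms(1)[OF cring_type_ring], symmetric])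
      (auto intro: cring.subcringI'[OF cring_type_ring])
qed

text \<open>The norm of \<open>g\<close> modulo the generic polynomial, a polynomial in the
  \<open>y_i\<close>. The lemmas about \<open>mult_matrix\<close> hold for every such matrix, so the
  choice is harmless.\<close>

definition generic_norm :: "nat \<Rightarrow> 'k::field poly \<Rightarrow> 'k mpoly" where
  "generic_norm n g = det (SOME M. mult_matrix n (generic_poly n) (map_poly pconst g) M)"

lemma generic_normE:
  assumes "n \<ge> 1"
  obtains M where "mult_matrix n (generic_poly n) (map_poly pconst g) M" "generic_norm n g = det M"
  using someI_ex[OF mult_matrix_exists[OF generic_poly_monic assms, of "map_poly pconst g"]]
  unfolding generic_norm_def by blast

text \<open>Each product \<open>g(t_1) ... g(t_n)\<close> is the image of a norm in
  \<open>k[y]\<close>. Invertibility of denominators can thus be tested by evaluating norms at the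
  images of the \<open>s_i\<close>.\<close>

lemma Uset_eq:
  assumes "n \<ge> 1"
  shows "Uset n = {esym_hom n (generic_norm n g) | g :: 'k::field poly. poly g 0 \<noteq> 0}"
proof -
  have "esym_hom n (generic_norm n g) = (\<Prod>i<n. poly (map_poly pconst g) (pvar i))" for g :: "'k poly"
    by (rule generic_normE[OF assms, of g]) (simp add: esym_hom_norm)
  then show ?thesis by (simp add: Uset_def mvar_eq_pvar mconst_eq_pconst)
qed

lemma mult_set_Uset:
  assumes "n \<ge> 1"
  shows "mult_set (SymR n) (Uset n :: 'k::field mpoly set)"
proof -
  have map_mult: "map_poly pconst (f * g) = map_poly pconst f * (map_poly pconst g :: 'k mpoly poly)" for f g
    by (rule poly_eqI) (simp add: coeff_map_poly coeff_mult pconst.hom_sum finsum_type_ring)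
  have "s * t \<in> Uset n" if st: "s \<in> Uset n" "t \<in> Uset n" for s t :: "'k mpoly"
  proof -
    obtain f g where fg: "poly f 0 \<noteq> 0" "poly g 0 \<noteq> 0"
      and "s = (\<Prod>i<n. poly (map_poly pconst f) (pvar i))" "t = (\<Prod>i<n. poly (map_poly pconst g) (pvar i))"
      using st by (auto simp: Uset_def mvar_eq_pvar mconst_eq_pconst)
    then have "s * t = (\<Prod>i<n. poly (map_poly pconst (f * g)) (pvar i))"
      by (simp add: map_mult prod.distrib)
    then show ?thesis using fg by (auto simp: Uset_def mvar_eq_pvar mconst_eq_pconst intro!: exI[of _ "f * g"])
  qed
  moreover have "(1 :: 'k mpoly) \<in> Uset n"
    by (auto simp: Uset_def mvar_eq_pvar mconst_eq_pconst intro!: exI[of _ 1])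
  moreover have "(Uset n :: 'k mpoly set) \<subseteq> carrier (SymR n)"
    using assms by (auto simp: Uset_eq carrier_SymR)
  ultimately show ?thesis
    by (simp add: mult_set_def mult_set_axioms_def cring_SymR)
qed

section \<open>Homomorphisms from the localized ring of symmetric polynomials\<close>

locale kalgebra = A?: cring A for A (structure) +
  fixes \<phi> :: "'k::field \<Rightarrow> 'a" and n :: nat
  assumes phi: "\<phi> \<in> ring_hom type_ring A" and n: "n \<ge> 1"
begin

sublocale phi: type_hom A \<phi>
  by unfold_locales (rule phi)

sublocale H: mult_set "SymR n :: 'k mpoly ring" "Uset n"
  using n by (rule mult_set_Uset)

lemma esym_hom_SymR [simp, intro]: "esym_hom n p \<in> carrier (SymR n)"
  by (simp add: carrier_SymR)

lemma esym_SymR [simp, intro]: "(esym n i :: 'k mpoly) \<in> carrier (SymR n)"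
  using esym_hom_SymR[of "pvar i"] by (simp add: esym_hom_pvar)

lemma Uset_one [simp]: "(1 :: 'k mpoly) \<in> Uset n"
  using H.S_one by simp

text \<open>On numerators \<open>\<psi>\<close> is evaluation of the \<open>y_i\<close> at the
  images of the \<open>s_i\<close>: both sides are homomorphisms on \<open>k[y]\<close> that agree
  on constants and variables.\<close>

lemma HomH_eval:
  assumes psi: "\<psi> \<in> HomH n A \<phi>"
  defines "a \<equiv> \<lambda>i. \<psi> (Hn_s n i)"
  shows "\<And>i. a i \<in> carrier A" and "a 0 = \<one>" and "\<And>i. i > n \<Longrightarrow> a i = \<zero>"
    and "\<psi> (loc_frac (SymR n) (Uset n) (esym_hom n p) 1) = meval A \<phi> a p"
proof -
  have hom: "\<psi> \<in> ring_hom (Hn n) A" and alg: "\<And>c. \<psi> (Hn_alg n c) = \<phi> c"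
    using psi by (auto simp: HomH_def kalg_hom_def)
  interpret psi: ring_hom_cring "Hn n" A \<psi>
    unfolding Hn_def by unfold_locales (use hom in \<open>simp add: Hn_def\<close>)
  show a: "a i \<in> carrier A" for i
    unfolding a_def by (rule psi.hom_closed) (simp add: Hn_s_def Hn_def)
  have "(Hn_s n 0 :: ('k mpoly \<times> 'k mpoly) set) = \<one>\<^bsub>Hn n\<^esub>" by (simp add: Hn_s_def Hn_def H.loc_one esym_0)
  then show "a 0 = \<one>" using psi.hom_one by (simp add: a_def)
  have "(Hn_s n i :: ('k mpoly \<times> 'k mpoly) set) = \<zero>\<^bsub>Hn n\<^esub>" if "i > n" for i using that by (simp add: Hn_s_def Hn_def H.loc_zero esym_gt)
  then show "a i = \<zero>" if "i > n" for i using that psi.hom_zero by (simp add: a_def)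
  interpret s: type_hom type_ring "esym_hom n :: 'k mpoly \<Rightarrow> _" by (rule type_hom_esym_hom)
  show "\<psi> (loc_frac (SymR n) (Uset n) (esym_hom n p) 1) = meval A \<phi> a p"
  proof (rule type_hom_mpoly_eqI[where A = A])
    show "type_hom A (meval A \<phi> a)" by (rule phi.type_hom_meval) (rule a)
    show "type_hom A (\<lambda>p. \<psi> (loc_frac (SymR n) (Uset n) (esym_hom n p) 1))"
    proof (rule type_hom_comp[OF _ A.is_cring hom])
      show "type_hom (Hn n) (\<lambda>p :: 'k mpoly. loc_frac (SymR n) (Uset n) (esym_hom n p) 1)"
        unfolding Hn_def by (rule type_homI[OF H.cring_loc])
          (use H.loc_mult[of _ 1 _ 1] H.loc_add[of _ 1 _ 1] in \<open>auto simp: H.loc_one\<close>)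
    qed
    show "\<psi> (loc_frac (SymR n) (Uset n) (esym_hom n (pconst c)) 1) = meval A \<phi> a (pconst c)" for c
      using alg[of c] phi.meval_pconst[of a, OF a] by (simp add: esym_hom_pconst Hn_alg_def mconst_eq_pconst)
    show "\<psi> (loc_frac (SymR n) (Uset n) (esym_hom n (pvar i)) 1) = meval A \<phi> a (pvar i)" for i
      unfolding phi.meval_pvar[of a, OF a] by (simp add: esym_hom_pvar Hn_s_def a_def)
  qed
qed

text \<open>The norm is the value of \<open>\<psi>\<close> at \<open>u/1\<close> for a denominator
  \<open>u\<close>, and the value at \<open>1/u\<close> is its inverse.\<close>

lemma HomH_norm_unit:
  assumes psi: "\<psi> \<in> HomH n A \<phi>" and g: "poly g 0 \<noteq> 0"
  shows "meval A \<phi> (\<lambda>i. \<psi> (Hn_s n i)) (generic_norm n g) \<in> Units A"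
proof -
  have hom: "\<psi> \<in> ring_hom (loc (SymR n) (Uset n)) A"
    using psi by (auto simp: HomH_def kalg_hom_def Hn_def)
  let ?u = "esym_hom n (generic_norm n g)"
  have u: "?u \<in> Uset n" using g by (auto simp: Uset_eq[OF n])
  have c: "\<psi> (H.frac 1 ?u) \<in> carrier A"
    by (rule ring_hom_closed[OF hom]) (use u H.R.one_closed in auto)
  have "H.frac ?u 1 \<otimes>\<^bsub>loc (SymR n) (Uset n)\<^esub> H.frac 1 ?u = \<one>\<^bsub>loc (SymR n) (Uset n)\<^esub>"
    using H.frac_inverse[OF u] by simp
  then have "\<psi> (H.frac ?u 1) \<otimes> \<psi> (H.frac 1 ?u) = \<one>"
    using ring_hom_mult[OF hom, of "H.frac ?u 1" "H.frac 1 ?u"] ring_hom_one[OF hom] u H.R.one_closed by auto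
  then show ?thesis
    using A.unit_factor[of "meval A \<phi> (\<lambda>i. \<psi> (Hn_s n i)) (generic_norm n g)" "\<psi> (H.frac 1 ?u)"]
      c HomH_eval(4)[OF psi, of "generic_norm n g"] phi.meval_closed[of "\<lambda>i. \<psi> (Hn_s n i)", OF HomH_eval(1)[OF psi]] by auto
qed

text \<open>The values on numerators are determined by those on the \<open>s_i\<close>. For a
  fraction \<open>r/u\<close> the image of \<open>u\<close> is a unit and can be cancelled.\<close>

lemma HomH_eqI:
  assumes psi: "\<psi> \<in> HomH n A \<phi>" and psi': "\<psi>' \<in> HomH n A \<phi>"
    and eq: "\<And>i. i \<in> {1..n} \<Longrightarrow> \<psi> (Hn_s n i) = \<psi>' (Hn_s n i)"
  shows "\<psi> = \<psi>'"
proof (rule extensionalityI)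
  show "\<psi> \<in> extensional (carrier (Hn n))" "\<psi>' \<in> extensional (carrier (Hn n))"
    using psi psi' by (auto simp: HomH_def)
next
  \<comment> \<open>Outside \<open>{1..n}\<close> the values are forced, to be one at index 0 and
    zero beyond \<open>n\<close>.\<close>
  have eq': "(\<lambda>i. \<psi> (Hn_s n i)) = (\<lambda>i. \<psi>' (Hn_s n i))"
  proof
    fix i
    consider "i = 0" | "i \<in> {1..n}" | "i > n" by force
    then show "\<psi> (Hn_s n i) = \<psi>' (Hn_s n i)"
      using HomH_eval(2,3)[OF psi] HomH_eval(2,3)[OF psi'] eq by cases auto
  qed
  have hom: "\<psi> \<in> ring_hom (loc (SymR n) (Uset n)) A" "\<psi>' \<in> ring_hom (loc (SymR n) (Uset n)) A"
    using psi psi' by (auto simp: HomH_def kalg_hom_def Hn_def)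
  fix x :: "('k mpoly \<times> 'k mpoly) set" assume "x \<in> carrier (Hn n)"
  then obtain r u where ru: "r \<in> carrier (SymR n)" "u \<in> Uset n" "x = H.frac r u"
    unfolding Hn_def by (rule H.locE)
  obtain p where p: "r = esym_hom n p" using ru(1) by (auto simp: carrier_SymR)
  obtain g where g: "u = esym_hom n (generic_norm n g)" "poly g 0 \<noteq> 0"
    using ru(2) by (auto simp: Uset_eq[OF n])
  have x: "x \<in> carrier (loc (SymR n) (Uset n))" using ru by auto
  have u1: "H.frac u 1 \<in> carrier (loc (SymR n) (Uset n))" using ru(2) by auto
  have mult: "x \<otimes>\<^bsub>loc (SymR n) (Uset n)\<^esub> H.frac u 1 = H.frac r 1"
    using H.frac_mult_denominator[of r u] ru by simp
  have "\<psi> x \<otimes> \<psi> (H.frac u 1) = \<psi>' x \<otimes> \<psi>' (H.frac u 1)"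
    using ring_hom_mult[OF hom(1) x u1] ring_hom_mult[OF hom(2) x u1] mult
      HomH_eval(4)[OF psi, of p] HomH_eval(4)[OF psi', of p] by (simp add: p eq')
  moreover have "\<psi> (H.frac u 1) = \<psi>' (H.frac u 1)"
    using HomH_eval(4)[OF psi, of "generic_norm n g"] HomH_eval(4)[OF psi', of "generic_norm n g"]
    by (simp add: g eq')
  moreover have "\<psi> (H.frac u 1) \<in> Units A"
    using HomH_norm_unit[OF psi g(2)] HomH_eval(4)[OF psi, of "generic_norm n g"] by (simp add: g)
  ultimately show "\<psi> x = \<psi>' x"
    using ring_hom_closed[OF hom(1) x] ring_hom_closed[OF hom(2) x]
    by (metis A.Units_closed A.Units_l_cancel A.m_comm)
qed

text \<open>Algebraic independence of the \<open>s_i\<close> makes the assignment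
  \<open>s_i \<mapsto> a i\<close> a well-defined homomorphism \<open>f\<close> on
  \<open>SymR n\<close>, and the hypothesis on norms lets \<open>f\<close> extend to the
  localization.\<close>

lemma HomH_exists:
  assumes a: "\<And>i. a i \<in> carrier A" and a0: "a 0 = \<one>" and an: "\<And>i. i > n \<Longrightarrow> a i = \<zero>"
    and units: "\<And>g. poly g 0 \<noteq> 0 \<Longrightarrow> meval A \<phi> a (generic_norm n g) \<in> Units A"
  obtains \<psi> where "\<psi> \<in> HomH n A \<phi>" "\<And>i. \<psi> (Hn_s n i) = a i"
proof -
  interpret E: type_hom A "meval A \<phi> a" by (rule phi.type_hom_meval) (rule a)
  interpret s: type_hom type_ring "esym_hom n :: 'k mpoly \<Rightarrow> _" by (rule type_hom_esym_hom)
  define f where "f x = meval A \<phi> a (SOME p. esym_hom n p = x)" for x :: "'k mpoly"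
  have f: "f (esym_hom n p) = meval A \<phi> a p" for p
  proof -
    define q :: "'k mpoly" where "q = (SOME q. esym_hom n q = esym_hom n p)"
    have q: "esym_hom n q = esym_hom n p" unfolding q_def by (rule someI[of _ p]) simp
    \<comment> \<open>Two preimages of one symmetric polynomial differ by an element of the kernel
      of \<open>esym_hom n\<close>; \<open>a0\<close> and \<open>an\<close> are the normalizations
      that \<open>esym_hom_kernel\<close> demands.\<close>
    have "meval A \<phi> a (q - p) = \<zero>"
      by (rule esym_hom_kernel[OF E.type_hom_axioms, of n])
        (use q in \<open>auto simp: phi.meval_pvar[of a, OF a] a0 an s.hom_diff a_minus_def\<close>)
    then show ?thesis by (simp add: f_def q_def[symmetric])
  qed
  have f_hom: "f \<in> ring_hom (SymR n) A"
  proof (rule ring_hom_memI)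
    fix x y :: "'k mpoly" assume "x \<in> carrier (SymR n)" "y \<in> carrier (SymR n)"
    then obtain p q where "x = esym_hom n p" "y = esym_hom n q" by (auto simp: carrier_SymR)
    then show "f (x \<otimes>\<^bsub>SymR n\<^esub> y) = f x \<otimes> f y" "f (x \<oplus>\<^bsub>SymR n\<^esub> y) = f x \<oplus> f y"
      using f[of "p * q"] f[of "p + q"] by (simp_all add: f)
  next
    show "f \<one>\<^bsub>SymR n\<^esub> = \<one>" using f[of 1] by simp
  qed (auto simp: carrier_SymR f)
  have f_units: "f ` Uset n \<subseteq> Units A" using units by (auto simp: Uset_eq[OF n] f)
  define \<psi> where "\<psi> = restrict (loc_lift A f) (carrier (Hn n))"
  have psi: "\<psi> (H.frac (esym_hom n p) 1) = meval A \<phi> a p" for p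
  proof -
    have "\<psi> (H.frac (esym_hom n p) 1) = loc_lift A f (H.frac (esym_hom n p) 1)"
      by (simp add: \<psi>_def Hn_def)
    also have "\<dots> = f (esym_hom n p) \<otimes> inv f 1"
      by (rule H.loc_lift_frac[OF A.is_cring f_hom f_units]) auto
    finally show ?thesis using f[of 1] by (simp add: f)
  qed
  have "\<psi> \<in> ring_hom (Hn n) A"
    using H.loc_lift_hom[OF A.is_cring f_hom f_units] H.L.is_cring
    unfolding \<psi>_def Hn_def ring_hom_def by (auto simp: H.L.m_closed H.L.a_closed H.L.one_closed Pi_iff)
  moreover have "\<psi> (Hn_alg n c) = \<phi> c" for c
    using psi[of "pconst c"] by (simp add: Hn_alg_def mconst_eq_pconst esym_hom_pconst phi.meval_pconst[of a, OF a])
  ultimately have "\<psi> \<in> HomH n A \<phi>" by (auto simp: HomH_def kalg_hom_def \<psi>_def)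
  moreover have "\<psi> (Hn_s n i) = a i" for i
    using psi[of "pvar i"] by (simp add: Hn_s_def esym_hom_pvar phi.meval_pvar[of a, OF a])
  ultimately show ?thesis by (rule that)
qed

end

section \<open>Determinants over a carrier-based ring\<close>

lemma (in abelian_monoid) finsum_swap:
  assumes "finite I" "finite J" "\<And>i j. i \<in> I \<Longrightarrow> j \<in> J \<Longrightarrow> f i j \<in> carrier G"
  shows "(\<Oplus>i\<in>I. \<Oplus>j\<in>J. f i j) = (\<Oplus>j\<in>J. \<Oplus>i\<in>I. f i j)"
  using assms(1,3)
proof (induction I rule: finite_induct)
  case (insert x I)
  have "(\<Oplus>i\<in>insert x I. \<Oplus>j\<in>J. f i j) = (\<Oplus>j\<in>J. f x j) \<oplus> (\<Oplus>j\<in>J. \<Oplus>i\<in>I. f i j)"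
    using insert by (subst finsum_insert) (auto intro!: finsum_closed)
  also have "\<dots> = (\<Oplus>j\<in>J. f x j \<oplus> (\<Oplus>i\<in>I. f i j))"
    using insert by (subst finsum_addf) (auto intro!: finsum_closed)
  also have "\<dots> = (\<Oplus>j\<in>J. \<Oplus>i\<in>insert x I. f i j)"
    using insert by (intro finsum_cong') (auto intro!: finsum_closed)
  finally show ?case .
qed (simp add: finsum_zero)

text \<open>By the Leibniz formula the image of a determinant depends only on the images of the
  entries. Lifts to different rings can therefore be exchanged.\<close>

lemma det_hom_cong:
  assumes h: "type_hom A h" and g: "type_hom A g"
    and M: "M \<in> carrier_mat n n" and N: "N \<in> carrier_mat n n"
    and eq: "\<And>i j. i < n \<Longrightarrow> j < n \<Longrightarrow> h (M $$ (i, j)) = g (N $$ (i, j))"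
  shows "h (det M) = g (det N)"
proof -
  interpret h: type_hom A h by (rule h)
  interpret g: type_hom A g by (rule g)
  have "h (of_int (sign p) * (\<Prod>i = 0..<n. M $$ (i, p i))) = g (of_int (sign p) * (\<Prod>i = 0..<n. N $$ (i, p i)))"
    if "p permutes {0..<n}" for p
  proof -
    have "h (\<Prod>i = 0..<n. M $$ (i, p i)) = g (\<Prod>i = 0..<n. N $$ (i, p i))"
      unfolding h.hom_prod g.hom_prod
      by (intro h.A.finprod_cong') (use that eq permutes_in_image[OF that] in auto)
    then show ?thesis by (simp add: sign_def)
  qed
  then show ?thesis
    unfolding det_def'[OF M] det_def'[OF N] h.hom_sum g.hom_sum
    by (intro h.A.finsum_cong') auto
qed

section \<open>Linear combinations with coefficients in \<open>A\<close> inside an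
  \<open>A\<close>-algebra \<open>Q\<close>\<close>

locale lin_comb = A?: cring A + Q: cring Q for A (structure) and Q (structure) +
  fixes \<sigma> :: "'a \<Rightarrow> 'c" and n :: nat
  assumes sigma: "\<sigma> \<in> ring_hom A Q"
begin

sublocale \<sigma>: ring_hom_cring A Q \<sigma>
  by unfold_locales (rule sigma)

definition lc :: "(nat \<Rightarrow> 'a) \<Rightarrow> (nat \<Rightarrow> 'c) \<Rightarrow> 'c" where
  "lc c x = (\<Oplus>\<^bsub>Q\<^esub>i\<in>{..<n}. \<sigma> (c i) \<otimes>\<^bsub>Q\<^esub> x i)"

lemma lc_closed [simp, intro]:
  "(\<And>i. i < n \<Longrightarrow> c i \<in> carrier A) \<Longrightarrow> (\<And>i. i < n \<Longrightarrow> x i \<in> carrier Q) \<Longrightarrow> lc c x \<in> carrier Q"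
  by (auto simp: lc_def intro!: Q.finsum_closed)

lemma lc_cong:
  "(\<And>i. i < n \<Longrightarrow> c i = d i) \<Longrightarrow> (\<And>i. i < n \<Longrightarrow> x i = y i) \<Longrightarrow>
   (\<And>i. i < n \<Longrightarrow> d i \<in> carrier A) \<Longrightarrow> (\<And>i. i < n \<Longrightarrow> y i \<in> carrier Q) \<Longrightarrow> lc c x = lc d y"
  unfolding lc_def by (intro Q.finsum_cong') auto

text \<open>Coordinates transform as a row vector times a matrix: the coordinates of
  \<open>c\<close> combined with the rows of \<open>D\<close> are \<open>c D\<close>.\<close>

lemma lc_comp:
  assumes c: "\<And>j. j < n \<Longrightarrow> c j \<in> carrier A" and w: "\<And>k. k < n \<Longrightarrow> w k \<in> carrier Q"
    and D: "\<And>j k. j < n \<Longrightarrow> k < n \<Longrightarrow> D j k \<in> carrier A"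
    and z: "\<And>j. j < n \<Longrightarrow> z j = lc (D j) w"
  shows "lc c z = lc (\<lambda>k. \<Oplus>j\<in>{..<n}. c j \<otimes> D j k) w"
proof -
  have "lc c z = (\<Oplus>\<^bsub>Q\<^esub>j\<in>{..<n}. \<Oplus>\<^bsub>Q\<^esub>k\<in>{..<n}. \<sigma> (c j) \<otimes>\<^bsub>Q\<^esub> (\<sigma> (D j k) \<otimes>\<^bsub>Q\<^esub> w k))"
    unfolding lc_def
    by (intro Q.finsum_cong') (auto simp: z lc_def c w D Q.finsum_rdistr intro!: Q.finsum_closed)
  also have "\<dots> = (\<Oplus>\<^bsub>Q\<^esub>k\<in>{..<n}. \<Oplus>\<^bsub>Q\<^esub>j\<in>{..<n}. \<sigma> (c j) \<otimes>\<^bsub>Q\<^esub> (\<sigma> (D j k) \<otimes>\<^bsub>Q\<^esub> w k))"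
    by (rule Q.finsum_swap) (auto simp: c w D)
  also have "\<dots> = lc (\<lambda>k. \<Oplus>j\<in>{..<n}. c j \<otimes> D j k) w"
    unfolding lc_def
  proof (intro Q.finsum_cong' refl)
    fix k assume k: "k \<in> {..<n}"
    have "(\<Oplus>\<^bsub>Q\<^esub>j\<in>{..<n}. \<sigma> (c j) \<otimes>\<^bsub>Q\<^esub> (\<sigma> (D j k) \<otimes>\<^bsub>Q\<^esub> w k)) = (\<Oplus>\<^bsub>Q\<^esub>j\<in>{..<n}. \<sigma> (c j \<otimes> D j k) \<otimes>\<^bsub>Q\<^esub> w k)"
      using k by (intro Q.finsum_cong') (auto simp: c w D Q.m_assoc)
    also have "\<dots> = (\<Oplus>\<^bsub>Q\<^esub>j\<in>{..<n}. \<sigma> (c j \<otimes> D j k)) \<otimes>\<^bsub>Q\<^esub> w k"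
      using k by (subst Q.finsum_ldistr) (auto simp: c w D)
    also have "(\<Oplus>\<^bsub>Q\<^esub>j\<in>{..<n}. \<sigma> (c j \<otimes> D j k)) = \<sigma> (\<Oplus>j\<in>{..<n}. c j \<otimes> D j k)"
      using k by (subst \<sigma>.hom_finsum) (auto simp: c D comp_def)
    finally show "(\<Oplus>\<^bsub>Q\<^esub>j\<in>{..<n}. \<sigma> (c j) \<otimes>\<^bsub>Q\<^esub> (\<sigma> (D j k) \<otimes>\<^bsub>Q\<^esub> w k)) = \<sigma> (\<Oplus>j\<in>{..<n}. c j \<otimes> D j k) \<otimes>\<^bsub>Q\<^esub> w k" .
  qed (auto simp: c w D intro!: Q.m_closed \<sigma>.hom_closed A.finsum_closed)
  finally show ?thesis .
qed

lemma lc_delta: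
  assumes "k < n" "a \<in> carrier A" "x k \<in> carrier Q" "\<And>i. i < n \<Longrightarrow> x i \<in> carrier Q"
  shows "lc (\<lambda>i. if k = i then a else \<zero>) x = \<sigma> a \<otimes>\<^bsub>Q\<^esub> x k"
proof -
  have "lc (\<lambda>i. if k = i then a else \<zero>) x = (\<Oplus>\<^bsub>Q\<^esub>i\<in>{..<n}. if k = i then \<sigma> a \<otimes>\<^bsub>Q\<^esub> x i else \<zero>\<^bsub>Q\<^esub>)"
    unfolding lc_def using assms by (intro Q.finsum_cong') auto
  also have "\<dots> = \<sigma> a \<otimes>\<^bsub>Q\<^esub> x k"
    using assms by (intro Q.add.finprod_singleton) auto
  finally show ?thesis .
qed

lemma lc_zero: "(\<And>i. i < n \<Longrightarrow> x i \<in> carrier Q) \<Longrightarrow> lc (\<lambda>i. \<zero>) x = \<zero>\<^bsub>Q\<^esub>"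
  unfolding lc_def by (rule trans[OF Q.finsum_cong' Q.finsum_zero]) auto

lemma lc_zero_right: "(\<And>i. i < n \<Longrightarrow> c i \<in> carrier A) \<Longrightarrow> lc c (\<lambda>i. \<zero>\<^bsub>Q\<^esub>) = \<zero>\<^bsub>Q\<^esub>"
  unfolding lc_def by (rule trans[OF Q.finsum_cong' Q.finsum_zero]) auto

lemma lc_diff:
  assumes "\<And>i. i < n \<Longrightarrow> c i \<in> carrier A" "\<And>i. i < n \<Longrightarrow> d i \<in> carrier A" "\<And>i. i < n \<Longrightarrow> x i \<in> carrier Q"
  shows "lc (\<lambda>i. c i \<ominus> d i) x = lc c x \<ominus>\<^bsub>Q\<^esub> lc d x"
proof -
  have neg: "lc (\<lambda>i. \<ominus> d i) x = \<ominus>\<^bsub>Q\<^esub> lc d x"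
  proof (rule Q.minus_equality[symmetric])
    have "lc (\<lambda>i. \<ominus> d i) x \<oplus>\<^bsub>Q\<^esub> lc d x = (\<Oplus>\<^bsub>Q\<^esub>i\<in>{..<n}. \<sigma> (\<ominus> d i) \<otimes>\<^bsub>Q\<^esub> x i \<oplus>\<^bsub>Q\<^esub> \<sigma> (d i) \<otimes>\<^bsub>Q\<^esub> x i)"
      unfolding lc_def using assms by (subst Q.finsum_addf) auto
    also have "\<dots> = (\<Oplus>\<^bsub>Q\<^esub>i\<in>{..<n}. \<zero>\<^bsub>Q\<^esub>)"
      using assms by (intro Q.finsum_cong') (auto simp: Q.l_neg simp flip: Q.l_distr)
    finally show "lc (\<lambda>i. \<ominus> d i) x \<oplus>\<^bsub>Q\<^esub> lc d x = \<zero>\<^bsub>Q\<^esub>" by (simp add: Q.finsum_zero)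
  qed (use assms in auto)
  have "lc (\<lambda>i. c i \<ominus> d i) x = (\<Oplus>\<^bsub>Q\<^esub>i\<in>{..<n}. \<sigma> (c i) \<otimes>\<^bsub>Q\<^esub> x i \<oplus>\<^bsub>Q\<^esub> \<sigma> (\<ominus> d i) \<otimes>\<^bsub>Q\<^esub> x i)"
    unfolding lc_def using assms by (intro Q.finsum_cong') (auto simp: a_minus_def Q.l_distr)
  also have "\<dots> = lc c x \<oplus>\<^bsub>Q\<^esub> lc (\<lambda>i. \<ominus> d i) x"
    unfolding lc_def using assms by (subst Q.finsum_addf) auto
  finally show ?thesis by (simp add: neg a_minus_def)
qed

end

text \<open>Viewing a ring as an algebra over itself makes the rules for \<open>lc\<close> available
  for sums of products in the ring.\<close>

lemma (in cring) lin_comb_self: "lin_comb R R id"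
  by (intro lin_comb.intro lin_comb_axioms.intro is_cring) (auto simp: ring_hom_def)

text \<open>Determinants and adjugates of matrices over the carrier-based ring \<open>A\<close> are computed on lifts along a
  surjection from a type-class ring.\<close>

locale surj_hom = type_hom A \<epsilon> for A (structure) and \<epsilon> :: "'r::comm_ring_1 \<Rightarrow> 'a" +
  assumes surj: "\<And>a. a \<in> carrier A \<Longrightarrow> \<exists>r. \<epsilon> r = a"
begin

definition rep :: "'a \<Rightarrow> 'r" where "rep a = (SOME r. \<epsilon> r = a)"

lemma rep [simp]: "a \<in> carrier A \<Longrightarrow> \<epsilon> (rep a) = a"
  unfolding rep_def using surj by (metis (mono_tags, lifting) someI_ex)

text \<open>A matrix with a left inverse has invertible determinant. The entries of \<open>M\<close>
  lie in the source of \<open>h\<close>, which may be another ring than that of the lifts, so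
  \<open>D\<close> lifts the images \<open>h (M $$ (i, j))\<close>. The product of the lifts agrees
  with the identity only after applying \<open>\<epsilon>\<close>, which \<open>det_hom_cong\<close>
  accepts.\<close>

lemma det_unit:
  assumes h: "type_hom A h" and M: "M \<in> carrier_mat n n"
    and W: "\<And>i j. i < n \<Longrightarrow> j < n \<Longrightarrow> W i j \<in> carrier A"
    and inv: "\<And>i k. i < n \<Longrightarrow> k < n \<Longrightarrow> (\<Oplus>j\<in>{..<n}. W i j \<otimes> h (M $$ (j, k))) = (if i = k then \<one> else \<zero>)"
  shows "h (det M) \<in> Units A"
proof -
  interpret h: type_hom A h by (rule h)
  define W' where "W' = mat n n (\<lambda>(i, j). rep (W i j))"
  define D where "D = mat n n (\<lambda>(i, j). rep (h (M $$ (i, j))))"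
  have carr: "W' \<in> carrier_mat n n" "D \<in> carrier_mat n n" by (auto simp: W'_def D_def)
  have "\<epsilon> (det W') \<otimes> \<epsilon> (det D) = \<epsilon> (det (W' * D))" using carr by (simp add: det_mult)
  also have "\<dots> = \<epsilon> (det (1\<^sub>m n))"
  proof (rule det_hom_cong[OF type_hom_axioms type_hom_axioms, of _ n])
    fix i k assume ik: "i < n" "k < n"
    have "\<epsilon> ((W' * D) $$ (i, k)) = \<epsilon> (\<Sum>j<n. W' $$ (i, j) * D $$ (j, k))"
      using ik carr by (simp add: scalar_prod_def lessThan_atLeast0)
    also have "\<dots> = (\<Oplus>j\<in>{..<n}. W i j \<otimes> h (M $$ (j, k)))"
      unfolding hom_sum using ik by (intro A.finsum_cong') (auto simp: W'_def D_def W)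
    also have "\<dots> = \<epsilon> (1\<^sub>m n $$ (i, k))" using ik inv by simp
    finally show "\<epsilon> ((W' * D) $$ (i, k)) = \<epsilon> (1\<^sub>m n $$ (i, k))" .
  qed (use carr in auto)
  finally have "\<epsilon> (det D) \<in> Units A"
    using A.unit_factor[of "\<epsilon> (det D)" "\<epsilon> (det W')"] by (simp add: A.m_comm)
  moreover have "\<epsilon> (det D) = h (det M)"
    by (rule det_hom_cong[OF type_hom_axioms h carr(2) M]) (auto simp: D_def)
  ultimately show ?thesis by simp
qed

text \<open>Multiplying the relation \<open>c M = 0\<close> by the adjugate gives
  \<open>det M\<close> times \<open>c k\<close> equal to zero, and the unit cancels.\<close>

lemma det_unit_kernel:
  assumes M: "M \<in> carrier_mat n n" and u: "\<epsilon> (det M) \<in> Units A"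
    and c: "\<And>j. j < n \<Longrightarrow> c j \<in> carrier A"
    and z: "\<And>k. k < n \<Longrightarrow> (\<Oplus>j\<in>{..<n}. c j \<otimes> \<epsilon> (M $$ (j, k))) = \<zero>"
    and k: "k < n"
  shows "c k = \<zero>"
proof -
  interpret S: lin_comb A A id n by (rule A.lin_comb_self)
  note adj = adj_mat[OF M]
  have "\<zero> = S.lc (\<lambda>l. \<zero>) (\<lambda>l. \<epsilon> (adj_mat M $$ (l, k)))"
    by (rule S.lc_zero[symmetric]) simp
  also have "\<dots> = S.lc (\<lambda>l. \<Oplus>j\<in>{..<n}. c j \<otimes> \<epsilon> (M $$ (j, l))) (\<lambda>l. \<epsilon> (adj_mat M $$ (l, k)))"
    by (rule S.lc_cong) (auto simp: z c intro!: A.finsum_closed)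
  also have "\<dots> = S.lc c (\<lambda>j. S.lc (\<lambda>l. \<epsilon> (M $$ (j, l))) (\<lambda>l. \<epsilon> (adj_mat M $$ (l, k))))"
    by (rule S.lc_comp[symmetric]) (auto simp: c)
  also have "\<dots> = S.lc c (\<lambda>j. if k = j then \<epsilon> (det M) else \<zero>)"
  proof (rule S.lc_cong)
    fix j assume j: "j < n"
    have "S.lc (\<lambda>l. \<epsilon> (M $$ (j, l))) (\<lambda>l. \<epsilon> (adj_mat M $$ (l, k))) = \<epsilon> (\<Sum>l<n. M $$ (j, l) * adj_mat M $$ (l, k))"
      by (simp add: S.lc_def hom_sum)
    also have "(\<Sum>l<n. M $$ (j, l) * adj_mat M $$ (l, k)) = (M * adj_mat M) $$ (j, k)"
      using j k M adj(1) by (simp add: scalar_prod_def lessThan_atLeast0)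
    also have "\<dots> = (if k = j then det M else 0)" unfolding adj(2) using j k by auto
    also have "\<epsilon> \<dots> = (if k = j then \<epsilon> (det M) else \<zero>)" by simp
    finally show "S.lc (\<lambda>l. \<epsilon> (M $$ (j, l))) (\<lambda>l. \<epsilon> (adj_mat M $$ (l, k))) = (if k = j then \<epsilon> (det M) else \<zero>)" .
  qed (auto simp: c)
  also have "\<dots> = (\<Oplus>j\<in>{..<n}. if k = j then c j \<otimes> \<epsilon> (det M) else \<zero>)"
    unfolding S.lc_def by (intro A.finsum_cong') (auto simp: c)
  also have "\<dots> = c k \<otimes> \<epsilon> (det M)"
    using k by (intro A.add.finprod_singleton) (auto simp: c)
  also have "\<dots> = \<epsilon> (det M) \<otimes> c k" using c[OF k] by (simp add: A.m_comm)
  finally have "\<zero> = \<epsilon> (det M) \<otimes> c k" .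
  from this[symmetric] have "\<epsilon> (det M) \<otimes> c k = \<epsilon> (det M) \<otimes> \<zero>" by simp
  then show ?thesis using u c[OF k] by (simp add: A.Units_l_cancel del: A.r_null)
qed

end

section \<open>Algebras that are free of rank \<open>n\<close>: integrality and spanning
  families\<close>

locale free_algebra = lin_comb A Q \<sigma> n + surj_hom A \<epsilon>
  for A (structure) and Q (structure) and \<sigma> :: "'a \<Rightarrow> 'c" and n and \<epsilon> :: "'r::comm_ring_1 \<Rightarrow> 'a" +
  fixes b :: "nat \<Rightarrow> 'c"
  assumes b: "\<And>i. i < n \<Longrightarrow> b i \<in> carrier Q"
    and basis: "\<And>f. f \<in> carrier Q \<Longrightarrow> \<exists>!c. c \<in> {..<n} \<rightarrow>\<^sub>E carrier A \<and> f = lc c b"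
begin

lemma coordsE:
  assumes "f \<in> carrier Q"
  obtains c where "\<And>i. i < n \<Longrightarrow> c i \<in> carrier A" "f = lc c b"
  using basis[OF assms] by (auto simp: PiE_iff)

lemma coords_unique:
  assumes c: "\<And>i. i < n \<Longrightarrow> c i \<in> carrier A" and d: "\<And>i. i < n \<Longrightarrow> d i \<in> carrier A"
    and eq: "lc c b = lc d b" and i: "i < n"
  shows "c i = d i"
proof -
  have "lc c b = lc (restrict c {..<n}) b" by (rule lc_cong) (auto simp: c b)
  moreover have "lc c b = lc (restrict d {..<n}) b" unfolding eq by (rule lc_cong) (auto simp: d b)
  moreover have "restrict c {..<n} \<in> {..<n} \<rightarrow>\<^sub>E carrier A" "restrict d {..<n} \<in> {..<n} \<rightarrow>\<^sub>E carrier A"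
    using c d by auto
  moreover have "lc c b \<in> carrier Q" using c b by (rule lc_closed)
  ultimately have "restrict c {..<n} = restrict d {..<n}"
    using basis[of "lc c b"] by blast
  then show ?thesis using i by (metis lessThan_iff restrict_apply')
qed

lemma type_hom_sigma_eps: "type_hom Q (\<lambda>r. \<sigma> (\<epsilon> r))"
  by (rule type_hom_comp[OF type_hom_axioms Q.is_cring sigma])

text \<open>The determinant trick: \<open>\<chi>(\<xi>)\<close> annihilates every \<open>b\<^sub>k\<close>, where \<open>\<chi>\<close> is the characteristic polynomial of
  multiplication by \<open>\<xi>\<close>.\<close>

lemma integral:
  assumes xi: "\<xi> \<in> carrier Q"
  obtains p where "Polynomial.degree p = n" "poly.coeff p n = 1" "peval Q (\<lambda>r. \<sigma> (\<epsilon> r)) \<xi> p = \<zero>\<^bsub>Q\<^esub>"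
proof -
  interpret se: type_hom Q "\<lambda>r. \<sigma> (\<epsilon> r)" by (rule type_hom_sigma_eps)
  let ?\<theta> = "peval Q (\<lambda>r. \<sigma> (\<epsilon> r)) \<xi>"
  interpret \<theta>: type_hom Q ?\<theta> by (rule se.type_hom_peval) (rule xi)
  interpret S: lin_comb Q Q id n by (rule Q.lin_comb_self)
  have "\<forall>i. \<exists>c. i < n \<longrightarrow> (\<forall>j<n. c j \<in> carrier A) \<and> \<xi> \<otimes>\<^bsub>Q\<^esub> b i = lc c b"
    using coordsE[OF Q.m_closed[OF xi b]] by metis
  then obtain C where C: "\<And>i j. i < n \<Longrightarrow> j < n \<Longrightarrow> C i j \<in> carrier A"
    and xib: "\<And>i. i < n \<Longrightarrow> \<xi> \<otimes>\<^bsub>Q\<^esub> b i = lc (C i) b"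
    by metis
  define M where "M = mat n n (\<lambda>(i, j). rep (C i j))"
  have M: "M \<in> carrier_mat n n" by (simp add: M_def)
  \<comment> \<open>\<open>N\<close> is \<open>x - M\<close>. Evaluated at \<open>x = \<xi>\<close>
    it annihilates the vector of the \<open>b i\<close>, and the adjugate of \<open>N\<close> then
    brings out the characteristic polynomial.\<close>
  define N where "N = char_poly_matrix M"
  have N: "N \<in> carrier_mat n n" using M by (simp add: N_def)
  note adj = adj_mat[OF N]
  have thN: "?\<theta> (N $$ (i, j)) = (if i = j then \<xi> else \<zero>\<^bsub>Q\<^esub>) \<ominus>\<^bsub>Q\<^esub> \<sigma> (C i j)" if "i < n" "j < n" for i j
  proof -
    have "N $$ (i, j) = (if i = j then [:0, 1:] else 0) + [:- rep (C i j):]"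
      using that M by (auto simp: N_def char_poly_matrix_def M_def)
    then show ?thesis
      using that C by (auto simp: \<theta>.hom_add se.peval_X[OF xi] se.peval_const[OF xi] a_minus_def simp del: add_pCons)
  qed
  have row: "S.lc (\<lambda>j. ?\<theta> (N $$ (i, j))) b = \<zero>\<^bsub>Q\<^esub>" if i: "i < n" for i
  proof -
    have "S.lc (\<lambda>j. ?\<theta> (N $$ (i, j))) b = S.lc (\<lambda>j. (if i = j then \<xi> else \<zero>\<^bsub>Q\<^esub>) \<ominus>\<^bsub>Q\<^esub> \<sigma> (C i j)) b"
      by (rule S.lc_cong) (use i in \<open>auto simp: thN C b xi\<close>)
    also have "\<dots> = S.lc (\<lambda>j. if i = j then \<xi> else \<zero>\<^bsub>Q\<^esub>) b \<ominus>\<^bsub>Q\<^esub> S.lc (\<lambda>j. \<sigma> (C i j)) b"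
      by (rule S.lc_diff) (use i in \<open>auto simp: C b xi\<close>)
    also have "S.lc (\<lambda>j. if i = j then \<xi> else \<zero>\<^bsub>Q\<^esub>) b = \<xi> \<otimes>\<^bsub>Q\<^esub> b i"
      by (rule trans[OF S.lc_delta]) (use i xi b in auto)
    also have "S.lc (\<lambda>j. \<sigma> (C i j)) b = \<xi> \<otimes>\<^bsub>Q\<^esub> b i"
      using xib[OF i] by (simp add: S.lc_def lc_def)
    also have "\<xi> \<otimes>\<^bsub>Q\<^esub> b i \<ominus>\<^bsub>Q\<^esub> \<xi> \<otimes>\<^bsub>Q\<^esub> b i = \<zero>\<^bsub>Q\<^esub>" using i xi b by simp
    finally show ?thesis .
  qed
  have kill: "?\<theta> (char_poly M) \<otimes>\<^bsub>Q\<^esub> b k = \<zero>\<^bsub>Q\<^esub>" if k: "k < n" for k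
  proof -
    have "\<zero>\<^bsub>Q\<^esub> = S.lc (\<lambda>i. ?\<theta> (adj_mat N $$ (k, i))) (\<lambda>i. \<zero>\<^bsub>Q\<^esub>)"
      by (rule S.lc_zero_right[symmetric]) simp
    also have "\<dots> = S.lc (\<lambda>i. ?\<theta> (adj_mat N $$ (k, i))) (\<lambda>i. S.lc (\<lambda>j. ?\<theta> (N $$ (i, j))) b)"
      by (rule S.lc_cong) (auto simp: row)
    also have "\<dots> = S.lc (\<lambda>j. \<Oplus>\<^bsub>Q\<^esub>i\<in>{..<n}. ?\<theta> (adj_mat N $$ (k, i)) \<otimes>\<^bsub>Q\<^esub> ?\<theta> (N $$ (i, j))) b"
      by (rule S.lc_comp) (auto simp: b)
    also have "\<dots> = S.lc (\<lambda>j. if k = j then ?\<theta> (char_poly M) else \<zero>\<^bsub>Q\<^esub>) b"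
    proof (rule S.lc_cong)
      fix j assume j: "j < n"
      have "(\<Oplus>\<^bsub>Q\<^esub>i\<in>{..<n}. ?\<theta> (adj_mat N $$ (k, i)) \<otimes>\<^bsub>Q\<^esub> ?\<theta> (N $$ (i, j))) = ?\<theta> (\<Sum>i<n. adj_mat N $$ (k, i) * N $$ (i, j))"
        by (simp add: \<theta>.hom_sum)
      also have "(\<Sum>i<n. adj_mat N $$ (k, i) * N $$ (i, j)) = (adj_mat N * N) $$ (k, j)"
        using j k N adj(1) by (simp add: scalar_prod_def lessThan_atLeast0)
      also have "\<dots> = (if k = j then char_poly M else 0)"
        unfolding adj(3) using j k by (simp add: char_poly_def N_def)
      also have "?\<theta> \<dots> = (if k = j then ?\<theta> (char_poly M) else \<zero>\<^bsub>Q\<^esub>)" by simp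
      finally show "(\<Oplus>\<^bsub>Q\<^esub>i\<in>{..<n}. ?\<theta> (adj_mat N $$ (k, i)) \<otimes>\<^bsub>Q\<^esub> ?\<theta> (N $$ (i, j))) = (if k = j then ?\<theta> (char_poly M) else \<zero>\<^bsub>Q\<^esub>)" .
    qed (auto simp: b)
    also have "\<dots> = ?\<theta> (char_poly M) \<otimes>\<^bsub>Q\<^esub> b k"
      by (rule trans[OF S.lc_delta]) (use k b in auto)
    finally show ?thesis by simp
  qed
  \<comment> \<open>Since the value at \<open>\<xi>\<close> annihilates the basis, it annihilates
    the expansion of 1 in it and is therefore zero.\<close>
  obtain c where c: "\<And>i. i < n \<Longrightarrow> c i \<in> carrier A" "\<one>\<^bsub>Q\<^esub> = lc c b"
    using coordsE[OF Q.one_closed] by metis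
  have "?\<theta> (char_poly M) = ?\<theta> (char_poly M) \<otimes>\<^bsub>Q\<^esub> lc c b" using c(2)[symmetric] by simp
  also have "\<dots> = (\<Oplus>\<^bsub>Q\<^esub>i\<in>{..<n}. ?\<theta> (char_poly M) \<otimes>\<^bsub>Q\<^esub> (\<sigma> (c i) \<otimes>\<^bsub>Q\<^esub> b i))"
    unfolding lc_def by (rule Q.finsum_rdistr) (auto simp: c b)
  also have "\<dots> = (\<Oplus>\<^bsub>Q\<^esub>i\<in>{..<n}. \<zero>\<^bsub>Q\<^esub>)"
  proof (intro Q.finsum_cong' refl)
    fix i assume i: "i \<in> {..<n}"
    have "?\<theta> (char_poly M) \<otimes>\<^bsub>Q\<^esub> (\<sigma> (c i) \<otimes>\<^bsub>Q\<^esub> b i) = \<sigma> (c i) \<otimes>\<^bsub>Q\<^esub> (?\<theta> (char_poly M) \<otimes>\<^bsub>Q\<^esub> b i)"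
      using i by (intro Q.m_lcomm) (auto simp: c b)
    then show "?\<theta> (char_poly M) \<otimes>\<^bsub>Q\<^esub> (\<sigma> (c i) \<otimes>\<^bsub>Q\<^esub> b i) = \<zero>\<^bsub>Q\<^esub>" using i by (simp add: kill c)
  qed auto
  finally have "?\<theta> (char_poly M) = \<zero>\<^bsub>Q\<^esub>" by (simp add: Q.finsum_zero)
  then show ?thesis using degree_monic_char_poly[OF M] by (intro that) auto
qed

text \<open>Let \<open>W\<close> express the basis through the \<open>x i\<close>, and
  \<open>D\<close> the \<open>x i\<close> through the basis. Uniqueness of coordinates forces
  \<open>W D = 1\<close>, so the determinant of \<open>D\<close> is a unit. A relation
  \<open>c\<close> among the \<open>x i\<close> gives \<open>c D = 0\<close>, hence
  \<open>c = 0\<close>.\<close>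

lemma spanning_independent:
  assumes x: "\<And>i. i < n \<Longrightarrow> x i \<in> carrier Q"
    and span: "\<And>f. f \<in> carrier Q \<Longrightarrow> \<exists>c. (\<forall>i<n. c i \<in> carrier A) \<and> f = lc c x"
    and c: "\<And>i. i < n \<Longrightarrow> c i \<in> carrier A" and z: "lc c x = \<zero>\<^bsub>Q\<^esub>" and i: "i < n"
  shows "c i = \<zero>"
proof -
  have "\<forall>i. \<exists>c. i < n \<longrightarrow> (\<forall>j<n. c j \<in> carrier A) \<and> b i = lc c x" using span[OF b] by metis
  then obtain W where W: "\<And>i j. i < n \<Longrightarrow> j < n \<Longrightarrow> W i j \<in> carrier A" "\<And>i. i < n \<Longrightarrow> b i = lc (W i) x"
    by metis
  have "\<forall>i. \<exists>c. i < n \<longrightarrow> (\<forall>j<n. c j \<in> carrier A) \<and> x i = lc c b" using coordsE[OF x] by metis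
  then obtain D where D: "\<And>i j. i < n \<Longrightarrow> j < n \<Longrightarrow> D i j \<in> carrier A" "\<And>i. i < n \<Longrightarrow> x i = lc (D i) b"
    by metis
  define M where "M = mat n n (\<lambda>(i, j). rep (D i j))"
  have M: "M \<in> carrier_mat n n" by (simp add: M_def)
  have MD: "\<epsilon> (M $$ (i, j)) = D i j" if "i < n" "j < n" for i j
    using that D by (simp add: M_def)
  have sumM: "(\<Oplus>j\<in>{..<n}. d j \<otimes> \<epsilon> (M $$ (j, k))) = (\<Oplus>j\<in>{..<n}. d j \<otimes> D j k)"
    if "k < n" "\<And>j. j < n \<Longrightarrow> d j \<in> carrier A" for d k
    using that by (intro A.finsum_cong') (auto simp: MD D)
  have sum_closed: "(\<Oplus>j\<in>{..<n}. d j \<otimes> D j k) \<in> carrier A"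
    if "k < n" "\<And>j. j < n \<Longrightarrow> d j \<in> carrier A" for d k
    using that by (intro A.finsum_closed) (auto simp: D)
  have "\<epsilon> (det M) \<in> Units A"
  proof (rule det_unit[OF type_hom_axioms M])
    fix i k assume ik: "i < n" "k < n"
    have "lc (W i) x = lc (\<lambda>k. \<Oplus>j\<in>{..<n}. W i j \<otimes> D j k) b"
      by (rule lc_comp) (use ik in \<open>auto simp: W(1) b D(1) D(2)[symmetric]\<close>)
    moreover have "lc (W i) x = lc (\<lambda>k. if i = k then \<one> else \<zero>) b"
      using lc_delta[of i \<one> b] ik b unfolding W(2)[OF ik(1), symmetric] by simp
    ultimately have "(\<Oplus>j\<in>{..<n}. W i j \<otimes> D j k) = (if i = k then \<one> else \<zero>)"
      by (intro coords_unique[where i = k]) (use ik in \<open>auto simp: W(1) sum_closed\<close>)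
    then show "(\<Oplus>j\<in>{..<n}. W i j \<otimes> \<epsilon> (M $$ (j, k))) = (if i = k then \<one> else \<zero>)"
      using ik W(1) by (simp add: sumM)
  qed (rule W(1))
  then show ?thesis
  proof (rule det_unit_kernel[OF M _ c _ i])
    fix k assume k: "k < n"
    have "lc c x = lc (\<lambda>k. \<Oplus>j\<in>{..<n}. c j \<otimes> D j k) b"
      by (rule lc_comp) (auto simp: c b D(1) D(2)[symmetric])
    then have "(\<Oplus>j\<in>{..<n}. c j \<otimes> D j k) = \<zero>"
      by (intro coords_unique[where d = "\<lambda>k. \<zero>", OF _ _ _ k]) (auto simp: c sum_closed z lc_zero b)
    then show "(\<Oplus>j\<in>{..<n}. c j \<otimes> \<epsilon> (M $$ (j, k))) = \<zero>" using k c by (simp add: sumM)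
  qed
qed

end

section \<open>Polynomials over the base algebra and their localization\<close>

text \<open>Elements of \<open>UP A\<close> are coefficient functions, so this is the map of
  polynomial rings induced by \<open>h\<close>.\<close>

definition upmap :: "('r::comm_ring_1 \<Rightarrow> 'a) \<Rightarrow> 'r poly \<Rightarrow> nat \<Rightarrow> 'a" where
  "upmap h p = (\<lambda>i. h (poly.coeff p i))"

lemma cring_UP: "cring A \<Longrightarrow> cring (UP A)"
  by (rule UP_cring.UP_cring) (simp add: UP_cring_def)

lemma type_hom_upmap:
  assumes "type_hom A h"
  shows "type_hom (UP A) (upmap h)"
proof -
  interpret type_hom A h by fact
  have closed: "upmap h p \<in> up A" for p
    by (rule mem_upI) (auto simp: upmap_def coeff_eq_0 intro!: exI[of _ "Polynomial.degree p"])
  show ?thesis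
  proof (rule type_homI)
    fix p q
    show "upmap h (p + q) = upmap h p \<oplus>\<^bsub>UP A\<^esub> upmap h q"
      using closed[of p] closed[of q] by (simp add: UP_def fun_eq_iff upmap_def)
    show "upmap h (p * q) = upmap h p \<otimes>\<^bsub>UP A\<^esub> upmap h q"
      using closed[of p] closed[of q] by (simp add: UP_def fun_eq_iff upmap_def coeff_mult hom_sum)
    show "upmap h p \<in> carrier (UP A)" using closed[of p] by (simp add: UP_def)
    show "upmap h 1 = \<one>\<^bsub>UP A\<^esub>"
      by (auto simp: UP_def fun_eq_iff upmap_def coeff_pCons one_pCons split: nat.split)
    show "cring (UP A)" by (rule cring_UP) (rule A.is_cring)
  qed
qed

lemma up_sub_apply:
  assumes "cring A" "f \<in> carrier (UP A)" "g \<in> carrier (UP A)"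
  shows "(f \<ominus>\<^bsub>UP A\<^esub> g) i = f i \<ominus>\<^bsub>A\<^esub> g i"
proof -
  have c: "up_ring.coeff (UP A) p = p" if "p \<in> carrier (UP A)" for p
    using that by (simp add: UP_def)
  interpret UP_cring A "UP A" by (simp add: UP_cring_def assms)
  show ?thesis
    using coeff_minus[OF assms(2,3), of i]
    unfolding c[OF assms(2)] c[OF assms(3)] c[OF P.minus_closed[OF assms(2,3)]] .
qed

lemma Sx_eq: "Sx A \<phi> = upmap \<phi> ` {g. poly g 0 \<noteq> 0}"
  by (auto simp: Sx_def upmap_def)

section \<open>A ring type surjecting onto \<open>A\<close>, and the localization of
  \<open>A[x]\<close>\<close>

context kalgebra
begin

text \<open>Evaluation on the polynomial ring over \<open>k\<close> with one variable for each
  element of the type \<open>'a\<close>. It provides a commutative ring type mapping onto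
  \<open>A\<close>; variables from outside the carrier go to zero so that all values stay in
  \<open>A\<close>.\<close>

definition eps :: "(('a \<Rightarrow>\<^sub>0 nat) \<Rightarrow>\<^sub>0 'k) \<Rightarrow> 'a" where
  "eps = meval A \<phi> (\<lambda>a. if a \<in> carrier A then a else \<zero>)"

sublocale eps: surj_hom A eps
proof -
  interpret e: type_hom A eps
    unfolding eps_def by (rule phi.type_hom_meval) simp
  show "surj_hom A eps"
  proof
    fix a assume a: "a \<in> carrier A"
    then have "eps (pvar a) = a"
      unfolding eps_def by (subst phi.meval_pvar) auto
    then show "\<exists>r. eps r = a" ..
  qed
qed

lemma eps_pconst: "eps (pconst c) = \<phi> c"
  unfolding eps_def by (rule phi.meval_pconst) simp

sublocale P: cring "UP A"
  by (rule cring_UP) (rule A.is_cring)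

sublocale phiP: type_hom "UP A" "upmap \<phi>"
  by (rule type_hom_upmap) (rule phi.type_hom_axioms)

sublocale epsP: type_hom "UP A" "upmap eps"
  by (rule type_hom_upmap) (rule eps.type_hom_axioms)

lemma mult_set_Sx: "mult_set (UP A) (Sx A \<phi>)"
proof -
  have "\<one>\<^bsub>UP A\<^esub> \<in> Sx A \<phi>" unfolding Sx_eq phiP.hom_one[symmetric] by (rule imageI) simp
  moreover have "s \<otimes>\<^bsub>UP A\<^esub> t \<in> Sx A \<phi>" if "s \<in> Sx A \<phi>" "t \<in> Sx A \<phi>" for s t
    using that by (auto simp: Sx_eq simp flip: phiP.hom_mult)
  ultimately show ?thesis
    by (intro mult_set.intro mult_set_axioms.intro P.is_cring) (auto simp: Sx_eq)
qed

sublocale Loc: mult_set "UP A" "Sx A \<phi>"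
  by (rule mult_set_Sx)

abbreviation LL :: "((nat \<Rightarrow> 'a) \<times> (nat \<Rightarrow> 'a)) set ring" where
  "LL \<equiv> loc (UP A) (Sx A \<phi>)"

abbreviation iota :: "(nat \<Rightarrow> 'a) \<Rightarrow> ((nat \<Rightarrow> 'a) \<times> (nat \<Rightarrow> 'a)) set" where
  "iota f \<equiv> loc_frac (UP A) (Sx A \<phi>) f \<one>\<^bsub>UP A\<^esub>"

sublocale iota: ring_hom_cring "UP A" LL "\<lambda>f. iota f"
  by unfold_locales (rule Loc.inj_loc_hom)

declare Loc.loc_mult [simp del] Loc.loc_add [simp del]

lemma type_hom_iota:
  assumes "type_hom A h"
  shows "type_hom LL (\<lambda>p. iota (upmap h p))"
  by (rule type_hom_comp[OF type_hom_upmap[OF assms] Loc.cring_loc Loc.inj_loc_hom])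

section \<open>Lifting and dividing polynomials over \<open>A\<close>\<close>

lemma carrier_UP: "f \<in> carrier (UP A) \<longleftrightarrow> (\<forall>i. f i \<in> carrier A) \<and> (\<exists>d. \<forall>i>d. f i = \<zero>)"
  by (auto simp: UP_def up_def bound_def)

lemma UP_zero_apply [simp]: "\<zero>\<^bsub>UP A\<^esub> i = \<zero>"
  by (simp add: UP_def)

lemma upmap_sum_monom:
  assumes "\<And>i. i \<le> d \<Longrightarrow> eps (c i) = f i" "\<And>i. i > d \<Longrightarrow> f i = \<zero>"
  shows "upmap eps (\<Sum>i\<le>d. Polynomial.monom (c i) i) = f"
  using assms by (auto simp: fun_eq_iff upmap_def Polynomial.coeff_sum not_le)

lemma up_lift:
  assumes "f \<in> carrier (UP A)"
  obtains p where "upmap eps p = f"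
proof -
  obtain d where "\<forall>i>d. f i = \<zero>" using assms by (auto simp: carrier_UP)
  then have "upmap eps (\<Sum>i\<le>d. Polynomial.monom (eps.rep (f i)) i) = f"
    using assms by (intro upmap_sum_monom) (auto simp: carrier_UP)
  then show ?thesis by (rule that)
qed

lemma up_lift_degree:
  assumes "f \<in> carrier (UP A)" "\<And>i. i \<ge> n \<Longrightarrow> f i = \<zero>"
  obtains p where "upmap eps p = f" "Polynomial.degree p < n"
proof -
  let ?p = "\<Sum>i\<le>n - 1. Polynomial.monom (eps.rep (f i)) i"
  have "upmap eps ?p = f"
    using assms n by (intro upmap_sum_monom) (auto simp: carrier_UP)
  moreover have "Polynomial.degree ?p \<le> n - 1"
    by (intro degree_le) (auto simp: Polynomial.coeff_sum)
  ultimately show ?thesis using n by (intro that) auto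
qed

definition up_monic :: "(nat \<Rightarrow> 'a) \<Rightarrow> bool" where
  "up_monic F \<longleftrightarrow> F \<in> carrier (UP A) \<and> F n = \<one> \<and> (\<forall>i>n. F i = \<zero>)"

lemma up_monicD [dest]: "up_monic F \<Longrightarrow> F \<in> carrier (UP A)"
  by (simp add: up_monic_def)

lemma up_monic_lift:
  assumes "up_monic F"
  obtains p where "upmap eps p = F" "Polynomial.degree p = n" "poly.coeff p n = 1"
proof -
  \<comment> \<open>The top coefficient is lifted to 1 itself, not to an arbitrary preimage of one,
    so that the lift is monic.\<close>
  let ?p = "\<Sum>i\<le>n. Polynomial.monom (if i = n then 1 else eps.rep (F i)) i"
  have "upmap eps ?p = F"
    using assms by (intro upmap_sum_monom) (auto simp: carrier_UP up_monic_def)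
  moreover have c: "poly.coeff ?p n = 1" by (simp add: Polynomial.coeff_sum)
  moreover have "Polynomial.degree ?p = n"
    using c by (intro antisym degree_le le_degree) (auto simp: Polynomial.coeff_sum)
  ultimately show ?thesis by (intro that[of ?p])
qed

lemma up_division:
  assumes F: "up_monic F" and f: "f \<in> carrier (UP A)"
  obtains q r where "q \<in> carrier (UP A)" "r \<in> carrier (UP A)" "f = F \<otimes>\<^bsub>UP A\<^esub> q \<oplus>\<^bsub>UP A\<^esub> r"
    "\<And>i. i \<ge> n \<Longrightarrow> r i = \<zero>"
proof -
  obtain F' where F': "upmap eps F' = F" "Polynomial.degree F' = n" "poly.coeff F' n = 1"
    using F by (rule up_monic_lift)
  obtain p where p: "upmap eps p = f" using f by (rule up_lift)
  obtain q r where qr: "p = F' * q + r" "Polynomial.degree r < n"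
    using monic_division[OF F'(2,3) n] by blast
  have "f = F \<otimes>\<^bsub>UP A\<^esub> upmap eps q \<oplus>\<^bsub>UP A\<^esub> upmap eps r"
    by (simp add: p[symmetric] qr(1) F'(1))
  moreover have "upmap eps r i = \<zero>" if "i \<ge> n" for i
    using qr(2) that by (simp add: upmap_def coeff_eq_0)
  ultimately show ?thesis by (intro that[of "upmap eps q" "upmap eps r"]) auto
qed

text \<open>If \<open>w\<close> is nonzero with highest index \<open>m\<close>, monicity of
  \<open>F\<close> makes coefficient \<open>n + m\<close> of the product equal to
  \<open>w m\<close>, against the vanishing from index \<open>n\<close> on.\<close>

lemma up_monic_mult_zero:
  assumes F: "up_monic F" and w: "w \<in> carrier (UP A)" and z: "\<And>i. i \<ge> n \<Longrightarrow> (F \<otimes>\<^bsub>UP A\<^esub> w) i = \<zero>"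
  shows "F \<otimes>\<^bsub>UP A\<^esub> w = \<zero>\<^bsub>UP A\<^esub>"
proof (cases "w = \<zero>\<^bsub>UP A\<^esub>")
  case True
  then show ?thesis using F by auto
next
  case False
  define m where "m = Max {i. w i \<noteq> \<zero>}"
  obtain d where d: "\<forall>i>d. w i = \<zero>" using w by (auto simp: carrier_UP)
  have fin: "finite {i. w i \<noteq> \<zero>}" by (rule finite_subset[of _ "{..d}"]) (use d not_le in auto)
  have ne: "{i. w i \<noteq> \<zero>} \<noteq> {}" using False by (auto simp: fun_eq_iff)
  have m: "w m \<noteq> \<zero>" using Max_in[OF fin ne] by (simp add: m_def)
  have above: "w i = \<zero>" if "i > m" for i using Max_ge[OF fin, of i] that by (auto simp: m_def)
  obtain F' where F': "upmap eps F' = F" "Polynomial.degree F' = n" "poly.coeff F' n = 1"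
    using F by (rule up_monic_lift)
  \<comment> \<open>This lift of \<open>w\<close> has degree exactly \<open>m\<close>: the sum stops
    at \<open>m\<close>, and the coefficient there maps to the nonzero \<open>w m\<close>.\<close>
  define p where "p = (\<Sum>i\<le>m. Polynomial.monom (eps.rep (w i)) i)"
  have p: "upmap eps p = w"
    unfolding p_def using w above by (intro upmap_sum_monom) (auto simp: carrier_UP)
  have cp: "poly.coeff p m = eps.rep (w m)" by (simp add: p_def Polynomial.coeff_sum)
  have wm: "w m \<in> carrier A" using w by (simp add: carrier_UP)
  have "eps.rep (w m) \<noteq> 0" using m wm by (metis eps.hom_zero eps.rep)
  then have "Polynomial.degree p = m"
    using cp by (intro antisym degree_le le_degree) (auto simp: p_def Polynomial.coeff_sum)
  then have "poly.coeff (F' * p) (n + m) = eps.rep (w m)"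
    using coeff_mult_degree_sum[of F' p] F' cp by simp
  then have "upmap eps (F' * p) (n + m) = w m" using wm by (simp add: upmap_def)
  then have "(F \<otimes>\<^bsub>UP A\<^esub> w) (n + m) = w m" by (simp add: F' p)
  then show ?thesis using z[of "n + m"] m by simp
qed

section \<open>Remainders of degree below \<open>n\<close> as coordinates modulo an ideal\<close>

definition rem :: "(nat \<Rightarrow> 'a) \<Rightarrow> nat \<Rightarrow> 'a" where
  "rem c = (\<lambda>i. if i < n then c i else \<zero>)"

text \<open>Says that the classes of \<open>1, x, ..., x^(n-1)\<close> form an
  \<open>A\<close>-basis of the quotient. Coordinate functions are extensional, so
  \<open>rem\<close> has to replace their values from \<open>n\<close> on by zero to obtain a
  polynomial.\<close>

definition power_basis :: "((nat \<Rightarrow> 'a) \<times> (nat \<Rightarrow> 'a)) set set \<Rightarrow> bool" where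
  "power_basis I \<longleftrightarrow> (\<forall>f\<in>carrier LL. \<exists>!c. c \<in> {..<n} \<rightarrow>\<^sub>E carrier A \<and> f \<ominus>\<^bsub>LL\<^esub> iota (rem c) \<in> I)"

lemma rem_closed [simp]: "c \<in> {..<n} \<rightarrow> carrier A \<Longrightarrow> rem c \<in> carrier (UP A)"
  by (auto simp: carrier_UP rem_def intro!: exI[of _ n])

abbreviation pw :: "nat \<Rightarrow> ((nat \<Rightarrow> 'a) \<times> (nat \<Rightarrow> 'a)) set" where
  "pw j \<equiv> iota (upmap eps ([:0, 1:] ^ j))"

lemma Lx_scalar_eps: "Lx_scalar A \<phi> (eps r) = iota (upmap eps [:r:])"
proof -
  have "up_ring.monom (UP A) (eps r) 0 = upmap eps [:r:]"
    by (auto simp: UP_def upmap_def fun_eq_iff coeff_pCons split: nat.split)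
  then show ?thesis by (simp add: Lx_scalar_def)
qed

lemma Lx_scalar_hom: "Lx_scalar A \<phi> \<in> ring_hom A LL"
proof -
  interpret i: type_hom LL "\<lambda>p. iota (upmap eps p)" by (rule type_hom_iota) (rule eps.type_hom_axioms)
  have "\<exists>r. a = eps r" if "a \<in> carrier A" for a using eps.surj[OF that] by auto
  then have *: "\<exists>r. a = eps r \<and> Lx_scalar A \<phi> a = iota (upmap eps [:r:])" if "a \<in> carrier A" for a
    using that Lx_scalar_eps by metis
  show ?thesis
  proof (rule ring_hom_memI)
    fix x y assume "x \<in> carrier A" "y \<in> carrier A"
    then obtain r s where rs: "x = eps r" "y = eps s" by (metis eps.surj)
    have "Lx_scalar A \<phi> (x \<otimes> y) = Lx_scalar A \<phi> (eps (r * s))"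
      "Lx_scalar A \<phi> (x \<oplus> y) = Lx_scalar A \<phi> (eps (r + s))" by (simp_all add: rs)
    then show "Lx_scalar A \<phi> (x \<otimes> y) = Lx_scalar A \<phi> x \<otimes>\<^bsub>LL\<^esub> Lx_scalar A \<phi> y"
      "Lx_scalar A \<phi> (x \<oplus> y) = Lx_scalar A \<phi> x \<oplus>\<^bsub>LL\<^esub> Lx_scalar A \<phi> y"
      using i.hom_mult[of "[:r:]" "[:s:]"] i.hom_add[of "[:r:]" "[:s:]"]
      unfolding rs Lx_scalar_eps by (simp_all add: mult.commute)
  next
    show "Lx_scalar A \<phi> \<one> = \<one>\<^bsub>LL\<^esub>"
      using Lx_scalar_eps[of 1] i.hom_one by (simp add: one_pCons)
  next
    fix x assume "x \<in> carrier A"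
    then show "Lx_scalar A \<phi> x \<in> carrier LL" using *[of x] by auto
  qed
qed

text \<open>A lift of \<open>rem c\<close> of degree below \<open>n\<close> is expanded in powers of
  \<open>x\<close>.\<close>

lemma power_comb:
  assumes c: "c \<in> {..<n} \<rightarrow> carrier A"
  shows "(\<Oplus>\<^bsub>LL\<^esub>i\<in>{..<n}. Lx_scalar A \<phi> (c i) \<otimes>\<^bsub>LL\<^esub> pw i) = iota (rem c)"
proof -
  interpret i: type_hom LL "\<lambda>p. iota (upmap eps p)" by (rule type_hom_iota) (rule eps.type_hom_axioms)
  obtain p where p: "upmap eps p = rem c" "Polynomial.degree p < n"
  proof (rule up_lift_degree)
    show "rem c \<in> carrier (UP A)" using c by simp
  qed (auto simp: rem_def)
  have "eps (poly.coeff p j) = c j" if "j < n" for j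
    using fun_cong[OF p(1), of j] that by (simp add: upmap_def rem_def)
  then have sc: "iota (upmap eps [:poly.coeff p j:]) = Lx_scalar A \<phi> (c j)" if "j < n" for j
    using that Lx_scalar_eps by metis
  have "iota (rem c) = (\<Oplus>\<^bsub>LL\<^esub>j\<in>{..<n}. iota (upmap eps [:poly.coeff p j:]) \<otimes>\<^bsub>LL\<^esub> pw j)"
    using type_hom_poly_expand[OF i.type_hom_axioms p(2)] by (simp add: p(1))
  also have "\<dots> = (\<Oplus>\<^bsub>LL\<^esub>i\<in>{..<n}. Lx_scalar A \<phi> (c i) \<otimes>\<^bsub>LL\<^esub> pw i)"
  proof (intro Loc.L.finsum_cong' refl)
    have "Lx_scalar A \<phi> (c i) \<in> carrier LL" if "i < n" for i
      by (rule ring_hom_closed[OF Lx_scalar_hom]) (use c that in auto)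
    then show "(\<lambda>i. Lx_scalar A \<phi> (c i) \<otimes>\<^bsub>LL\<^esub> pw i) \<in> {..<n} \<rightarrow> carrier LL"
      by (auto intro!: Loc.L.m_closed i.closed)
  qed (simp add: sc)
  finally show ?thesis by simp
qed

lemma power_basis_free: "power_basis I \<Longrightarrow> free_quot_rank n A \<phi> I"
  unfolding free_quot_rank_def Lx_def
proof (intro exI[of _ pw] conjI ballI)
  show "pw \<in> {..<n} \<rightarrow> carrier LL" by auto
next
  fix f assume I: "power_basis I" and f: "f \<in> carrier LL"
  have "c \<in> {..<n} \<rightarrow>\<^sub>E carrier A \<and> f \<ominus>\<^bsub>LL\<^esub> (\<Oplus>\<^bsub>LL\<^esub>i\<in>{..<n}. Lx_scalar A \<phi> (c i) \<otimes>\<^bsub>LL\<^esub> pw i) \<in> I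
     \<longleftrightarrow> c \<in> {..<n} \<rightarrow>\<^sub>E carrier A \<and> f \<ominus>\<^bsub>LL\<^esub> iota (rem c) \<in> I" for c
    using power_comb[of c] by (auto simp: PiE_iff)
  then show "\<exists>!c. c \<in> {..<n} \<rightarrow>\<^sub>E carrier A \<and> f \<ominus>\<^bsub>LL\<^esub> (\<Oplus>\<^bsub>LL\<^esub>i\<in>{..<n}. Lx_scalar A \<phi> (c i) \<otimes>\<^bsub>LL\<^esub> pw i) \<in> I"
    using I f unfolding power_basis_def by simp
qed

text \<open>Both \<open>r\<close> and zero are remainders of \<open>iota r\<close> modulo
  \<open>I\<close>, so they coincide.\<close>

lemma power_basis_zero:
  assumes I: "ideal I LL" "power_basis I" and r: "r \<in> carrier (UP A)" "\<And>i. i \<ge> n \<Longrightarrow> r i = \<zero>" "iota r \<in> I"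
  shows "r = \<zero>\<^bsub>UP A\<^esub>"
proof -
  interpret I: ideal I LL by (rule I(1))
  let ?c = "restrict r {..<n}" and ?z = "restrict (\<lambda>_. \<zero>) {..<n}"
  have c: "?c \<in> {..<n} \<rightarrow>\<^sub>E carrier A" "?z \<in> {..<n} \<rightarrow>\<^sub>E carrier A" using r by (auto simp: carrier_UP)
  have rem: "rem ?c = r" "rem ?z = \<zero>\<^bsub>UP A\<^esub>" using r by (auto simp: rem_def fun_eq_iff)
  have f: "iota r \<in> carrier LL" using r by auto
  have "iota r \<ominus>\<^bsub>LL\<^esub> iota (rem ?c) \<in> I" using f by (simp add: rem a_minus_def Loc.L.r_neg)
  moreover have "iota r \<ominus>\<^bsub>LL\<^esub> iota (rem ?z) \<in> I" using f r by (simp add: rem a_minus_def)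
  ultimately have "?c = ?z" using I(2) f c unfolding power_basis_def by blast
  then have "r i = \<zero>" if "i < n" for i using that by (metis lessThan_iff restrict_apply')
  then show ?thesis using r(2) by (auto simp: fun_eq_iff not_le[symmetric])
qed

text \<open>The hypothesis makes every denominator invertible modulo \<open>F\<close> already in
  \<open>A[x]\<close>. Remainders then come from division by the monic \<open>F\<close>, and their
  uniqueness can be pulled back to \<open>A[x]\<close>.\<close>

lemma comaximal_power_basis:
  assumes F: "up_monic F"
    and comax: "\<And>s. s \<in> Sx A \<phi> \<Longrightarrow> \<exists>U\<in>carrier (UP A). \<exists>V\<in>carrier (UP A).
       s \<otimes>\<^bsub>UP A\<^esub> U \<oplus>\<^bsub>UP A\<^esub> F \<otimes>\<^bsub>UP A\<^esub> V = \<one>\<^bsub>UP A\<^esub>"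
  shows "power_basis (PIdl\<^bsub>LL\<^esub> (iota F))"
  unfolding power_basis_def
proof (intro ballI)
  let ?I = "PIdl\<^bsub>LL\<^esub> (iota F)"
  have Fc [simp]: "F \<in> carrier (UP A)" using F by auto
  interpret I: ideal ?I LL by (rule Loc.L.cgenideal_ideal) simp
  have mem: "iota F \<otimes>\<^bsub>LL\<^esub> y \<in> ?I" if "y \<in> carrier LL" for y
    using that unfolding cgenideal_def by (intro CollectI exI[of _ y] conjI Loc.L.m_comm) auto
  fix f assume "f \<in> carrier LL"
  then obtain p s where [simp]: "p \<in> carrier (UP A)" "s \<in> Sx A \<phi>" and f: "f = Loc.frac p s" by (rule Loc.locE)
  obtain U V where [simp]: "U \<in> carrier (UP A)" "V \<in> carrier (UP A)"
    and UV: "s \<otimes>\<^bsub>UP A\<^esub> U \<oplus>\<^bsub>UP A\<^esub> F \<otimes>\<^bsub>UP A\<^esub> V = \<one>\<^bsub>UP A\<^esub>" using comax[of s] by auto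
  obtain q r where [simp]: "q \<in> carrier (UP A)" "r \<in> carrier (UP A)"
    and pU: "p \<otimes>\<^bsub>UP A\<^esub> U = F \<otimes>\<^bsub>UP A\<^esub> q \<oplus>\<^bsub>UP A\<^esub> r" and r: "\<And>i. i \<ge> n \<Longrightarrow> r i = \<zero>"
    using up_division[OF F, of "p \<otimes>\<^bsub>UP A\<^esub> U"] by auto
  have fc [simp]: "f \<in> carrier LL" by (simp add: f)
  \<comment> \<open>Multiplication by \<open>s U + F V = 1\<close> replaces the fraction
    \<open>p/s\<close> by the polynomial \<open>p U\<close> modulo \<open>F\<close>, whose remainder
    is \<open>r\<close>.\<close>
  have "f = f \<otimes>\<^bsub>LL\<^esub> iota (s \<otimes>\<^bsub>UP A\<^esub> U \<oplus>\<^bsub>UP A\<^esub> F \<otimes>\<^bsub>UP A\<^esub> V)" by (simp add: UV)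
  also have "\<dots> = (f \<otimes>\<^bsub>LL\<^esub> iota s) \<otimes>\<^bsub>LL\<^esub> iota U \<oplus>\<^bsub>LL\<^esub> iota F \<otimes>\<^bsub>LL\<^esub> (f \<otimes>\<^bsub>LL\<^esub> iota V)"
    by (simp add: Loc.L.r_distr Loc.L.m_ac)
  also have "f \<otimes>\<^bsub>LL\<^esub> iota s = iota p" unfolding f by (rule Loc.frac_mult_denominator) simp_all
  also have "iota p \<otimes>\<^bsub>LL\<^esub> iota U = iota (p \<otimes>\<^bsub>UP A\<^esub> U)" by simp
  also have "\<dots> = iota F \<otimes>\<^bsub>LL\<^esub> iota q \<oplus>\<^bsub>LL\<^esub> iota r" unfolding pU by (simp)
  finally have "f = (iota F \<otimes>\<^bsub>LL\<^esub> iota q \<oplus>\<^bsub>LL\<^esub> iota r) \<oplus>\<^bsub>LL\<^esub> iota F \<otimes>\<^bsub>LL\<^esub> (f \<otimes>\<^bsub>LL\<^esub> iota V)" .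
  moreover have "(a \<oplus>\<^bsub>LL\<^esub> b) \<oplus>\<^bsub>LL\<^esub> c \<ominus>\<^bsub>LL\<^esub> b = a \<oplus>\<^bsub>LL\<^esub> c"
    if "a \<in> carrier LL" "b \<in> carrier LL" "c \<in> carrier LL" for a b c
  proof -
    have "(a \<oplus>\<^bsub>LL\<^esub> b) \<oplus>\<^bsub>LL\<^esub> c \<ominus>\<^bsub>LL\<^esub> b = (a \<oplus>\<^bsub>LL\<^esub> c) \<oplus>\<^bsub>LL\<^esub> (b \<ominus>\<^bsub>LL\<^esub> b)"
      using that by (simp add: a_minus_def Loc.L.a_ac del: Loc.L.r_neg)
    then show ?thesis using that by simp
  qed
  ultimately have "f \<ominus>\<^bsub>LL\<^esub> iota r = iota F \<otimes>\<^bsub>LL\<^esub> iota q \<oplus>\<^bsub>LL\<^esub> iota F \<otimes>\<^bsub>LL\<^esub> (f \<otimes>\<^bsub>LL\<^esub> iota V)"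
    by (metis (no_types, lifting) Fc Loc.L.m_closed Loc.S_one Loc.frac_closed \<open>V \<in> carrier (UP A)\<close>
        \<open>q \<in> carrier (UP A)\<close> \<open>r \<in> carrier (UP A)\<close> fc)
  then have fr: "f \<ominus>\<^bsub>LL\<^esub> iota r \<in> ?I"
    using I.a_closed[OF mem[of "iota q"] mem[of "f \<otimes>\<^bsub>LL\<^esub> iota V"]] by simp
  show "\<exists>!c. c \<in> {..<n} \<rightarrow>\<^sub>E carrier A \<and> f \<ominus>\<^bsub>LL\<^esub> iota (rem c) \<in> ?I"
  proof (rule ex_ex1I)
    have "rem (restrict r {..<n}) = r" using r by (auto simp: rem_def fun_eq_iff)
    moreover have "restrict r {..<n} \<in> {..<n} \<rightarrow>\<^sub>E carrier A"
      using \<open>r \<in> carrier (UP A)\<close> by (auto simp: carrier_UP)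
    ultimately show "\<exists>c. c \<in> {..<n} \<rightarrow>\<^sub>E carrier A \<and> f \<ominus>\<^bsub>LL\<^esub> iota (rem c) \<in> ?I"
      using fr by (intro exI[of _ "restrict r {..<n}"]) simp
  next
    fix c d
    assume c: "c \<in> {..<n} \<rightarrow>\<^sub>E carrier A \<and> f \<ominus>\<^bsub>LL\<^esub> iota (rem c) \<in> ?I"
      and d: "d \<in> {..<n} \<rightarrow>\<^sub>E carrier A \<and> f \<ominus>\<^bsub>LL\<^esub> iota (rem d) \<in> ?I"
    have [simp]: "rem c \<in> carrier (UP A)" "rem d \<in> carrier (UP A)" using c d by (auto simp: PiE_iff)
    \<comment> \<open>The difference of two remainders lies in the ideal generated by
      \<open>F\<close> in the localization. Once it is seen to be a multiple of \<open>F\<close> in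
      \<open>A[x]\<close> itself, its degree forces it to vanish.\<close>
    define t where "t = rem d \<ominus>\<^bsub>UP A\<^esub> rem c"
    have t [simp]: "t \<in> carrier (UP A)" by (simp add: t_def)
    have t0: "t i = \<zero>" if "i \<ge> n" for i
    proof -
      have "t i = rem d i \<ominus> rem c i" unfolding t_def by (rule up_sub_apply[OF A.is_cring]) simp_all
      then show ?thesis using that by (simp add: rem_def)
    qed
    have "iota t = (f \<ominus>\<^bsub>LL\<^esub> iota (rem c)) \<ominus>\<^bsub>LL\<^esub> (f \<ominus>\<^bsub>LL\<^esub> iota (rem d))"
    proof -
      have "iota t = iota (rem d) \<ominus>\<^bsub>LL\<^esub> iota (rem c)"
        unfolding t_def a_minus_def by (subst iota.hom_add) (auto simp: iota.hom_a_inv)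
      also have "\<dots> = (f \<ominus>\<^bsub>LL\<^esub> f) \<oplus>\<^bsub>LL\<^esub> (iota (rem d) \<ominus>\<^bsub>LL\<^esub> iota (rem c))"
        by (simp add: a_minus_def Loc.L.r_neg)
      also have "\<dots> = (f \<ominus>\<^bsub>LL\<^esub> iota (rem c)) \<ominus>\<^bsub>LL\<^esub> (f \<ominus>\<^bsub>LL\<^esub> iota (rem d))"
        by (simp add: a_minus_def Loc.L.minus_add Loc.L.a_ac)
      finally show ?thesis .
    qed
    then have "iota t \<in> ?I"
      using c d I.a_closed[of "f \<ominus>\<^bsub>LL\<^esub> iota (rem c)"] I.a_inv_closed by (simp add: a_minus_def[of _ _ "f \<ominus>\<^bsub>LL\<^esub> iota (rem d)"])
    then obtain y where "y \<in> carrier LL" and y: "iota t = y \<otimes>\<^bsub>LL\<^esub> iota F"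
      unfolding cgenideal_def by blast
    obtain a v where [simp]: "a \<in> carrier (UP A)" "v \<in> Sx A \<phi>" and yav: "y = Loc.frac a v"
      using \<open>y \<in> carrier LL\<close> by (rule Loc.locE)
    have "Loc.frac t \<one>\<^bsub>UP A\<^esub> = Loc.frac (a \<otimes>\<^bsub>UP A\<^esub> F) v"
      unfolding y yav by (subst Loc.loc_mult) simp_all
    then obtain u where [simp]: "u \<in> Sx A \<phi>" and u: "u \<otimes>\<^bsub>UP A\<^esub> (t \<otimes>\<^bsub>UP A\<^esub> v) = u \<otimes>\<^bsub>UP A\<^esub> ((a \<otimes>\<^bsub>UP A\<^esub> F) \<otimes>\<^bsub>UP A\<^esub> \<one>\<^bsub>UP A\<^esub>)"
      unfolding Loc.frac_eq_iff[OF t Loc.S_one P.m_closed[OF \<open>a \<in> carrier (UP A)\<close> Fc] \<open>v \<in> Sx A \<phi>\<close>] by blast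
    \<comment> \<open>Equality of fractions says \<open>u v t = u a F\<close>. As \<open>u v\<close>
      is again a denominator, comaximality with \<open>F\<close> removes it and exhibits
      \<open>t\<close> as \<open>F w\<close>.\<close>
    obtain U V where [simp]: "U \<in> carrier (UP A)" "V \<in> carrier (UP A)"
      and UV: "(u \<otimes>\<^bsub>UP A\<^esub> v) \<otimes>\<^bsub>UP A\<^esub> U \<oplus>\<^bsub>UP A\<^esub> F \<otimes>\<^bsub>UP A\<^esub> V = \<one>\<^bsub>UP A\<^esub>" using comax[of "u \<otimes>\<^bsub>UP A\<^esub> v"] by auto
    define w where "w = U \<otimes>\<^bsub>UP A\<^esub> (u \<otimes>\<^bsub>UP A\<^esub> a) \<oplus>\<^bsub>UP A\<^esub> V \<otimes>\<^bsub>UP A\<^esub> t"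
    have w: "w \<in> carrier (UP A)" by (simp add: w_def)
    have "t = t \<otimes>\<^bsub>UP A\<^esub> ((u \<otimes>\<^bsub>UP A\<^esub> v) \<otimes>\<^bsub>UP A\<^esub> U \<oplus>\<^bsub>UP A\<^esub> F \<otimes>\<^bsub>UP A\<^esub> V)" by (simp add: UV)
    also have "\<dots> = U \<otimes>\<^bsub>UP A\<^esub> (u \<otimes>\<^bsub>UP A\<^esub> (t \<otimes>\<^bsub>UP A\<^esub> v)) \<oplus>\<^bsub>UP A\<^esub> F \<otimes>\<^bsub>UP A\<^esub> (V \<otimes>\<^bsub>UP A\<^esub> t)"
      by (simp add: P.r_distr P.m_ac)
    also have "\<dots> = F \<otimes>\<^bsub>UP A\<^esub> w"
      unfolding u w_def by (simp add: P.r_distr P.m_ac)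
    finally have tw: "t = F \<otimes>\<^bsub>UP A\<^esub> w" .
    have "F \<otimes>\<^bsub>UP A\<^esub> w = \<zero>\<^bsub>UP A\<^esub>"
      by (rule up_monic_mult_zero[OF F w]) (metis t0 tw)
    with tw have "t = \<zero>\<^bsub>UP A\<^esub>" by metis
    then have eq: "rem d = rem c" unfolding t_def by (subst (asm) P.r_right_minus_eq) auto
    show "c = d"
    proof (rule PiE_ext[where k = "{..<n}" and s = "\<lambda>_. carrier A"])
      fix i assume "i \<in> {..<n}"
      then show "c i = d i" using fun_cong[OF eq, of i] by (simp add: rem_def)
    next
      show "c \<in> {..<n} \<rightarrow>\<^sub>E carrier A" by (rule conjunct1[OF c])
    next
      show "d \<in> {..<n} \<rightarrow>\<^sub>E carrier A" by (rule conjunct1[OF d])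
    qed
  qed
qed

end

section \<open>From homomorphisms to ideals: values in \<open>Hilb\<close> and injectivity\<close>

context kalgebra
begin

lemma upmap_map_poly_pconst:
  assumes "\<And>c. E (pconst c) = \<phi> c"
  shows "upmap E (map_poly pconst g) = upmap \<phi> g"
  using assms by (simp add: upmap_def fun_eq_iff coeff_map_poly)

lemma upmap_generic_poly:
  assumes a: "\<And>i. a i \<in> carrier A" and a0: "a 0 = \<one>"
  shows "upmap (meval A \<phi> a) (generic_poly n) =
    (\<lambda>j. if j \<le> n then (if even (n - j) then a (n - j) else \<ominus> a (n - j)) else \<zero>)"
proof -
  interpret E: type_hom A "meval A \<phi> a" by (rule phi.type_hom_meval) (rule a)
  have y: "meval A \<phi> a (ycoeff n k) = a k" if "k \<le> n" for k
    using that a0 phi.meval_pvar[of a k, OF a] by (auto simp: ycoeff_def)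
  have "meval A \<phi> a ((-1) ^ k * ycoeff n k) = (if even k then a k else \<ominus> a k)" if "k \<le> n" for k
  proof (cases "even k")
    case True
    then show ?thesis using a[of k] y[OF that] by simp
  next
    case False
    then show ?thesis using a[of k] y[OF that] by (simp add: E.hom_mult[of "- 1"] A.l_minus del: mult_minus_left)
  qed
  then show ?thesis by (auto simp: upmap_def fun_eq_iff coeff_generic_poly)
qed

lemma Fpoly_eq:
  assumes psi: "\<psi> \<in> HomH n A \<phi>"
  shows "Fpoly n A \<psi> = upmap (meval A \<phi> (\<lambda>i. \<psi> (Hn_s n i))) (generic_poly n)"
  unfolding upmap_generic_poly[of "\<lambda>i. \<psi> (Hn_s n i)", OF HomH_eval(1,2)[OF psi]] Fpoly_def ..

lemma up_monic_generic:
  assumes a: "\<And>i. a i \<in> carrier A" and a0: "a 0 = \<one>"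
  shows "up_monic (upmap (meval A \<phi> a) (generic_poly n))"
proof -
  interpret E: type_hom A "meval A \<phi> a" by (rule phi.type_hom_meval) (rule a)
  interpret EP: type_hom "UP A" "upmap (meval A \<phi> a)" by (rule type_hom_upmap) (rule E.type_hom_axioms)
  have "upmap (meval A \<phi> a) (generic_poly n) n = \<one>"
    "\<forall>i>n. upmap (meval A \<phi> a) (generic_poly n) i = \<zero>"
    unfolding upmap_generic_poly[of a, OF a a0] using a0 by auto
  then show ?thesis unfolding up_monic_def using EP.closed by blast
qed

text \<open>Specializing the identity of \<open>mult_matrix_bezout\<close> at \<open>a\<close>
  writes the norm of \<open>g\<close> as a combination of \<open>s\<close> and the specialized
  generic polynomial. The norm is a unit, and multiplying by the constant polynomial
  \<open>d\<close>, its inverse, gives 1.\<close>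

lemma generic_comaximal:
  assumes a: "\<And>i. a i \<in> carrier A"
    and units: "\<And>g. poly g 0 \<noteq> 0 \<Longrightarrow> meval A \<phi> a (generic_norm n g) \<in> Units A"
    and s: "s \<in> Sx A \<phi>"
  shows "\<exists>U\<in>carrier (UP A). \<exists>V\<in>carrier (UP A).
    s \<otimes>\<^bsub>UP A\<^esub> U \<oplus>\<^bsub>UP A\<^esub> upmap (meval A \<phi> a) (generic_poly n) \<otimes>\<^bsub>UP A\<^esub> V = \<one>\<^bsub>UP A\<^esub>"
proof -
  let ?E = "meval A \<phi> a"
  interpret E: type_hom A ?E by (rule phi.type_hom_meval) (rule a)
  interpret EP: type_hom "UP A" "upmap ?E" by (rule type_hom_upmap) (rule E.type_hom_axioms)
  obtain g where g: "s = upmap \<phi> g" "poly g 0 \<noteq> 0" using s by (auto simp: Sx_eq)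
  obtain M where M: "mult_matrix n (generic_poly n) (map_poly pconst g) M" "generic_norm n g = det M"
    using n by (rule generic_normE)
  obtain u v where uv: "[:generic_norm n g:] = map_poly pconst g * u + generic_poly n * v"
    using mult_matrix_bezout[OF M(1) n] M(2) by metis
  let ?N = "?E (generic_norm n g)"
  have N: "?N \<in> Units A" using units g(2) by blast
  define d where "d = upmap eps [:eps.rep (inv ?N):]"
  have d: "d \<in> carrier (UP A)" by (simp add: d_def)
  have "upmap ?E [:generic_norm n g:] = upmap eps [:eps.rep ?N:]"
    by (auto simp: upmap_def fun_eq_iff coeff_pCons split: nat.split)
  then have "d \<otimes>\<^bsub>UP A\<^esub> upmap ?E [:generic_norm n g:] = upmap eps ([:eps.rep (inv ?N):] * [:eps.rep ?N:])"
    by (simp only: d_def epsP.hom_mult)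
  also have "\<dots> = upmap eps 1"
    using N by (auto simp: upmap_def fun_eq_iff coeff_pCons one_pCons A.m_comm split: nat.split)
  also have "\<dots> = \<one>\<^bsub>UP A\<^esub>" by (rule epsP.hom_one)
  finally have one: "d \<otimes>\<^bsub>UP A\<^esub> upmap ?E [:generic_norm n g:] = \<one>\<^bsub>UP A\<^esub>" .
  have sg: "upmap ?E (map_poly pconst g) = s"
    unfolding g(1) by (rule upmap_map_poly_pconst) (rule phi.meval_pconst, rule a)
  have sc: "s \<in> carrier (UP A)" using Loc.S_closed s by blast
  have "s \<otimes>\<^bsub>UP A\<^esub> (d \<otimes>\<^bsub>UP A\<^esub> upmap ?E u) \<oplus>\<^bsub>UP A\<^esub> upmap ?E (generic_poly n) \<otimes>\<^bsub>UP A\<^esub> (d \<otimes>\<^bsub>UP A\<^esub> upmap ?E v)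
     = d \<otimes>\<^bsub>UP A\<^esub> (s \<otimes>\<^bsub>UP A\<^esub> upmap ?E u \<oplus>\<^bsub>UP A\<^esub> upmap ?E (generic_poly n) \<otimes>\<^bsub>UP A\<^esub> upmap ?E v)"
    using d sc by (simp add: P.r_distr P.m_lcomm)
  also have "\<dots> = \<one>\<^bsub>UP A\<^esub>"
    using one by (simp only: uv EP.hom_add EP.hom_mult sg)
  finally show ?thesis
    using d by (intro bexI[of _ "d \<otimes>\<^bsub>UP A\<^esub> upmap ?E u"] bexI[of _ "d \<otimes>\<^bsub>UP A\<^esub> upmap ?E v"]) auto
qed

lemma Fmap_eq_PIdl:
  assumes psi: "\<psi> \<in> HomH n A \<phi>"
  shows "Fmap n A \<phi> \<psi> = PIdl\<^bsub>LL\<^esub> (iota (Fpoly n A \<psi>))"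
    and "up_monic (Fpoly n A \<psi>)"
proof -
  show m: "up_monic (Fpoly n A \<psi>)"
    unfolding Fpoly_eq[OF psi] by (rule up_monic_generic) (rule HomH_eval(1,2)[OF psi])+
  have "iota (Fpoly n A \<psi>) \<in> carrier LL" using up_monicD[OF m] by blast
  then show "Fmap n A \<phi> \<psi> = PIdl\<^bsub>LL\<^esub> (iota (Fpoly n A \<psi>))"
    unfolding Fmap_def Lx_def by (rule Loc.L.cgenideal_eq_genideal[symmetric])
qed

lemma Fmap_ideal: "\<psi> \<in> HomH n A \<phi> \<Longrightarrow> ideal (Fmap n A \<phi> \<psi>) LL"
  unfolding Fmap_eq_PIdl by (rule Loc.L.cgenideal_ideal) (use up_monicD[OF Fmap_eq_PIdl(2)] in blast)

lemma Fmap_power_basis: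
  assumes psi: "\<psi> \<in> HomH n A \<phi>"
  shows "power_basis (Fmap n A \<phi> \<psi>)"
  unfolding Fmap_eq_PIdl(1)[OF psi]
proof (rule comaximal_power_basis[OF Fmap_eq_PIdl(2)[OF psi]])
  fix s assume s: "s \<in> Sx A \<phi>"
  show "\<exists>U\<in>carrier (UP A). \<exists>V\<in>carrier (UP A).
       s \<otimes>\<^bsub>UP A\<^esub> U \<oplus>\<^bsub>UP A\<^esub> Fpoly n A \<psi> \<otimes>\<^bsub>UP A\<^esub> V = \<one>\<^bsub>UP A\<^esub>"
    unfolding Fpoly_eq[OF psi]
    by (rule generic_comaximal[OF HomH_eval(1)[OF psi] HomH_norm_unit[OF psi] s])
qed

lemma Fmap_Hilb: "\<psi> \<in> HomH n A \<phi> \<Longrightarrow> Fmap n A \<phi> \<psi> \<in> Hilb n A \<phi>"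
  using Fmap_ideal power_basis_free[OF Fmap_power_basis] unfolding Hilb_def Lx_def by blast

text \<open>Two monic polynomials of degree \<open>n\<close> in the same ideal differ by a
  polynomial of degree below \<open>n\<close> in that ideal, which is zero by uniqueness of
  remainders. The coefficients then determine the homomorphism.\<close>

lemma Fmap_inj: "inj_on (Fmap n A \<phi>) (HomH n A \<phi>)"
proof (rule inj_onI)
  fix \<psi> \<psi>' assume psi: "\<psi> \<in> HomH n A \<phi>" and psi': "\<psi>' \<in> HomH n A \<phi>"
    and eq: "Fmap n A \<phi> \<psi> = Fmap n A \<phi> \<psi>'"
  let ?F = "Fpoly n A \<psi>" and ?G = "Fpoly n A \<psi>'" and ?I = "Fmap n A \<phi> \<psi>"
  interpret I: ideal ?I LL by (rule Fmap_ideal[OF psi])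
  have F: "up_monic ?F" and G: "up_monic ?G" using Fmap_eq_PIdl(2) psi psi' by blast+
  have Fc: "?F \<in> carrier (UP A)" and Gc: "?G \<in> carrier (UP A)" using F G by blast+
  have "iota ?F \<in> ?I" unfolding Fmap_eq_PIdl(1)[OF psi] by (rule Loc.L.cgenideal_self) (use Fc in blast)
  moreover have "iota ?G \<in> ?I"
    unfolding eq Fmap_eq_PIdl(1)[OF psi'] by (rule Loc.L.cgenideal_self) (use Gc in blast)
  ultimately have "iota ?F \<ominus>\<^bsub>LL\<^esub> iota ?G \<in> ?I"
    unfolding a_minus_def by (intro I.a_closed I.a_inv_closed)
  also have "iota ?F \<ominus>\<^bsub>LL\<^esub> iota ?G = iota (?F \<ominus>\<^bsub>UP A\<^esub> ?G)"
    unfolding a_minus_def using Fc Gc by (simp add: iota.hom_a_inv)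
  finally have mem: "iota (?F \<ominus>\<^bsub>UP A\<^esub> ?G) \<in> ?I" .
  have "(?F \<ominus>\<^bsub>UP A\<^esub> ?G) i = \<zero>" if "i \<ge> n" for i
    unfolding up_sub_apply[OF A.is_cring Fc Gc] using F G that
    by (cases "i = n") (auto simp: up_monic_def)
  then have "?F \<ominus>\<^bsub>UP A\<^esub> ?G = \<zero>\<^bsub>UP A\<^esub>"
    by (intro power_basis_zero[OF Fmap_ideal[OF psi] Fmap_power_basis[OF psi] _ _ mem] P.minus_closed Fc Gc)
  then have FG: "?F = ?G" using Fc Gc P.r_right_minus_eq by blast
  show "\<psi> = \<psi>'"
  proof (rule HomH_eqI[OF psi psi'])
    fix i assume "i \<in> {1..n}"
    then have ni: "n - (n - i) = i" "n - i \<le> n" by auto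
    \<comment> \<open>Coefficient \<open>n - i\<close> carries the image of \<open>s_i\<close> up to
      the sign \<open>(-1)^i\<close>.\<close>
    have "(if even i then \<psi> (Hn_s n i) else \<ominus> \<psi> (Hn_s n i)) = (if even i then \<psi>' (Hn_s n i) else \<ominus> \<psi>' (Hn_s n i))"
      using fun_cong[OF FG, of "n - i"] by (simp only: Fpoly_def ni if_True)
    then show "\<psi> (Hn_s n i) = \<psi>' (Hn_s n i)"
      using HomH_eval(1)[OF psi, of i] HomH_eval(1)[OF psi', of i]
      by (metis A.minus_minus)
  qed
qed

end

section \<open>Ideals with free quotient\<close>

lemma type_hom_poly_eqI:
  fixes p :: "'r::comm_ring_1 poly"
  assumes "type_hom Q h" "type_hom Q g" "\<And>c. h [:c:] = g [:c:]" "h [:0, 1:] = g [:0, 1:]"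
  shows "h p = g p"
proof -
  interpret h: type_hom Q h by fact
  interpret g: type_hom Q g by fact
  have split: "pCons a p = [:a:] + [:0, 1:] * p" for a and p :: "'r poly" by simp
  show ?thesis
  proof (induction p)
    case (pCons a p)
    have "h (pCons a p) = h [:a:] \<oplus>\<^bsub>Q\<^esub> h [:0, 1:] \<otimes>\<^bsub>Q\<^esub> h p"
      by (subst split) (simp only: h.hom_add h.hom_mult)
    moreover have "g (pCons a p) = g [:a:] \<oplus>\<^bsub>Q\<^esub> g [:0, 1:] \<otimes>\<^bsub>Q\<^esub> g p"
      by (subst split) (simp only: g.hom_add g.hom_mult)
    ultimately show ?case using pCons assms(3,4) by simp
  qed simp
qed

lemma (in lin_comb) lc_mult:
  assumes "q \<in> carrier Q" "\<And>i. i < n \<Longrightarrow> c i \<in> carrier A" "\<And>i. i < n \<Longrightarrow> x i \<in> carrier Q"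
  shows "q \<otimes>\<^bsub>Q\<^esub> lc c x = lc c (\<lambda>i. q \<otimes>\<^bsub>Q\<^esub> x i)"
proof -
  have "q \<otimes>\<^bsub>Q\<^esub> lc c x = (\<Oplus>\<^bsub>Q\<^esub>i\<in>{..<n}. q \<otimes>\<^bsub>Q\<^esub> (\<sigma> (c i) \<otimes>\<^bsub>Q\<^esub> x i))"
    unfolding lc_def using assms by (intro Q.finsum_rdistr) auto
  also have "\<dots> = lc c (\<lambda>i. q \<otimes>\<^bsub>Q\<^esub> x i)"
    unfolding lc_def using assms by (intro Q.finsum_cong') (auto simp: Q.m_lcomm)
  finally show ?thesis .
qed

section \<open>The quotient of the localization by an ideal, as an \<open>A\<close>-algebra\<close>

locale hilb_ideal = kalgebra A \<phi> n
  for A :: "('a, 'm) ring_scheme" (structure) and \<phi> :: "'k::field \<Rightarrow> 'a" and n +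
  fixes I
  assumes ideal: "ideal I LL"
begin

sublocale I: ideal I LL
  by (rule ideal)

definition Quo where "Quo = LL Quot I"

definition pr where "pr f = I +>\<^bsub>LL\<^esub> f"

lemma pr_hom: "pr \<in> ring_hom LL Quo"
  using I.rcos_ring_hom by (simp add: Quo_def ring_hom_def pr_def Pi_iff)

lemma cring_Quo: "cring Quo"
  unfolding Quo_def by (rule I.quotient_is_cring) (rule Loc.cring_loc)

sublocale Qc: cring Quo
  by (rule cring_Quo)

sublocale pr: ring_hom_cring LL Quo pr
  by unfold_locales (rule pr_hom)

lemma pr_eq_iff: "f \<in> carrier LL \<Longrightarrow> g \<in> carrier LL \<Longrightarrow> pr f = pr g \<longleftrightarrow> f \<ominus>\<^bsub>LL\<^esub> g \<in> I"
  unfolding pr_def by (rule Loc.L.quotient_eq_iff_same_a_r_cos[OF ideal, symmetric])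

lemma pr_zero_iff: "f \<in> carrier LL \<Longrightarrow> pr f = \<zero>\<^bsub>Quo\<^esub> \<longleftrightarrow> f \<in> I"
  using pr_eq_iff[of f "\<zero>\<^bsub>LL\<^esub>"] by (simp add: a_minus_def)

lemma Quo_elem:
  assumes "x \<in> carrier Quo"
  obtains f where "f \<in> carrier LL" "x = pr f"
  using assms by (auto simp: Quo_def pr_def FactRing_def A_RCOSETS_def')

definition sc where "sc a = pr (Lx_scalar A \<phi> a)"

lemma sc_hom: "sc \<in> ring_hom A Quo"
  using ring_hom_trans[OF Lx_scalar_hom pr_hom] by (simp add: sc_def[abs_def] comp_def)

sublocale lin: lin_comb A Quo sc n
  by (intro lin_comb.intro lin_comb_axioms.intro A.is_cring cring_Quo sc_hom)

text \<open>Polynomials over the lifting ring type, read in the quotient. Division and expansion in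
  powers of \<open>x\<close> are done on this side.\<close>

definition th where "th p = pr (iota (upmap eps p))"

lemma type_hom_th: "type_hom Quo th"
  unfolding th_def[abs_def]
  by (rule type_hom_comp[OF type_hom_iota[OF eps.type_hom_axioms] cring_Quo pr_hom])

sublocale th: type_hom Quo th
  by (rule type_hom_th)

lemma th_const: "th [:r:] = sc (eps r)"
  by (simp add: th_def sc_def Lx_scalar_eps)

abbreviation xp where "xp j \<equiv> th ([:0, 1:] ^ j)"

lemma pr_lin_comb:
  assumes "c \<in> {..<n} \<rightarrow> carrier A" "b \<in> {..<n} \<rightarrow> carrier LL"
  shows "pr (\<Oplus>\<^bsub>LL\<^esub>i\<in>{..<n}. Lx_scalar A \<phi> (c i) \<otimes>\<^bsub>LL\<^esub> b i) = lin.lc c (\<lambda>i. pr (b i))"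
proof -
  have s: "Lx_scalar A \<phi> (c i) \<in> carrier LL" if "i < n" for i
    by (rule ring_hom_closed[OF Lx_scalar_hom]) (use assms that in auto)
  have b: "b i \<in> carrier LL" if "i < n" for i using assms that by auto
  have "pr (\<Oplus>\<^bsub>LL\<^esub>i\<in>{..<n}. Lx_scalar A \<phi> (c i) \<otimes>\<^bsub>LL\<^esub> b i) =
      (\<Oplus>\<^bsub>Quo\<^esub>i\<in>{..<n}. pr (Lx_scalar A \<phi> (c i) \<otimes>\<^bsub>LL\<^esub> b i))"
    using s b by (subst pr.hom_finsum) (auto simp: comp_def)
  also have "\<dots> = lin.lc c (\<lambda>i. pr (b i))"
    unfolding lin.lc_def sc_def using s b by (intro Qc.finsum_cong') auto
  finally show ?thesis .
qed

lemma lc_xp: "c \<in> {..<n} \<rightarrow> carrier A \<Longrightarrow> lin.lc c xp = pr (iota (rem c))"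
  unfolding power_comb[symmetric] th_def by (rule pr_lin_comb[symmetric]) auto

lemma th_degree:
  assumes "Polynomial.degree p < n"
  shows "th p = lin.lc (\<lambda>j. eps (poly.coeff p j)) xp"
  unfolding lin.lc_def th_const[symmetric] by (rule type_hom_poly_expand[OF type_hom_th assms])

lemma mem_iff_lc:
  assumes f: "f \<in> carrier LL" and c: "c \<in> {..<n} \<rightarrow>\<^sub>E carrier A"
  shows "f \<ominus>\<^bsub>LL\<^esub> iota (rem c) \<in> I \<longleftrightarrow> pr f = lin.lc c xp"
proof -
  have c: "c \<in> {..<n} \<rightarrow> carrier A" using c by (auto simp: PiE_iff)
  have "iota (rem c) \<in> carrier LL" using rem_closed[OF c] by blast
  then show ?thesis unfolding lc_xp[OF c] using pr_eq_iff[OF f] by blast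
qed

lemma power_basisI:
  assumes span: "\<And>f. f \<in> carrier Quo \<Longrightarrow> \<exists>c. (\<forall>i<n. c i \<in> carrier A) \<and> f = lin.lc c xp"
    and ind: "\<And>c i. (\<And>i. i < n \<Longrightarrow> c i \<in> carrier A) \<Longrightarrow> lin.lc c xp = \<zero>\<^bsub>Quo\<^esub> \<Longrightarrow> i < n \<Longrightarrow> c i = \<zero>"
  shows "power_basis I"
  unfolding power_basis_def
proof (intro ballI)
  fix f assume f: "f \<in> carrier LL"
  note mem = mem_iff_lc[OF f]
  show "\<exists>!c. c \<in> {..<n} \<rightarrow>\<^sub>E carrier A \<and> f \<ominus>\<^bsub>LL\<^esub> iota (rem c) \<in> I"
  proof (rule ex_ex1I)
    obtain c where c: "\<forall>i<n. c i \<in> carrier A" "pr f = lin.lc c xp" using span[of "pr f"] f by auto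
    let ?c = "restrict c {..<n}"
    have "?c \<in> {..<n} \<rightarrow>\<^sub>E carrier A" using c by auto
    moreover have "lin.lc c xp = lin.lc ?c xp" by (rule lin.lc_cong) (use c in auto)
    ultimately show "\<exists>c. c \<in> {..<n} \<rightarrow>\<^sub>E carrier A \<and> f \<ominus>\<^bsub>LL\<^esub> iota (rem c) \<in> I"
      using mem[of ?c] c(2) by (intro exI[of _ ?c]) simp
  next
    fix c d
    assume "c \<in> {..<n} \<rightarrow>\<^sub>E carrier A \<and> f \<ominus>\<^bsub>LL\<^esub> iota (rem c) \<in> I"
      and "d \<in> {..<n} \<rightarrow>\<^sub>E carrier A \<and> f \<ominus>\<^bsub>LL\<^esub> iota (rem d) \<in> I"
    then have c: "c \<in> {..<n} \<rightarrow>\<^sub>E carrier A" and d: "d \<in> {..<n} \<rightarrow>\<^sub>E carrier A"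
      and eq: "lin.lc c xp = lin.lc d xp" using mem by metis+
    have cc: "c i \<in> carrier A" and dc: "d i \<in> carrier A" if "i < n" for i
      using c d that by (auto simp: PiE_iff)
    have z: "lin.lc (\<lambda>i. c i \<ominus> d i) xp = \<zero>\<^bsub>Quo\<^esub>"
      using lin.lc_diff[of c d xp] cc dc lin.lc_closed[of d xp] eq by simp
    have "c i = d i" if i: "i < n" for i
      using ind[of "\<lambda>i. c i \<ominus> d i", OF _ z i] cc[OF i] dc[OF i] cc dc by simp
    then show "c = d" by (intro PiE_ext[OF c d]) auto
  qed
qed

text \<open>Some basis is given, not that of the powers of \<open>x\<close>. Integrality shows that
  the powers span, and \<open>spanning_independent\<close> makes them a basis.\<close>

lemma free_power_basis:
  assumes free: "free_quot_rank n A \<phi> I"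
  shows "power_basis I"
proof -
  obtain b where b: "b \<in> {..<n} \<rightarrow> carrier LL"
    and basis: "\<forall>f\<in>carrier LL. \<exists>!c. c \<in> {..<n} \<rightarrow>\<^sub>E carrier A \<and>
            f \<ominus>\<^bsub>LL\<^esub> (\<Oplus>\<^bsub>LL\<^esub>i\<in>{..<n}. Lx_scalar A \<phi> (c i) \<otimes>\<^bsub>LL\<^esub> b i) \<in> I"
    using free unfolding free_quot_rank_def Lx_def by (elim exE conjE)
  interpret fa: free_algebra A Quo sc n eps "\<lambda>i. pr (b i)"
  proof (intro free_algebra.intro free_algebra_axioms.intro lin.lin_comb_axioms eps.surj_hom_axioms)
    show "i < n \<Longrightarrow> pr (b i) \<in> carrier Quo" for i using b by auto
    fix x assume "x \<in> carrier Quo"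
    then obtain f where f: "f \<in> carrier LL" "x = pr f" by (rule Quo_elem)
    have "c \<in> {..<n} \<rightarrow>\<^sub>E carrier A \<and> f \<ominus>\<^bsub>LL\<^esub> (\<Oplus>\<^bsub>LL\<^esub>i\<in>{..<n}. Lx_scalar A \<phi> (c i) \<otimes>\<^bsub>LL\<^esub> b i) \<in> I \<longleftrightarrow>
        c \<in> {..<n} \<rightarrow>\<^sub>E carrier A \<and> x = lin.lc c (\<lambda>i. pr (b i))" for c
    proof (rule conj_cong[OF refl])
      assume "c \<in> {..<n} \<rightarrow>\<^sub>E carrier A"
      then have c: "c \<in> {..<n} \<rightarrow> carrier A" by (auto simp: PiE_iff)
      have s: "Lx_scalar A \<phi> (c i) \<in> carrier LL" if "i < n" for i
        by (rule ring_hom_closed[OF Lx_scalar_hom]) (use c that in auto)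
      have "(\<Oplus>\<^bsub>LL\<^esub>i\<in>{..<n}. Lx_scalar A \<phi> (c i) \<otimes>\<^bsub>LL\<^esub> b i) \<in> carrier LL"
        using s b by (intro Loc.L.finsum_closed) auto
      then show "f \<ominus>\<^bsub>LL\<^esub> (\<Oplus>\<^bsub>LL\<^esub>i\<in>{..<n}. Lx_scalar A \<phi> (c i) \<otimes>\<^bsub>LL\<^esub> b i) \<in> I \<longleftrightarrow> x = lin.lc c (\<lambda>i. pr (b i))"
        unfolding f(2) pr_lin_comb[OF c b, symmetric] using pr_eq_iff[OF f(1)] by blast
    qed
    then show "\<exists>!c. c \<in> {..<n} \<rightarrow>\<^sub>E carrier A \<and> x = lin.lc c (\<lambda>i. pr (b i))"
      using bspec[OF basis f(1)] by simp
  qed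
  interpret se: type_hom Quo "\<lambda>r. sc (eps r)" by (rule fa.type_hom_sigma_eps)
  \<comment> \<open>Let \<open>w\<close> be the class of \<open>s\<close> and \<open>v\<close> its
    inverse. Multiplying a monic equation of degree \<open>n\<close> for \<open>v\<close> by
    \<open>w^(n-1)\<close> leaves \<open>v\<close> as the top term and powers of \<open>w\<close>
    elsewhere, so \<open>v\<close> is a polynomial in \<open>w\<close>.\<close>
  have inv_range: "\<exists>p. pr (Loc.frac \<one>\<^bsub>UP A\<^esub> s) = th p" if s: "s \<in> Sx A \<phi>" for s
  proof -
    obtain g where g: "s = upmap \<phi> g" using s by (auto simp: Sx_eq)
    define G where "G = (map_poly pconst g :: (('a \<Rightarrow>\<^sub>0 nat) \<Rightarrow>\<^sub>0 'k) poly)"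
    have G: "upmap eps G = s" unfolding g G_def by (rule upmap_map_poly_pconst) (rule eps_pconst)
    define v where "v = pr (Loc.frac \<one>\<^bsub>UP A\<^esub> s)"
    define w where "w = th G"
    have v: "v \<in> carrier Quo" unfolding v_def by (rule pr.hom_closed) (use s in blast)
    have w: "w \<in> carrier Quo" by (simp add: w_def)
    have "w \<otimes>\<^bsub>Quo\<^esub> v = pr (iota s \<otimes>\<^bsub>LL\<^esub> Loc.frac \<one>\<^bsub>UP A\<^esub> s)"
      unfolding w_def v_def th_def G by (rule pr.hom_mult[symmetric]) (use s in blast)+
    also have "\<dots> = \<one>\<^bsub>Quo\<^esub>" unfolding Loc.frac_inverse[OF s] by (rule pr.hom_one)
    finally have wv: "w \<otimes>\<^bsub>Quo\<^esub> v = \<one>\<^bsub>Quo\<^esub>" .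
    have wv_pow: "w [^]\<^bsub>Quo\<^esub> (n - 1) \<otimes>\<^bsub>Quo\<^esub> v [^]\<^bsub>Quo\<^esub> i = w [^]\<^bsub>Quo\<^esub> (n - 1 - i)" if "i < n" for i
      using that
    proof (induction i)
      case (Suc i)
      have "w [^]\<^bsub>Quo\<^esub> (n - 1) \<otimes>\<^bsub>Quo\<^esub> v [^]\<^bsub>Quo\<^esub> Suc i = w [^]\<^bsub>Quo\<^esub> (n - 1 - i) \<otimes>\<^bsub>Quo\<^esub> v"
        using Suc v w by (simp add: Qc.m_assoc[symmetric])
      also have "n - 1 - i = Suc (n - 1 - Suc i)" using Suc.prems by simp
      also have "w [^]\<^bsub>Quo\<^esub> Suc (n - 1 - Suc i) \<otimes>\<^bsub>Quo\<^esub> v = w [^]\<^bsub>Quo\<^esub> (n - 1 - Suc i) \<otimes>\<^bsub>Quo\<^esub> (w \<otimes>\<^bsub>Quo\<^esub> v)"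
        using v w by (simp add: Qc.m_assoc)
      finally show ?case using w by (simp add: wv)
    qed (use w in simp)
    have wv_n: "w [^]\<^bsub>Quo\<^esub> (n - 1) \<otimes>\<^bsub>Quo\<^esub> v [^]\<^bsub>Quo\<^esub> n = v"
    proof -
      have "w [^]\<^bsub>Quo\<^esub> (n - 1) \<otimes>\<^bsub>Quo\<^esub> v [^]\<^bsub>Quo\<^esub> Suc (n - 1) = (w [^]\<^bsub>Quo\<^esub> (n - 1) \<otimes>\<^bsub>Quo\<^esub> v [^]\<^bsub>Quo\<^esub> (n - 1)) \<otimes>\<^bsub>Quo\<^esub> v"
        using v w by (simp add: Qc.m_assoc)
      also have "\<dots> = v" using wv_pow[of "n - 1"] n v by simp
      finally show ?thesis using n by simp
    qed
    obtain p where p: "Polynomial.degree p = n" "poly.coeff p n = 1" "peval Quo (\<lambda>r. sc (eps r)) v p = \<zero>\<^bsub>Quo\<^esub>"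
      using v by (rule fa.integral)
    \<comment> \<open>The lower terms after this multiplication: \<open>w^(n-1) v^i\<close> is
      \<open>w^(n-1-i)\<close>, and \<open>G\<close> lifts \<open>w\<close>.\<close>
    define t where "t = (\<Sum>i<n. [:poly.coeff p i:] * G ^ (n - 1 - i))"
    have "\<zero>\<^bsub>Quo\<^esub> = w [^]\<^bsub>Quo\<^esub> (n - 1) \<otimes>\<^bsub>Quo\<^esub> (\<Oplus>\<^bsub>Quo\<^esub>i\<in>{..n}. sc (eps (poly.coeff p i)) \<otimes>\<^bsub>Quo\<^esub> v [^]\<^bsub>Quo\<^esub> i)"
      using p w unfolding peval_def by simp
    also have "\<dots> = (\<Oplus>\<^bsub>Quo\<^esub>i\<in>{..n}. w [^]\<^bsub>Quo\<^esub> (n - 1) \<otimes>\<^bsub>Quo\<^esub> (sc (eps (poly.coeff p i)) \<otimes>\<^bsub>Quo\<^esub> v [^]\<^bsub>Quo\<^esub> i))"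
      using v w by (intro Qc.finsum_rdistr) auto
    also have "{..n} = insert n {..<n}" by auto
    also have "(\<Oplus>\<^bsub>Quo\<^esub>i\<in>insert n {..<n}. w [^]\<^bsub>Quo\<^esub> (n - 1) \<otimes>\<^bsub>Quo\<^esub> (sc (eps (poly.coeff p i)) \<otimes>\<^bsub>Quo\<^esub> v [^]\<^bsub>Quo\<^esub> i)) =
        w [^]\<^bsub>Quo\<^esub> (n - 1) \<otimes>\<^bsub>Quo\<^esub> (sc (eps (poly.coeff p n)) \<otimes>\<^bsub>Quo\<^esub> v [^]\<^bsub>Quo\<^esub> n) \<oplus>\<^bsub>Quo\<^esub>
        (\<Oplus>\<^bsub>Quo\<^esub>i\<in>{..<n}. w [^]\<^bsub>Quo\<^esub> (n - 1) \<otimes>\<^bsub>Quo\<^esub> (sc (eps (poly.coeff p i)) \<otimes>\<^bsub>Quo\<^esub> v [^]\<^bsub>Quo\<^esub> i))"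
      using v w by (intro Qc.finsum_insert) auto
    also have "w [^]\<^bsub>Quo\<^esub> (n - 1) \<otimes>\<^bsub>Quo\<^esub> (sc (eps (poly.coeff p n)) \<otimes>\<^bsub>Quo\<^esub> v [^]\<^bsub>Quo\<^esub> n) = v"
      using p(2) v wv_n by simp
    also have "(\<Oplus>\<^bsub>Quo\<^esub>i\<in>{..<n}. w [^]\<^bsub>Quo\<^esub> (n - 1) \<otimes>\<^bsub>Quo\<^esub> (sc (eps (poly.coeff p i)) \<otimes>\<^bsub>Quo\<^esub> v [^]\<^bsub>Quo\<^esub> i)) = th t"
      unfolding t_def th.hom_sum
    proof (intro Qc.finsum_cong' refl)
      fix i assume i: "i \<in> {..<n}"
      have "w [^]\<^bsub>Quo\<^esub> (n - 1) \<otimes>\<^bsub>Quo\<^esub> (sc (eps (poly.coeff p i)) \<otimes>\<^bsub>Quo\<^esub> v [^]\<^bsub>Quo\<^esub> i) =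
          sc (eps (poly.coeff p i)) \<otimes>\<^bsub>Quo\<^esub> (w [^]\<^bsub>Quo\<^esub> (n - 1) \<otimes>\<^bsub>Quo\<^esub> v [^]\<^bsub>Quo\<^esub> i)"
        using v w by (intro Qc.m_lcomm) auto
      then show "w [^]\<^bsub>Quo\<^esub> (n - 1) \<otimes>\<^bsub>Quo\<^esub> (sc (eps (poly.coeff p i)) \<otimes>\<^bsub>Quo\<^esub> v [^]\<^bsub>Quo\<^esub> i) =
          th ([:poly.coeff p i:] * G ^ (n - 1 - i))"
        using i wv_pow[of i] by (simp only: th.hom_mult th_const th.hom_power w_def[symmetric] lessThan_iff)
    qed auto
    finally have "\<zero>\<^bsub>Quo\<^esub> = v \<oplus>\<^bsub>Quo\<^esub> th t" .
    then have "v = \<ominus>\<^bsub>Quo\<^esub> th t" using v by (intro Qc.minus_equality[symmetric]) auto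
    then have "v = th (- t)" by simp
    then show ?thesis unfolding v_def ..
  qed
  have surj: "\<exists>p. x = th p" if x: "x \<in> carrier Quo" for x
  proof -
    obtain f where f: "f \<in> carrier LL" "x = pr f" using x by (rule Quo_elem)
    obtain p s where ps: "p \<in> carrier (UP A)" "s \<in> Sx A \<phi>" "f = Loc.frac p s" using f(1) by (rule Loc.locE)
    obtain p' where p': "upmap eps p' = p" using ps(1) by (rule up_lift)
    obtain t where t: "pr (Loc.frac \<one>\<^bsub>UP A\<^esub> s) = th t" using inv_range[OF ps(2)] by blast
    have "x = pr (iota p \<otimes>\<^bsub>LL\<^esub> Loc.frac \<one>\<^bsub>UP A\<^esub> s)"
      unfolding f(2) ps(3) using Loc.frac_split[OF ps(1,2)] by simp
    also have "\<dots> = pr (iota p) \<otimes>\<^bsub>Quo\<^esub> pr (Loc.frac \<one>\<^bsub>UP A\<^esub> s)"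
      by (rule pr.hom_mult) (use ps in blast)+
    also have "\<dots> = th (p' * t)" unfolding t by (simp add: th_def[of p'] p')
    finally show ?thesis ..
  qed
  \<comment> \<open>The class of \<open>x\<close> is a root of a monic \<open>F\<close> of degree
    \<open>n\<close>, so every polynomial has the same class as its remainder modulo
    \<open>F\<close>.\<close>
  have span: "\<exists>c. (\<forall>i<n. c i \<in> carrier A) \<and> f = lin.lc c xp" if f: "f \<in> carrier Quo" for f
  proof -
    have X: "th [:0, 1:] \<in> carrier Quo" by simp
    obtain F where F: "Polynomial.degree F = n" "poly.coeff F n = 1"
      "peval Quo (\<lambda>r. sc (eps r)) (th [:0, 1:]) F = \<zero>\<^bsub>Quo\<^esub>"
      using X by (rule fa.integral)
    have "th F = peval Quo (\<lambda>r. sc (eps r)) (th [:0, 1:]) F"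
      by (rule type_hom_poly_eqI[OF type_hom_th se.type_hom_peval[OF X]])
        (use se.peval_const[OF X] se.peval_X[OF X] th_const in simp_all)
    then have thF: "th F = \<zero>\<^bsub>Quo\<^esub>" using F(3) by simp
    obtain p where p: "f = th p" using surj[OF f] by blast
    obtain q r where qr: "p = F * q + r" "Polynomial.degree r < n" using monic_division[OF F(1,2) n] by blast
    have "f = lin.lc (\<lambda>j. eps (poly.coeff r j)) xp"
      unfolding th_degree[OF qr(2), symmetric] p qr(1) by (simp add: thF)
    then show ?thesis by (intro exI conjI) auto
  qed
  show ?thesis
  proof (rule power_basisI[OF span])
    fix c :: "nat \<Rightarrow> 'a" and i
    assume "\<And>i. i < n \<Longrightarrow> c i \<in> carrier A" "lin.lc c xp = \<zero>\<^bsub>Quo\<^esub>" "i < n"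
    then show "c i = \<zero>" by (intro fa.spanning_independent[of xp c i] span) auto
  qed
qed

end

section \<open>Surjectivity: the homomorphism belonging to an ideal with a power basis\<close>

lemma coeff_X_power: "poly.coeff ([:0, 1:] ^ j) i = (if i = j then 1 else (0 :: 'r::comm_ring_1))"
  using monom_altdef[of "1 :: 'r" j] by (metis coeff_monom smult_1_left)

lemma (in kalgebra) upmap_power_X:
  assumes "type_hom A h"
  shows "upmap h ([:0, 1:] ^ j) = upmap eps ([:0, 1:] ^ j)"
proof -
  interpret h: type_hom A h by fact
  show ?thesis by (simp add: upmap_def fun_eq_iff coeff_X_power)
qed

context hilb_ideal
begin

text \<open>Expanding \<open>x^n\<close> in the power basis yields a monic \<open>F\<close> of
  degree \<open>n\<close> in \<open>I\<close>. It generates \<open>I\<close>, and its coefficients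
  with the proper signs are the images to be given to the \<open>s_i\<close>.\<close>

lemma power_basis_surj:
  assumes basis: "power_basis I"
  obtains \<psi> where "\<psi> \<in> HomH n A \<phi>" "Fmap n A \<phi> \<psi> = I"
proof -
  interpret fa: free_algebra A Quo sc n eps xp
  proof (intro free_algebra.intro free_algebra_axioms.intro lin.lin_comb_axioms eps.surj_hom_axioms)
    show "xp i \<in> carrier Quo" for i by simp
    fix x assume "x \<in> carrier Quo"
    then obtain f where f: "f \<in> carrier LL" "x = pr f" by (rule Quo_elem)
    have "c \<in> {..<n} \<rightarrow>\<^sub>E carrier A \<and> f \<ominus>\<^bsub>LL\<^esub> iota (rem c) \<in> I \<longleftrightarrow> c \<in> {..<n} \<rightarrow>\<^sub>E carrier A \<and> x = lin.lc c xp" for c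
      unfolding f(2) by (rule conj_cong[OF refl mem_iff_lc[OF f(1)]])
    then show "\<exists>!c. c \<in> {..<n} \<rightarrow>\<^sub>E carrier A \<and> x = lin.lc c xp"
      using bspec[OF basis[unfolded power_basis_def] f(1)] by simp
  qed
  obtain c where c: "\<And>i. i < n \<Longrightarrow> c i \<in> carrier A" "xp n = lin.lc c xp"
    using fa.coordsE[OF th.closed] by metis
  define T where "T = (\<Sum>j<n. Polynomial.monom (eps.rep (c j)) j)"
  have coeff_T: "poly.coeff T i = (if i < n then eps.rep (c i) else 0)" for i
    by (simp add: T_def Polynomial.coeff_sum)
  have "Polynomial.degree T \<le> n - 1" by (rule degree_le) (use n in \<open>auto simp: coeff_T\<close>)
  then have "th T = lin.lc (\<lambda>j. eps (poly.coeff T j)) xp" using n by (intro th_degree) simp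
  also have "\<dots> = lin.lc c xp" by (rule lin.lc_cong) (auto simp: coeff_T c)
  finally have thT: "th T = xp n" using c(2) by simp
  define F' where "F' = [:0, 1:] ^ n - T"
  have coeff_F': "poly.coeff F' i = (if i = n then 1 else if i < n then - eps.rep (c i) else 0)" for i
    unfolding F'_def coeff_diff coeff_T coeff_X_power by auto
  have thF: "th F' = \<zero>\<^bsub>Quo\<^esub>" unfolding F'_def th.hom_diff thT by simp
  define F where "F = upmap eps F'"
  have Fc: "F \<in> carrier (UP A)" unfolding F_def by (rule epsP.closed)
  have F: "up_monic F" using Fc unfolding up_monic_def by (simp add: F_def upmap_def coeff_F')
  have iF: "iota F \<in> carrier LL" using Fc by blast
  have FI: "iota F \<in> I" using thF pr_zero_iff[OF iF] unfolding th_def F_def by blast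
  have "PIdl\<^bsub>LL\<^esub> (iota F) = I"
  proof
    show "PIdl\<^bsub>LL\<^esub> (iota F) \<subseteq> I" using ideal FI by (rule Loc.L.cgenideal_minimal)
    \<comment> \<open>The numerator of an element of \<open>I\<close> lies in \<open>I\<close>,
      hence so does its remainder modulo \<open>F\<close>, which is then zero by
      \<open>power_basis_zero\<close>.\<close>
    show "I \<subseteq> PIdl\<^bsub>LL\<^esub> (iota F)"
    proof
      fix f assume fI: "f \<in> I"
      then have "f \<in> carrier LL" by (rule I.Icarr)
      then obtain p s where ps: "p \<in> carrier (UP A)" "s \<in> Sx A \<phi>" and f: "f = Loc.frac p s" by (rule Loc.locE)
      have sc: "s \<in> carrier (UP A)" using ps(2) by (rule Loc.S_closed)
      have "f \<otimes>\<^bsub>LL\<^esub> iota s \<in> I" using fI by (rule I.I_r_closed) (use sc in blast)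
      then have pI: "iota p \<in> I" unfolding f Loc.frac_mult_denominator[OF ps] .
      obtain q r where q: "q \<in> carrier (UP A)" and r: "r \<in> carrier (UP A)" and pqr: "p = F \<otimes>\<^bsub>UP A\<^esub> q \<oplus>\<^bsub>UP A\<^esub> r"
        and r0: "\<And>i. i \<ge> n \<Longrightarrow> r i = \<zero>"
        using up_division[OF F ps(1)] by metis
      have iq: "iota q \<in> carrier LL" and ir: "iota r \<in> carrier LL" using q r by blast+
      have FqI: "iota F \<otimes>\<^bsub>LL\<^esub> iota q \<in> I" using FI iq by (rule I.I_r_closed)
      have Fq: "iota F \<otimes>\<^bsub>LL\<^esub> iota q \<in> carrier LL" using iF iq by (rule Loc.L.m_closed)
      have "pr (iota p) = pr (iota F \<otimes>\<^bsub>LL\<^esub> iota q) \<oplus>\<^bsub>Quo\<^esub> pr (iota r)"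
        unfolding pqr using Fc q r Fq ir by simp
      then have "\<zero>\<^bsub>Quo\<^esub> = \<zero>\<^bsub>Quo\<^esub> \<oplus>\<^bsub>Quo\<^esub> pr (iota r)"
        using pI FqI pr_zero_iff[OF Fq] pr_zero_iff[of "iota p"] I.Icarr[OF pI] by simp
      then have "iota r \<in> I" using pr_zero_iff[OF ir] pr.hom_closed[OF ir] by simp
      then have "r = \<zero>\<^bsub>UP A\<^esub>"
        by (intro power_basis_zero[OF ideal basis r]) (simp_all only: r0)
      then have p: "p = q \<otimes>\<^bsub>UP A\<^esub> F" unfolding pqr using Fc q by (simp add: P.m_comm)
      have "f = Loc.frac q s \<otimes>\<^bsub>LL\<^esub> iota F"
        unfolding f p using q Fc ps(2) by (simp add: Loc.loc_mult)
      moreover have "Loc.frac q s \<in> carrier LL" using q ps(2) by blast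
      ultimately show "f \<in> PIdl\<^bsub>LL\<^esub> (iota F)" unfolding cgenideal_def by blast
    qed
  qed
  \<comment> \<open>The sign undoes the alternating signs of \<open>generic_poly\<close>, so that
    specialization at \<open>a\<close> returns \<open>F\<close>; monicity gives
    \<open>a 0 = \<one>\<close>.\<close>
  define a where "a i = (if i \<le> n then eps ((-1) ^ i * poly.coeff F' (n - i)) else \<zero>)" for i
  have a: "a i \<in> carrier A" for i by (simp add: a_def)
  have a0: "a 0 = \<one>" by (simp add: a_def coeff_F')
  have an: "a i = \<zero>" if "i > n" for i using that by (simp add: a_def)
  let ?E = "meval A \<phi> a"
  have EF: "upmap ?E (generic_poly n) = F"
    unfolding upmap_generic_poly[of a, OF a a0] F_def
  proof (rule ext)
    fix j
    show "(if j \<le> n then (if even (n - j) then a (n - j) else \<ominus> a (n - j)) else \<zero>) = upmap eps F' j"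
      by (auto simp: a_def coeff_F' upmap_def)
  qed
  interpret E: type_hom A ?E by (rule phi.type_hom_meval) (rule a)
  \<comment> \<open>The counterpart of \<open>th\<close> for coefficients in \<open>k[y]\<close>
    specialized at \<open>a\<close>. It agrees with \<open>th\<close> on powers of \<open>x\<close>
    and kills the generic polynomial, because \<open>F\<close> lies in \<open>I\<close>.\<close>
  define th' where "th' p = pr (iota (upmap ?E p))" for p
  have th': "type_hom Quo th'"
    unfolding th'_def[abs_def]
    by (rule type_hom_comp[OF type_hom_iota[OF E.type_hom_axioms] cring_Quo pr_hom])
  interpret th': type_hom Quo th' by (rule th')
  have th'_pow: "th' ([:0, 1:] ^ j) = xp j" for j
    unfolding th'_def th_def upmap_power_X[OF E.type_hom_axioms] ..
  have th'_const: "th' [:m:] = sc (?E m)" for m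
  proof -
    have "upmap ?E [:m:] = upmap eps [:eps.rep (?E m):]"
      by (auto simp: upmap_def fun_eq_iff coeff_pCons split: nat.split)
    then have "th' [:m:] = th [:eps.rep (?E m):]" unfolding th'_def th_def by simp
    then show ?thesis by (simp add: th_const)
  qed
  have th'_generic: "th' (generic_poly n) = \<zero>\<^bsub>Quo\<^esub>"
    using FI pr_zero_iff[OF iF] unfolding th'_def EF by blast
  \<comment> \<open>In the quotient the specialized matrix \<open>M\<close> describes multiplication
    by the class \<open>w\<close> of \<open>g\<close>. Its inverse \<open>v\<close> has a coordinate
    matrix \<open>W\<close>, and uniqueness of coordinates turns \<open>w v = 1\<close> into
    \<open>W M = 1\<close>, so the determinant is a unit.\<close>
  have units: "?E (generic_norm n g) \<in> Units A" if g: "poly g 0 \<noteq> 0" for g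
  proof -
    obtain M where M: "mult_matrix n (generic_poly n) (map_poly pconst g) M" "generic_norm n g = det M"
      using n by (rule generic_normE)
    have Mc: "M \<in> carrier_mat n n" using M(1) by (simp add: mult_matrix_def)
    let ?s = "upmap \<phi> g"
    have s: "?s \<in> Sx A \<phi>" using g by (auto simp: Sx_eq)
    have sc: "?s \<in> carrier (UP A)" using s by (rule Loc.S_closed)
    define w where "w = pr (iota ?s)"
    define v where "v = pr (Loc.frac \<one>\<^bsub>UP A\<^esub> ?s)"
    have is_c: "iota ?s \<in> carrier LL" "Loc.frac \<one>\<^bsub>UP A\<^esub> ?s \<in> carrier LL" using s sc by blast+
    have w: "w \<in> carrier Quo" and v: "v \<in> carrier Quo" unfolding w_def v_def using is_c by (simp_all only: pr.hom_closed)
    have wv: "w \<otimes>\<^bsub>Quo\<^esub> v = \<one>\<^bsub>Quo\<^esub>"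
      unfolding w_def v_def pr.hom_mult[OF is_c, symmetric] Loc.frac_inverse[OF s] by (rule pr.hom_one)
    have thg: "th' (map_poly pconst g) = w"
      unfolding th'_def w_def
      by (subst upmap_map_poly_pconst) (auto intro: phi.meval_pconst simp: a)
    \<comment> \<open>The defining identity of \<open>mult_matrix\<close> for row \<open>j\<close>,
      read in the quotient, loses its multiple of the generic polynomial.\<close>
    have row: "w \<otimes>\<^bsub>Quo\<^esub> xp j = lin.lc (\<lambda>k. ?E (M $$ (j, k))) xp" if j: "j < n" for j
    proof -
      obtain q where q: "map_poly pconst g * [:0, 1:] ^ j = generic_poly n * q + (\<Sum>k<n. [:M $$ (j, k):] * [:0, 1:] ^ k)"
        using M(1) j unfolding mult_matrix_def by blast
      have "w \<otimes>\<^bsub>Quo\<^esub> xp j = th' (map_poly pconst g * [:0, 1:] ^ j)"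
        by (simp only: th'.hom_mult thg th'_pow)
      also have "\<dots> = \<zero>\<^bsub>Quo\<^esub> \<otimes>\<^bsub>Quo\<^esub> th' q \<oplus>\<^bsub>Quo\<^esub> lin.lc (\<lambda>k. ?E (M $$ (j, k))) xp"
        unfolding q lin.lc_def by (simp only: th'.hom_add th'.hom_mult th'.hom_sum th'_generic th'_const th'_pow)
      also have "\<dots> = lin.lc (\<lambda>k. ?E (M $$ (j, k))) xp" by simp
      finally show ?thesis .
    qed
    have "\<forall>i. \<exists>d. (\<forall>j<n. d j \<in> carrier A) \<and> v \<otimes>\<^bsub>Quo\<^esub> xp i = lin.lc d xp"
      using fa.coordsE[OF Qc.m_closed[OF v th.closed]] by metis
    then obtain W where W: "\<And>i j. j < n \<Longrightarrow> W i j \<in> carrier A" and Wx: "\<And>i. v \<otimes>\<^bsub>Quo\<^esub> xp i = lin.lc (W i) xp"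
      by metis
    have "?E (det M) \<in> Units A"
    proof (rule eps.det_unit[OF E.type_hom_axioms Mc, where W = W])
      show "W i j \<in> carrier A" if "i < n" "j < n" for i j using that(2) by (rule W)
      fix i k assume ik: "i < n" "k < n"
      have "lin.lc (\<lambda>k. if i = k then \<one> else \<zero>) xp = xp i"
        using lin.lc_delta[of i \<one> xp] ik by simp
      also have "\<dots> = w \<otimes>\<^bsub>Quo\<^esub> (v \<otimes>\<^bsub>Quo\<^esub> xp i)"
        using w v wv by (simp add: Qc.m_assoc[symmetric])
      also have "\<dots> = lin.lc (W i) (\<lambda>j. w \<otimes>\<^bsub>Quo\<^esub> xp j)"
        unfolding Wx by (rule lin.lc_mult) (auto simp: w W)
      also have "\<dots> = lin.lc (\<lambda>k. \<Oplus>j\<in>{..<n}. W i j \<otimes> ?E (M $$ (j, k))) xp"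
        by (rule lin.lc_comp) (auto simp: W row)
      finally have "lin.lc (\<lambda>k. if i = k then \<one> else \<zero>) xp = lin.lc (\<lambda>k. \<Oplus>j\<in>{..<n}. W i j \<otimes> ?E (M $$ (j, k))) xp" .
      then have "(if i = k then \<one> else \<zero>) = (\<Oplus>j\<in>{..<n}. W i j \<otimes> ?E (M $$ (j, k)))"
        by (intro fa.coords_unique[where i = k, OF _ _ _ ik(2)]) (auto simp: W intro!: A.finsum_closed)
      then show "(\<Oplus>j\<in>{..<n}. W i j \<otimes> ?E (M $$ (j, k))) = (if i = k then \<one> else \<zero>)" by simp
    qed
    then show ?thesis by (simp add: M(2))
  qed
  obtain \<psi> where psi: "\<psi> \<in> HomH n A \<phi>" and psi_s: "\<And>i. \<psi> (Hn_s n i) = a i"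
    using HomH_exists[OF a a0 an units] by metis
  have "Fpoly n A \<psi> = F" unfolding Fpoly_eq[OF psi] psi_s EF ..
  then have "Fmap n A \<phi> \<psi> = I" using Fmap_eq_PIdl(1)[OF psi] \<open>PIdl\<^bsub>LL\<^esub> (iota F) = I\<close> by simp
  with psi show ?thesis by (rule that)
qed

end

section \<open>Bijectivity of \<open>Fmap\<close>\<close>

context kalgebra
begin

lemma Fmap_bij: "bij_betw (Fmap n A \<phi>) (HomH n A \<phi>) (Hilb n A \<phi>)"
  unfolding bij_betw_def
proof (intro conjI Fmap_inj subset_antisym subsetI)
  fix I assume "I \<in> Fmap n A \<phi> ` HomH n A \<phi>"
  then show "I \<in> Hilb n A \<phi>" using Fmap_Hilb by blast
next
  fix I assume I: "I \<in> Hilb n A \<phi>"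
  then interpret hilb_ideal A \<phi> n I
    by (intro hilb_ideal.intro hilb_ideal_axioms.intro kalgebra_axioms) (simp add: Hilb_def Lx_def)
  have "power_basis I" using I by (intro free_power_basis) (simp add: Hilb_def)
  then obtain \<psi> where "\<psi> \<in> HomH n A \<phi>" "Fmap n A \<phi> \<psi> = I" by (rule power_basis_surj)
  then show "I \<in> Fmap n A \<phi> ` HomH n A \<phi>" by blast
qed

end

section \<open>Naturality\<close>

text \<open>The polynomial of the composite homomorphism is obtained by applying \<open>h\<close> to
  the coefficients. The image of the principal ideal contains this new generator and consists of
  multiples of it, so both ideals are equal.\<close>

lemma Fmap_natural:
  fixes A :: "('a,'m) ring_scheme" and \<phi>A :: "'k::field \<Rightarrow> 'a" and B :: "('b,'o) ring_scheme"
  assumes A: "kalgebra A \<phi>A n" and B: "kalgebra B \<phi>B n" and h: "kalg_hom A \<phi>A B \<phi>B h"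
    and psi: "\<psi> \<in> HomH n A \<phi>A"
  shows "Fmap n B \<phi>B (restrict (h \<circ> \<psi>) (carrier (Hn n))) = Hilb_map B \<phi>B h (Fmap n A \<phi>A \<psi>)"
proof -
  interpret A: kalgebra A \<phi>A n by (rule A)
  interpret B: kalgebra B \<phi>B n by (rule B)
  have hom: "h \<in> ring_hom A B" and h_alg: "\<And>c. h (\<phi>A c) = \<phi>B c"
    using h by (auto simp: kalg_hom_def)
  interpret he: type_hom B "\<lambda>r. h (A.eps r)"
    by (rule type_hom_comp[OF A.eps.type_hom_axioms B.A.is_cring hom])
  interpret hP: type_hom "UP B" "upmap (\<lambda>r. h (A.eps r))" by (rule type_hom_upmap) (rule he.type_hom_axioms)
  define hp where "hp = (\<lambda>(p :: nat \<Rightarrow> 'a) i. h (p i))"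
  have hp_eps: "hp (upmap A.eps p) = upmap (\<lambda>r. h (A.eps r)) p" for p
    by (simp add: hp_def upmap_def)
  \<comment> \<open>Polynomials over \<open>A\<close> are lifted along \<open>eps\<close>; on lifts,
    \<open>hp\<close> becomes \<open>upmap\<close> for \<open>h\<close> composed with
    \<open>eps\<close>, which is known to be a homomorphism.\<close>
  have hp_hom: "hp \<in> ring_hom (UP A) (UP B)"
  proof (rule ring_hom_memI)
    fix p assume "p \<in> carrier (UP A)"
    then obtain p' where p': "p = upmap A.eps p'" by (metis A.up_lift)
    show "hp p \<in> carrier (UP B)" unfolding p' hp_eps by (rule hP.closed)
    fix q assume "q \<in> carrier (UP A)"
    then obtain q' where q': "q = upmap A.eps q'" by (metis A.up_lift)
    show "hp (p \<otimes>\<^bsub>UP A\<^esub> q) = hp p \<otimes>\<^bsub>UP B\<^esub> hp q"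
      unfolding p' q' A.epsP.hom_mult[symmetric] hp_eps by (rule hP.hom_mult)
    show "hp (p \<oplus>\<^bsub>UP A\<^esub> q) = hp p \<oplus>\<^bsub>UP B\<^esub> hp q"
      unfolding p' q' A.epsP.hom_add[symmetric] hp_eps by (rule hP.hom_add)
  next
    show "hp \<one>\<^bsub>UP A\<^esub> = \<one>\<^bsub>UP B\<^esub>" unfolding A.epsP.hom_one[symmetric] hp_eps by (rule hP.hom_one)
  qed
  have hp_S: "hp ` Sx A \<phi>A \<subseteq> Sx B \<phi>B"
    by (auto simp: Sx_eq hp_def upmap_def h_alg)
  let ?lm = "loc_map (UP B) (Sx B \<phi>B) hp"
  have lm: "?lm (A.Loc.frac p s) = B.Loc.frac (hp p) (hp s)" if "p \<in> carrier (UP A)" "s \<in> Sx A \<phi>A" for p s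
    by (rule A.Loc.loc_map_frac[OF B.mult_set_Sx hp_hom hp_S that])
  let ?psi' = "restrict (h \<circ> \<psi>) (carrier (Hn n))" and ?F = "Fpoly n A \<psi>"
  have Fc: "?F \<in> carrier (UP A)" using A.Fmap_eq_PIdl(2)[OF psi] by blast
  have hF: "hp ?F \<in> carrier (UP B)" using hp_hom Fc by (rule ring_hom_closed)
  \<comment> \<open>The restriction of the composite to the carrier therefore does not affect the
    coefficients of its polynomial.\<close>
  have "Hn_s n i \<in> carrier (Hn n :: ('k mpoly \<times> 'k mpoly) set ring)" for i
    unfolding Hn_s_def Hn_def by (rule A.H.frac_closed) auto
  then have F': "Fpoly n B ?psi' = hp ?F"
  proof -
    interpret h: ring_hom_cring A B h by unfold_locales (rule hom)
    show ?thesis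
      using \<open>\<And>i. Hn_s n i \<in> carrier (Hn n)\<close> A.HomH_eval(1)[OF psi]
      by (auto simp: Fpoly_def hp_def fun_eq_iff h.hom_a_inv)
  qed
  have lmF: "?lm (A.iota ?F) = B.iota (hp ?F)"
    using lm[OF Fc A.Loc.S_one] ring_hom_one[OF hp_hom] by simp
  have iF: "A.iota ?F \<in> carrier A.LL" and ihF: "B.iota (hp ?F) \<in> carrier B.LL"
    using Fc hF by blast+
  have image: "?lm ` Fmap n A \<phi>A \<psi> \<subseteq> PIdl\<^bsub>B.LL\<^esub> (B.iota (hp ?F))"
  proof
    fix y assume "y \<in> ?lm ` Fmap n A \<phi>A \<psi>"
    then obtain x where x: "x \<in> carrier A.LL" and y: "y = ?lm (x \<otimes>\<^bsub>A.LL\<^esub> A.iota ?F)"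
      unfolding A.Fmap_eq_PIdl(1)[OF psi] cgenideal_def by blast
    obtain p s where p: "p \<in> carrier (UP A)" and s: "s \<in> Sx A \<phi>A" and xps: "x = A.Loc.frac p s"
      using x by (rule A.Loc.locE)
    have hps: "hp p \<in> carrier (UP B)" "hp s \<in> Sx B \<phi>B" using ring_hom_closed[OF hp_hom p] hp_S s by blast+
    have "y = ?lm (A.Loc.frac (p \<otimes>\<^bsub>UP A\<^esub> ?F) s)"
      unfolding y xps using p s Fc by (simp add: A.Loc.loc_mult)
    also have "\<dots> = B.Loc.frac (hp p \<otimes>\<^bsub>UP B\<^esub> hp ?F) (hp s)"
      unfolding lm[OF A.P.m_closed[OF p Fc] s] ring_hom_mult[OF hp_hom p Fc] ..
    also have "\<dots> = B.Loc.frac (hp p) (hp s) \<otimes>\<^bsub>B.LL\<^esub> B.iota (hp ?F)"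
      using hps hF by (simp add: B.Loc.loc_mult)
    finally show "y \<in> PIdl\<^bsub>B.LL\<^esub> (B.iota (hp ?F))"
      unfolding cgenideal_def using hps by blast
  qed
  have "Fmap n B \<phi>B ?psi' = PIdl\<^bsub>B.LL\<^esub> (B.iota (hp ?F))"
    unfolding Fmap_def F' Lx_def by (rule B.Loc.L.cgenideal_eq_genideal[OF ihF, symmetric])
  also have "\<dots> = genideal B.LL (?lm ` Fmap n A \<phi>A \<psi>)"
  proof
    have "PIdl\<^bsub>B.LL\<^esub> (B.iota (hp ?F)) \<subseteq> carrier B.LL"
      using ideal.Icarr[OF B.Loc.L.cgenideal_ideal[OF ihF]] by blast
    then have sub: "?lm ` Fmap n A \<phi>A \<psi> \<subseteq> carrier B.LL" using image by blast
    have "A.iota ?F \<in> Fmap n A \<phi>A \<psi>"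
      unfolding A.Fmap_eq_PIdl(1)[OF psi] by (rule A.Loc.L.cgenideal_self[OF iF])
    then have "B.iota (hp ?F) \<in> ?lm ` Fmap n A \<phi>A \<psi>" unfolding lmF[symmetric] by (rule imageI)
    then have "B.iota (hp ?F) \<in> genideal B.LL (?lm ` Fmap n A \<phi>A \<psi>)"
      using B.Loc.L.genideal_self[OF sub] by blast
    then show "PIdl\<^bsub>B.LL\<^esub> (B.iota (hp ?F)) \<subseteq> genideal B.LL (?lm ` Fmap n A \<phi>A \<psi>)"
      by (rule B.Loc.L.cgenideal_minimal[OF B.Loc.L.genideal_ideal[OF sub]])
    show "genideal B.LL (?lm ` Fmap n A \<phi>A \<psi>) \<subseteq> PIdl\<^bsub>B.LL\<^esub> (B.iota (hp ?F))"
      by (rule B.Loc.L.genideal_minimal[OF B.Loc.L.cgenideal_ideal[OF ihF] image])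
  qed
  finally show ?thesis unfolding Hilb_map_def Lx_def hp_def .
qed

theorem theorem4p4:
  fixes n :: nat
    and A :: "('a,'m) ring_scheme" and \<phi>A :: "'k::field \<Rightarrow> 'a"
    and B :: "('b,'o) ring_scheme" and \<phi>B :: "'k \<Rightarrow> 'b"
  assumes "n \<ge> 1"
    and "cring A" and "\<phi>A \<in> ring_hom type_ring A"
    and "cring B" and "\<phi>B \<in> ring_hom type_ring B"
  shows "(\<forall>\<psi>\<in>HomH n A \<phi>A. Fmap n A \<phi>A \<psi> \<in> Hilb n A \<phi>A)
       \<and> bij_betw (Fmap n A \<phi>A) (HomH n A \<phi>A) (Hilb n A \<phi>A)
       \<and> (\<forall>h. kalg_hom A \<phi>A B \<phi>B h \<longrightarrow>
            (\<forall>\<psi>\<in>HomH n A \<phi>A.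
               Fmap n B \<phi>B (restrict (h \<circ> \<psi>) (carrier (Hn n))) = Hilb_map B \<phi>B h (Fmap n A \<phi>A \<psi>)))"
proof -
  have A: "kalgebra A \<phi>A n" and B: "kalgebra B \<phi>B n"
    using assms by (auto intro!: kalgebra.intro kalgebra_axioms.intro)
  show ?thesis
    using kalgebra.Fmap_Hilb[OF A] kalgebra.Fmap_bij[OF A] Fmap_natural[OF A B] by blast
qed

end
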